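(* Let $\mathcal P$ be a hereditary permutation property and let $\epsilon>0$. For $\eta>0$ put $$M_1(\eta)=\left\lceil\frac{2000\,C}{\eta}\bigl(\log_2(\eta/2)\bigr)^2\right\rceil,\qquad M_2(\eta)=\left\lceil\frac{20000}{\eta^2}\right\rceil,\qquad n_0(M,\eta)=\left\lceil\frac{32M^5k^*(M)}{\eta^3}\right\rceil,$$ where $C=1000\,c(\sigma)$ and $c(\sigma)$ is the Füredi–Hajnal constant of a smallest permutation $\sigma\notin\mathcal P$. Let $$M'=\min\bigl(n_0(M_1(\epsilon/2),\epsilon/2),\;n_0(M_2(\epsilon/2),\epsilon/2)\bigr).$$ Then there is a one-sided tester for $\mathcal P$ with respect to the planar tau distance, with parameter $\epsilon$ and query complexity $M'$, for permutations of length at least $M'$.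
   Context: A permutation $\pi$ of length $n=|\pi|\ge1$ is a bijection $[n]\to[n]$, $[n]=\{1,\dots,n\}$. A permutation $\sigma$ of length $k$ is a subpermutation of $\pi$ if there are $i_1<\dots<i_k$ in $[n]$ with $\pi(i_j)<\pi(i_\ell)$ iff $\sigma(j)<\sigma(\ell)$. A permutation property is a family $\mathcal P$ of permutations; it is hereditary if every subpermutation of a member is a member. If $\mathcal P$ consists of all permutations (so no $\sigma$ exists), $M'$ is interpreted as $\infty$ and the assertion is vacuous, as it is whenever $M'=\infty$. Blow-ups. A permutation $\alpha'$ is a blow-up of $\alpha$ if there are integers $1=k_1<k_2<\dots<k_{|\alpha|+1}=|\alpha'|+1$ such that whenever $k_{j_1}\le i_1<k_{j_1+1}$ and $k_{j_2}\le i_2<k_{j_2+1}$ with $j_1\ne j_2$, one has $\alpha'(i_1)>\alpha'(i_2)$ iff $\alpha(j_1)>\alpha(j_2)$. The $j$-th block has size $k_{j+1}-k_j$; the pattern inside each block is arbitrary. A $k$-blow-up is a blow-up in which every block has size $k$. For a permutation $\alpha$, $k^*(\alpha)$ is the least positive integer $k$ such that no $k$-blow-up of $\alpha$ is in $\mathcal P$, and $k^*(\alpha)=\infty$ if there is none. For a positive integer $T$, $k^*(T)$ is the maximum of $k^*(\alpha)$ over permutations $\alpha$ of length $T$ with $k^*(\alpha)<\infty$, and $k^*(T)=\infty$ if there is no such $\alpha$. (Convention: $n_0(0,\eta)=0$.) Füredi–Hajnal constant. A $0$-$1$ matrix $A$ contains a $0$-$1$ matrix $B$ if $A$ has a submatrix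 $A'$ of the same size as $B$ with a one in every position where $B$ has a one. $\mathrm{ex}(n,\sigma)$ is the maximum number of ones in an $n\times n$ $0$-$1$ matrix not containing the permutation matrix of $\sigma$, and $c(\sigma)=\lim_{n\to\infty}\mathrm{ex}(n,\sigma)/n$ (this limit is known to exist and be finite, with $\mathrm{ex}(n,\sigma)\le c(\sigma)n$ for all $n$). Planar tau distance. $\sigma$ is obtained from $\pi$ (both of length $n$) by a planar simple transposition if for some $1\le i\le n-1$ either $\sigma$ equals $\pi$ except $\sigma(i)=\pi(i+1)$, $\sigma(i+1)=\pi(i)$, or $\sigma^{-1}$ equals $\pi^{-1}$ except $\sigma^{-1}(i)=\pi^{-1}(i+1)$, $\sigma^{-1}(i+1)=\pi^{-1}(i)$. $\rho_{\mathrm{PT}}(\pi_1,\pi_2)$ is $1/\binom n2$ times the minimum number of planar simple transpositions transforming $\pi_1$ into $\pi_2$ (and $0$ if $n=1$). The distance of $\pi$ from $\mathcal P$ is $\min\rho_{\mathrm{PT}}(\pi,\pi_0)$ over $\pi_0\in\mathcal P$ with $|\pi_0|=|\pi|$, and is $1$ if there is no such $\pi_0$; $\pi$ is $\epsilon$-far from $\mathcal P$ if this distance is greater than $\epsilon$. Testers. A one-sided tester for $\mathcal P$ (with parameter $\epsilon$) of query complexity $q$, for permutations of length at least $n_0$, is a randomized algorithm (which may depend on $\mathcal P$ and $\epsilon$; only queries are counted) that, for each permutation $\pi$ of length $n\ge n_0$, queries at most $q$ positions of $\pi$ and outputs either "$\pi\in\mathcal P$" or "$\pi\notin\mathcal P$",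 such that: if $\pi\in\mathcal P$ it always outputs "$\pi\in\mathcal P$", and if $\pi$ is $\epsilon$-far from $\mathcal P$ it outputs "$\pi\notin\mathcal P$" with probability at least $2/3$. *)

theory Defs
  imports "HOL-Probability.Probability_Mass_Function" "HOL-Combinatorics.Permutations"
begin

section \<open>Permutations and hereditary properties\<close>

text \<open>The pair \<open>(n, \<pi>)\<close> is the permutation \<open>\<pi>\<close> of length \<open>n\<close>; by \<open>permutes\<close>,
  \<open>\<pi>\<close> is the identity outside \<open>{1..n}\<close>, so every permutation has exactly one such encoding.\<close>

type_synonym perm = "nat \<times> (nat \<Rightarrow> nat)"

abbreviation len :: "perm \<Rightarrow> nat" where "len \<equiv> fst"

abbreviation app :: "perm \<Rightarrow> nat \<Rightarrow> nat" where "app \<equiv> snd"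

definition perms :: "perm set" where
  "perms = {\<pi>. 1 \<le> len \<pi> \<and> app \<pi> permutes {1..len \<pi>}}"

definition subpermutation :: "perm \<Rightarrow> perm \<Rightarrow> bool" where
  "subpermutation \<sigma> \<pi> \<longleftrightarrow>
     (\<exists>f. strict_mono_on {1..len \<sigma>} f \<and> f ` {1..len \<sigma>} \<subseteq> {1..len \<pi>} \<and>
        (\<forall>j\<in>{1..len \<sigma>}. \<forall>l\<in>{1..len \<sigma>}.
           app \<pi> (f j) < app \<pi> (f l) \<longleftrightarrow> app \<sigma> j < app \<sigma> l))"

definition permutation_property :: "perm set \<Rightarrow> bool" where
  "permutation_property P \<longleftrightarrow> P \<subseteq> perms"

definition hereditary :: "perm set \<Rightarrow> bool" where
  "hereditary P \<longleftrightarrow> (\<forall>\<pi>\<in>P. \<forall>\<sigma>\<in>perms. subpermutation \<sigma> \<pi> \<longrightarrow> \<sigma> \<in> P)"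

definition smallest_excluded :: "perm set \<Rightarrow> perm \<Rightarrow> bool" where
  "smallest_excluded P \<sigma> \<longleftrightarrow> \<sigma> \<in> perms - P \<and> (\<forall>\<tau>\<in>perms - P. len \<sigma> \<le> len \<tau>)"

section \<open>Blow-ups\<close>

text \<open>\<open>b 1 < \<dots> < b (len \<alpha> + 1)\<close> are the block boundaries; block \<open>j\<close> is \<open>{b j..<b (j + 1)}\<close>.\<close>

definition blow_up_via :: "(nat \<Rightarrow> nat) \<Rightarrow> perm \<Rightarrow> perm \<Rightarrow> bool" where
  "blow_up_via b \<alpha> \<alpha>' \<longleftrightarrow>
     b 1 = 1 \<and> b (len \<alpha> + 1) = len \<alpha>' + 1 \<and> strict_mono_on {1..len \<alpha> + 1} b \<and>
     (\<forall>j1\<in>{1..len \<alpha>}. \<forall>j2\<in>{1..len \<alpha>}. j1 \<noteq> j2 \<longrightarrow>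
        (\<forall>i1\<in>{b j1..<b (j1 + 1)}. \<forall>i2\<in>{b j2..<b (j2 + 1)}.
           app \<alpha>' i1 > app \<alpha>' i2 \<longleftrightarrow> app \<alpha> j1 > app \<alpha> j2))"

definition k_blow_up :: "nat \<Rightarrow> perm \<Rightarrow> perm \<Rightarrow> bool" where
  "k_blow_up k \<alpha> \<alpha>' \<longleftrightarrow>
     (\<exists>b. blow_up_via b \<alpha> \<alpha>' \<and> (\<forall>j\<in>{1..len \<alpha>}. b (j + 1) - b j = k))"

definition no_k_blow_up_in :: "perm set \<Rightarrow> perm \<Rightarrow> nat \<Rightarrow> bool" where
  "no_k_blow_up_in P \<alpha> k \<longleftrightarrow> \<not> (\<exists>\<alpha>'\<in>perms. k_blow_up k \<alpha> \<alpha>' \<and> \<alpha>' \<in> P)"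

definition kstar_perm :: "perm set \<Rightarrow> perm \<Rightarrow> enat" where
  "kstar_perm P \<alpha> =
     (if \<exists>k\<ge>1. no_k_blow_up_in P \<alpha> k
      then enat (LEAST k. 1 \<le> k \<and> no_k_blow_up_in P \<alpha> k) else \<infinity>)"

definition kstar :: "perm set \<Rightarrow> nat \<Rightarrow> enat" where
  "kstar P T =
     (let S = {kstar_perm P \<alpha> |\<alpha>. \<alpha> \<in> perms \<and> len \<alpha> = T \<and> kstar_perm P \<alpha> < \<infinity>}
      in if S = {} then \<infinity> else Max S)"

section \<open>The Fueredi--Hajnal constant\<close>

text \<open>An \<open>m \<times> n\<close> matrix is a function read only on \<open>{1..m} \<times> {1..n}\<close>.\<close>

definition zero_one_matrix :: "nat \<Rightarrow> nat \<Rightarrow> (nat \<Rightarrow> nat \<Rightarrow> nat) \<Rightarrow> bool" where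
  "zero_one_matrix m n A \<longleftrightarrow> (\<forall>i\<in>{1..m}. \<forall>j\<in>{1..n}. A i j \<in> {0, 1})"

definition num_ones :: "nat \<Rightarrow> nat \<Rightarrow> (nat \<Rightarrow> nat \<Rightarrow> nat) \<Rightarrow> nat" where
  "num_ones m n A = card {(i, j). i \<in> {1..m} \<and> j \<in> {1..n} \<and> A i j = 1}"

text \<open>The submatrix is given by its increasing row selection \<open>r\<close> and column selection \<open>c\<close>.\<close>

definition matrix_contains ::
  "nat \<Rightarrow> nat \<Rightarrow> (nat \<Rightarrow> nat \<Rightarrow> nat) \<Rightarrow> nat \<Rightarrow> nat \<Rightarrow> (nat \<Rightarrow> nat \<Rightarrow> nat) \<Rightarrow> bool" where
  "matrix_contains m n A k l B \<longleftrightarrow>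
     (\<exists>r c. strict_mono_on {1..k} r \<and> r ` {1..k} \<subseteq> {1..m} \<and>
            strict_mono_on {1..l} c \<and> c ` {1..l} \<subseteq> {1..n} \<and>
            (\<forall>i\<in>{1..k}. \<forall>j\<in>{1..l}. B i j = 1 \<longrightarrow> A (r i) (c j) = 1))"

definition perm_matrix :: "perm \<Rightarrow> nat \<Rightarrow> nat \<Rightarrow> nat" where
  "perm_matrix \<sigma> i j = (if app \<sigma> i = j then 1 else 0)"

definition ex_ones :: "nat \<Rightarrow> perm \<Rightarrow> nat" where
  "ex_ones n \<sigma> =
     Max {num_ones n n A |A. zero_one_matrix n n A \<and>
            \<not> matrix_contains n n A (len \<sigma>) (len \<sigma>) (perm_matrix \<sigma>)}"

definition fh_const :: "perm \<Rightarrow> real" where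
  "fh_const \<sigma> = lim (\<lambda>n. real (ex_ones n \<sigma>) / real n)"

section \<open>Planar tau distance\<close>

text \<open>\<open>inv \<sigma>\<close> carries no information unless \<open>\<sigma>\<close> is bijective, hence the explicit
  \<open>permutes\<close> condition on \<open>\<sigma>\<close>.\<close>

definition planar_simple_transposition :: "nat \<Rightarrow> (nat \<Rightarrow> nat) \<Rightarrow> (nat \<Rightarrow> nat) \<Rightarrow> bool" where
  "planar_simple_transposition n \<pi> \<sigma> \<longleftrightarrow> \<sigma> permutes {1..n} \<and>
     (\<exists>i. 1 \<le> i \<and> i + 1 \<le> n \<and>
        (\<sigma> = \<pi>(i := \<pi> (i + 1), i + 1 := \<pi> i) \<or>
         inv \<sigma> = (inv \<pi>)(i := inv \<pi> (i + 1), i + 1 := inv \<pi> i)))"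

definition rho_PT :: "nat \<Rightarrow> (nat \<Rightarrow> nat) \<Rightarrow> (nat \<Rightarrow> nat) \<Rightarrow> real" where
  "rho_PT n \<pi>1 \<pi>2 =
     (if n = 1 then 0
      else real (LEAST d. (planar_simple_transposition n ^^ d) \<pi>1 \<pi>2) / real (n choose 2))"

definition dist_PT :: "perm \<Rightarrow> perm set \<Rightarrow> real" where
  "dist_PT \<pi> P =
     (let D = {rho_PT (len \<pi>) (app \<pi>) (app \<pi>0) |\<pi>0. \<pi>0 \<in> P \<and> len \<pi>0 = len \<pi>}
      in if D = {} then 1 else Min D)"

definition eps_far :: "real \<Rightarrow> perm \<Rightarrow> perm set \<Rightarrow> bool" where
  "eps_far \<epsilon> \<pi> P \<longleftrightarrow> dist_PT \<pi> P > \<epsilon>"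

section \<open>Testers\<close>

datatype verdict = In_Property | Not_In_Property

text \<open>A deterministic adaptive query algorithm: \<open>Query i f\<close> asks for \<open>\<pi> i\<close> and goes on with
  \<open>f (\<pi> i)\<close>. A randomized algorithm, which is told the length \<open>n\<close> of the input, is a random
  choice of such an algorithm for every \<open>n\<close>.\<close>

datatype query_alg = Output verdict | Query nat "nat \<Rightarrow> query_alg"

primrec run :: "query_alg \<Rightarrow> (nat \<Rightarrow> nat) \<Rightarrow> verdict" where
  "run (Output v) \<pi> = v"
| "run (Query i f) \<pi> = run (f (\<pi> i)) \<pi>"

primrec queries :: "query_alg \<Rightarrow> (nat \<Rightarrow> nat) \<Rightarrow> nat list" where
  "queries (Output v) \<pi> = []"
| "queries (Query i f) \<pi> = i # queries (f (\<pi> i)) \<pi>"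

type_synonym randomized_alg = "nat \<Rightarrow> query_alg pmf"

definition one_sided_tester ::
  "perm set \<Rightarrow> real \<Rightarrow> nat \<Rightarrow> nat \<Rightarrow> randomized_alg \<Rightarrow> bool" where
  "one_sided_tester P \<epsilon> q n0 A \<longleftrightarrow>
     (\<forall>\<pi>\<in>perms. n0 \<le> len \<pi> \<longrightarrow>
        (\<forall>t\<in>set_pmf (A (len \<pi>)).
           length (queries t (app \<pi>)) \<le> q \<and> set (queries t (app \<pi>)) \<subseteq> {1..len \<pi>}) \<and>
        (\<pi> \<in> P \<longrightarrow> (\<forall>t\<in>set_pmf (A (len \<pi>)). run t (app \<pi>) = In_Property)) \<and>
        (eps_far \<epsilon> \<pi> P \<longrightarrow>
           measure_pmf.prob (A (len \<pi>)) {t. run t (app \<pi>) = Not_In_Property} \<ge> 2 / 3))"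

section \<open>The bounds\<close>

definition M1 :: "real \<Rightarrow> real \<Rightarrow> nat" where
  "M1 C \<eta> = nat \<lceil>2000 * C / \<eta> * (log 2 (\<eta> / 2))\<^sup>2\<rceil>"

definition M2 :: "real \<Rightarrow> nat" where
  "M2 \<eta> = nat \<lceil>20000 / \<eta>\<^sup>2\<rceil>"

definition n_zero :: "perm set \<Rightarrow> nat \<Rightarrow> real \<Rightarrow> enat" where
  "n_zero P M \<eta> =
     (if M = 0 then 0
      else case kstar P M of
             enat k \<Rightarrow> enat (nat \<lceil>32 * real M ^ 5 * real k / \<eta> ^ 3\<rceil>)
           | \<infinity> \<Rightarrow> \<infinity>)"

end

theory Submission
  imports Defs
begin

text \<open>
  The tester queries a uniformly random set \<open>S\<close> of \<open>M'\<close> positions and accepts iff the induced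
  pattern \<open>\<beta>\<close> is in \<open>P\<close>.  Heredity makes this one-sided.  For soundness, cut positions and values
  into dyadic grids down to cells of side about \<open>\<epsilon> n / 32\<close>.  With probability at least \<open>2 / 3\<close> the
  cell densities of \<open>S\<close> are close to those of \<open>\<pi>\<close>, by a second moment computation.  Call a cell of
  any scale heavy if it contains at least a fraction \<open>1 / M\<close> of \<open>S\<close>.  There are at most \<open>M\<close>
  inclusion-minimal heavy cells, since these are disjoint, and one can select in them \<open>M\<close> boxes in
  distinct rows and columns, each containing \<open>k\<^sup>*(M)\<close> points of \<open>S\<close>.  If \<open>\<beta>\<close> is in \<open>P\<close>, the boxes
  form a blow-up in \<open>P\<close> of a permutation \<open>\<alpha>\<close> of length \<open>M\<close>, so \<open>k\<^sup>*(\<alpha>)\<close> is infinite, and \<open>P\<close>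
  contains blow-ups of \<open>\<alpha>\<close> with arbitrary block sizes.  Moving every point of \<open>\<pi>\<close> to the nearest
  box turns \<open>\<pi>\<close> into such a blow-up, and the number of planar transpositions needed is at most twice
  the total displacement.  A point is moved far only if its cells are light down from a coarse
  scale, and at scale \<open>2 ^ -l\<close> the light cells carry at most a fraction \<open>K\<^sub>l / M\<close> of \<open>S\<close>, where
  \<open>K\<^sub>l\<close> is the number of occupied cells.  Always \<open>K\<^sub>l \<le> 4 ^ l\<close>, which suffices for \<open>M\<^sub>2\<close>; since the
  occupied cells avoid the permutation matrix of \<open>\<sigma>\<close>, also \<open>K\<^sub>l \<le> c(\<sigma>) 2 ^ l\<close>, which suffices
  for \<open>M\<^sub>1\<close>.
\<close>

section \<open>Enumerations and standardization\<close>

text \<open>Two grids are at work. Displacements are measured in the dyadic grid on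
  \<open>\<pi>\<close>, but different minimal heavy cells may share dyadic rows or columns, and then
  their points need not be ordered like the cells. The boxes are therefore cut by
  \<open>N = 4 * M\<^sup>2\<close> strips in the ranks of the sample. A strip holds at most
  \<open>m div N + 1\<close> of the \<open>m\<close> sample points, so the strips already used
  cannot exhaust a heavy cell, and distinct strips make the order between boxes independent of the
  points chosen in them. This selection costs \<open>32 * M ^ 5 * k\<close> points, the main part of
  the threshold; its denominator \<open>\<eta> ^ 3\<close>, with
  \<open>M \<ge> 40000 / \<eta>\<close>, leaves enough points for the second moment bound. Heavy
  cells of all scales are used because a point then pays only for the smallest heavy cell around it.
  The second moment is needed at the finest scale alone: a coarser cell is a union of finest cells,
  so one bound on the sum of absolute deviations serves every scale. Exactly \<open>M\<close> boxes
  are chosen because \<open>kstar P M\<close> concerns patterns of length \<open>M\<close>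
  only.\<close>

lemma strict_mono_onI':
  assumes "\<And>i j. i \<in> A \<Longrightarrow> j \<in> A \<Longrightarrow> i < j \<Longrightarrow> f i < f j"
  shows "strict_mono_on A f"
  using assms by (auto simp: strict_mono_on_def)

lemma sorted_list_of_set_enum:
  assumes "finite S" "card S = m"
  defines "f \<equiv> \<lambda>x. sorted_list_of_set S ! (x - 1)"
  shows "strict_mono_on {1..m} f" "f ` {1..m} = S"
proof -
  have len: "length (sorted_list_of_set S) = m" using assms by simp
  show "strict_mono_on {1..m} f"
  proof (rule strict_mono_onI')
    fix i j assume "i \<in> {1..m}" "j \<in> {1..m}" "i < j"
    then show "f i < f j"
      unfolding f_def using strict_sorted_list_of_set[of S] len
      by (intro sorted_wrt_nth_less[of "(<)"]) auto
  qed
  have "f ` {1..m} = (!) (sorted_list_of_set S) ` ((\<lambda>x. x - 1) ` {1..m})"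
    unfolding f_def image_image ..
  also have "(\<lambda>x. x - 1) ` {1..m} = {..<length (sorted_list_of_set S)}"
    unfolding len by (auto simp: image_iff intro!: bexI[of _ "Suc _"])
  also have "(!) (sorted_list_of_set S) ` {..<length (sorted_list_of_set S)} = S"
    using assms(1) by (metis list.set_map map_nth set_sorted_list_of_set lessThan_atLeast0 atLeast_upt)
  finally show "f ` {1..m} = S" .
qed

lemma finite_set_enum:
  fixes J :: "nat set"
  assumes "finite J"
  obtains e where "strict_mono_on {1..card J} e" "e ` {1..card J} = J"
  using sorted_list_of_set_enum[OF assms refl] by blast

lemma standardization:
  fixes g :: "nat \<Rightarrow> nat"
  assumes "inj_on g {1..n}"
  obtains \<rho> where "\<rho> permutes {1..n}"
    "\<forall>i\<in>{1..n}. \<forall>j\<in>{1..n}. \<rho> i < \<rho> j \<longleftrightarrow> g i < g j"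
proof -
  \<comment> \<open>The rank of \<open>g i\<close> among the values; the identity outside
    \<open>{1..n}\<close>, as \<open>permutes\<close> demands.\<close>
  define r where "r = (\<lambda>i. if i \<in> {1..n} then card {j \<in> {1..n}. g j \<le> g i} else i)"
  have less: "r i < r j" if "i \<in> {1..n}" "j \<in> {1..n}" "g i < g j" for i j
  proof -
    have "j \<in> {l \<in> {1..n}. g l \<le> g j}" "j \<notin> {l \<in> {1..n}. g l \<le> g i}"
      "{l \<in> {1..n}. g l \<le> g i} \<subseteq> {l \<in> {1..n}. g l \<le> g j}"
      using that by auto
    then have "{l \<in> {1..n}. g l \<le> g i} \<subset> {l \<in> {1..n}. g l \<le> g j}" by blast
    then show ?thesis using that by (simp add: r_def psubset_card_mono)
  qed
  have iff: "r i < r j \<longleftrightarrow> g i < g j" if ij: "i \<in> {1..n}" "j \<in> {1..n}" for i j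
  proof -
    consider "g i < g j" | "g j < g i" | "i = j"
      using assms ij by (meson inj_onD linorder_neqE)
    then show ?thesis using less[of i j] less[of j i] that by cases auto
  qed
  have inj: "inj_on r {1..n}"
  proof (rule inj_onI)
    fix i j assume "i \<in> {1..n}" "j \<in> {1..n}" "r i = r j"
    then show "i = j" using iff[of i j] iff[of j i] assms by (metis inj_onD less_irrefl linorder_neqE)
  qed
  have "r i \<in> {1..n}" if "i \<in> {1..n}" for i
  proof -
    have "i \<in> {j \<in> {1..n}. g j \<le> g i}" using that by auto
    then have "card {j \<in> {1..n}. g j \<le> g i} > 0" by (metis (no_types, lifting) card_gt_0_iff empty_iff finite_atLeastAtMost finite_Collect_conjI mem_Collect_eq finite_subset subsetI)
    moreover have "card {j \<in> {1..n}. g j \<le> g i} \<le> card {1..n}" by (rule card_mono) auto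
    ultimately show ?thesis using that by (simp add: r_def)
  qed
  then have "bij_betw r {1..n} {1..n}"
    using inj by (simp add: bij_betw_def endo_inj_surj image_subset_iff)
  then have "r permutes {1..n}"
    by (rule bij_imp_permutes) (auto simp: r_def)
  then show ?thesis using that iff by blast
qed

section \<open>Inversions and planar transpositions\<close>

definition inversions :: "nat \<Rightarrow> (nat \<Rightarrow> nat) \<Rightarrow> (nat \<times> nat) set" where
  "inversions n f = {(i, j). 1 \<le> i \<and> i < j \<and> j \<le> n \<and> f j < f i}"

lemma finite_inversions [simp]: "finite (inversions n f)"
  by (rule finite_subset[of _ "{1..n} \<times> {1..n}"]) (auto simp: inversions_def)

lemma permutes_increasing_imp_id:
  fixes f :: "nat \<Rightarrow> nat"
  assumes "f permutes {1..n}" "\<And>i. 1 \<le> i \<Longrightarrow> i + 1 \<le> n \<Longrightarrow> f i < f (i + 1)"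
  shows "f = id"
proof (rule permutes_natset_ge[OF assms(1)])
  have "i \<le> f i" if "i \<in> {1..n}" for i
    using that
  proof (induction i)
    case (Suc i)
    show ?case
    proof (cases "i = 0")
      case True
      then show ?thesis using permutes_in_image[OF assms(1), of 1] Suc.prems by auto
    next
      case False
      then show ?thesis using Suc assms(2)[of i] by force
    qed
  qed auto
  then show "\<forall>i\<in>{1..n}. i \<le> f i" by blast
qed

text \<open>One of the two kinds of planar transposition. Swaps of adjacent values are obtained from
  it by passing to inverses.\<close>

definition position_step :: "nat \<Rightarrow> (nat \<Rightarrow> nat) \<Rightarrow> (nat \<Rightarrow> nat) \<Rightarrow> bool" where
  "position_step n \<pi> \<sigma> \<longleftrightarrow> \<sigma> permutes {1..n} \<and>
     (\<exists>i. 1 \<le> i \<and> i + 1 \<le> n \<and> \<sigma> = \<pi>(i := \<pi> (i + 1), i + 1 := \<pi> i))"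

text \<open>Swapping the entries of a descent carries the inversions of the new function injectively
  to those of \<open>f\<close>, and the descent itself is missed.\<close>

lemma card_inversions_descent:
  assumes "1 \<le> i" "i + 1 \<le> n" "f (i + 1) < f i"
  shows "card (inversions n (f \<circ> Transposition.transpose i (i + 1))) < card (inversions n f)"
proof -
  let ?t = "Transposition.transpose i (i + 1)"
  let ?h = "\<lambda>(a, b). (?t a, ?t b)"
  have "inj ?h" by (auto simp: inj_def Transposition.transpose_eq_iff)
  have "?h ` inversions n (f \<circ> ?t) \<subseteq> inversions n f - {(i, i + 1)}"
  proof clarify
    fix a b assume *: "(a, b) \<in> inversions n (f \<circ> ?t)"
    then have "\<not> (a = i \<and> b = i + 1)" using assms(3) by (auto simp: inversions_def)
    then have "?t a < ?t b" using * by (auto simp: inversions_def Transposition.transpose_def)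
    then show "(?t a, ?t b) \<in> inversions n f - {(i, i + 1)}"
      using * assms by (auto simp: inversions_def Transposition.transpose_def split: if_splits)
  qed
  then have "card (inversions n (f \<circ> ?t)) \<le> card (inversions n f - {(i, i + 1)})"
    by (metis card_image card_mono finite_Diff finite_inversions \<open>inj ?h\<close> inj_on_subset subset_UNIV)
  also have "\<dots> < card (inversions n f)"
    using assms by (intro card_Diff1_less finite_inversions) (auto simp: inversions_def)
  finally show ?thesis .
qed

text \<open>Bubble sort: every descent that is removed from \<open>f\<close> saves at least one
  inversion, and a permutation without descents is the identity.\<close>

lemma position_path:
  assumes "\<pi> permutes {1..n}" "f permutes {1..n}"
  shows "\<exists>d \<le> card (inversions n f). (position_step n ^^ d) \<pi> (\<pi> \<circ> f)"
  using assms(2)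
proof (induction "card (inversions n f)" arbitrary: f rule: less_induct)
  case less
  show ?case
  proof (cases "\<exists>i. 1 \<le> i \<and> i + 1 \<le> n \<and> f (i + 1) < f i")
    case True
    then obtain i where i: "1 \<le> i" "i + 1 \<le> n" "f (i + 1) < f i" by blast
    let ?t = "Transposition.transpose i (i + 1)"
    have t: "?t permutes {1..n}" using i by (intro permutes_swap_id) auto
    then have ft: "f \<circ> ?t permutes {1..n}" using less.prems permutes_compose by blast
    obtain d where d: "d \<le> card (inversions n (f \<circ> ?t))"
      "(position_step n ^^ d) \<pi> (\<pi> \<circ> (f \<circ> ?t))"
      using less.hyps[OF card_inversions_descent[of i n f] ft] i by blast
    have "position_step n (\<pi> \<circ> (f \<circ> ?t)) (\<pi> \<circ> f)"
      unfolding position_step_def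
    proof (intro conjI exI[of _ i] ext)
      show "\<pi> \<circ> f permutes {1..n}" using assms(1) less.prems permutes_compose by blast
    qed (use i in \<open>auto simp: Transposition.transpose_def\<close>)
    then have "(position_step n ^^ Suc d) \<pi> (\<pi> \<circ> f)" using d(2) by auto
    moreover have "Suc d \<le> card (inversions n f)"
      using d(1) card_inversions_descent[of i n f] i by linarith
    ultimately show ?thesis by blast
  next
    case False
    have "f i < f (i + 1)" if "1 \<le> i" "i + 1 \<le> n" for i
    proof -
      have "f i \<noteq> f (i + 1)" using permutes_inj[OF less.prems] by (simp add: inj_eq)
      then show ?thesis using False that by (metis linorder_neqE)
    qed
    then have "f = id" using permutes_increasing_imp_id less.prems by blast
    then show ?thesis by (intro exI[of _ 0]) auto
  qed
qed

lemma relpowp_mono_map: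
  assumes "(R ^^ d) x y" "\<And>a b. R a b \<Longrightarrow> Q (h a) (h b)"
  shows "(Q ^^ d) (h x) (h y)"
  using assms(1) by (induction d arbitrary: y) (auto intro: assms(2))

lemma relpowp_trans_add: "(R ^^ d) x y \<Longrightarrow> (R ^^ e) y z \<Longrightarrow> (R ^^ (d + e)) x z"
  for R :: "'a \<Rightarrow> 'a \<Rightarrow> bool"
  by (auto simp: relpowp_add)

text \<open>Positions are rearranged first. The values are then rearranged by the same bubble sort
  applied to the inverse permutation, where value swaps become position swaps.\<close>

lemma planar_path:
  assumes "\<pi> permutes {1..n}" "f permutes {1..n}" "g permutes {1..n}"
  shows "\<exists>d \<le> card (inversions n f) + card (inversions n g).
           (planar_simple_transposition n ^^ d) \<pi> (inv g \<circ> \<pi> \<circ> f)"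
proof -
  obtain d where d: "d \<le> card (inversions n f)" "(position_step n ^^ d) \<pi> (\<pi> \<circ> f)"
    using position_path assms by blast
  have \<pi>f: "\<pi> \<circ> f permutes {1..n}" using assms permutes_compose by blast
  obtain e where e: "e \<le> card (inversions n g)"
    "(position_step n ^^ e) (inv (\<pi> \<circ> f)) (inv (\<pi> \<circ> f) \<circ> g)"
    using position_path[OF permutes_inv[OF \<pi>f] assms(3)] by blast
  have 1: "(planar_simple_transposition n ^^ d) \<pi> (\<pi> \<circ> f)"
    using relpowp_mono_map[OF d(2), of "planar_simple_transposition n" id]
    by (auto simp: position_step_def planar_simple_transposition_def)
  have "planar_simple_transposition n (inv a) (inv b)" if ab: "position_step n a b" for a b
  proof -
    obtain i where i: "b permutes {1..n}" "1 \<le> i" "i + 1 \<le> n" "b = a(i := a (i + 1), i + 1 := a i)"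
      using ab unfolding position_step_def by blast
    have "a = b \<circ> Transposition.transpose i (i + 1)" using i(4) by (auto simp: Transposition.transpose_def)
    moreover have "Transposition.transpose i (i + 1) permutes {1..n}" using i by (intro permutes_swap_id) auto
    ultimately have "a permutes {1..n}" using i(1) permutes_compose by blast
    then show ?thesis
      using i permutes_inv[OF i(1)]
      by (auto simp: planar_simple_transposition_def permutes_inv_inv)
  qed
  then have "(planar_simple_transposition n ^^ e) (inv (inv (\<pi> \<circ> f))) (inv (inv (\<pi> \<circ> f) \<circ> g))"
    using relpowp_mono_map[OF e(2), of "planar_simple_transposition n" inv] by blast
  moreover have "inv (inv (\<pi> \<circ> f) \<circ> g) = inv g \<circ> \<pi> \<circ> f"
    using \<pi>f assms(3)
    by (simp add: o_inv_distrib permutes_bij permutes_inv permutes_inv_inv bij_imp_bij_inv o_assoc)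
  ultimately have "(planar_simple_transposition n ^^ e) (\<pi> \<circ> f) (inv g \<circ> \<pi> \<circ> f)"
    using \<pi>f by (simp add: permutes_inv_inv)
  then show ?thesis
    using relpowp_trans_add[OF 1] d(1) e(1) by (meson add_mono)
qed

lemma rho_PT_le:
  assumes "(planar_simple_transposition n ^^ d) \<pi>1 \<pi>2" "d \<le> b * real (n choose 2)" "0 \<le> b"
  shows "rho_PT n \<pi>1 \<pi>2 \<le> b"
proof (cases "n = 1 \<or> n choose 2 = 0")
  case False
  have "(LEAST d. (planar_simple_transposition n ^^ d) \<pi>1 \<pi>2) \<le> d"
    using assms(1) by (rule Least_le)
  then have "real (LEAST d. (planar_simple_transposition n ^^ d) \<pi>1 \<pi>2) \<le> b * real (n choose 2)"
    using assms(2) by linarith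
  then show ?thesis using False by (auto simp: rho_PT_def divide_simps)
next
  \<comment> \<open>For \<open>n = 0\<close> the denominator is \<open>0\<close>, and so is the
    quotient.\<close>
  case True
  then show ?thesis using assms(3) by (auto simp: rho_PT_def simp del: binomial_eq_0_iff)
qed

lemma card_inversions_le: "card (inversions n f) \<le> n choose 2"
proof -
  have inj: "inj_on (\<lambda>(i, j). {i, j}) (inversions n f)"
    by (auto simp: inj_on_def inversions_def doubleton_eq_iff)
  have "(\<lambda>(i, j). {i, j}) ` inversions n f \<subseteq> {A. A \<subseteq> {1..n} \<and> card A = 2}"
    by (auto simp: inversions_def)
  then have "card ((\<lambda>(i, j). {i, j}) ` inversions n f) \<le> card {A. A \<subseteq> {1..n} \<and> card A = 2}"
    by (intro card_mono) auto
  also have "\<dots> = n choose 2" using n_subsets[of "{1..n}" 2] by simp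
  finally show ?thesis using card_image[OF inj] by simp
qed

lemma rho_PT_le_one:
  assumes "\<pi>1 permutes {1..n}" "\<pi>2 permutes {1..n}"
  shows "rho_PT n \<pi>1 \<pi>2 \<le> 1"
proof -
  have f: "inv \<pi>1 \<circ> \<pi>2 permutes {1..n}" using assms permutes_compose permutes_inv by blast
  obtain d where "d \<le> card (inversions n (inv \<pi>1 \<circ> \<pi>2)) + card (inversions n id)"
    "(planar_simple_transposition n ^^ d) \<pi>1 (inv id \<circ> \<pi>1 \<circ> (inv \<pi>1 \<circ> \<pi>2))"
    using planar_path[OF assms(1) f permutes_id] by blast
  moreover have "inversions n id = {}" by (auto simp: inversions_def)
  moreover have "inv id \<circ> \<pi>1 \<circ> (inv \<pi>1 \<circ> \<pi>2) = \<pi>2"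
    using assms(1) by (auto simp: permutes_inverses)
  ultimately have "(planar_simple_transposition n ^^ d) \<pi>1 \<pi>2" "d \<le> n choose 2"
    using card_inversions_le[of n "inv \<pi>1 \<circ> \<pi>2"] by auto
  then show ?thesis by (intro rho_PT_le) auto
qed

lemma finite_perms_len: "finite {\<pi> \<in> perms. len \<pi> = n}"
proof -
  have "{\<pi> \<in> perms. len \<pi> = n} \<subseteq> {n} \<times> {f. f permutes {1..n}}" by (auto simp: perms_def)
  then show ?thesis by (rule finite_subset) (auto simp: finite_permutations)
qed

lemma dist_PT_le:
  assumes "P \<subseteq> perms" "\<pi>0 \<in> P" "len \<pi>0 = len \<pi>" "rho_PT (len \<pi>) (app \<pi>) (app \<pi>0) \<le> b"
  shows "dist_PT \<pi> P \<le> b"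
proof -
  let ?D = "{rho_PT (len \<pi>) (app \<pi>) (app \<pi>0) |\<pi>0. \<pi>0 \<in> P \<and> len \<pi>0 = len \<pi>}"
  have "?D \<subseteq> (\<lambda>\<pi>0. rho_PT (len \<pi>) (app \<pi>) (app \<pi>0)) ` {\<pi>0 \<in> perms. len \<pi>0 = len \<pi>}"
    using assms(1) by blast
  then have "finite ?D" using finite_perms_len finite_subset by blast
  moreover have "rho_PT (len \<pi>) (app \<pi>) (app \<pi>0) \<in> ?D" using assms by blast
  ultimately have "Min ?D \<le> rho_PT (len \<pi>) (app \<pi>) (app \<pi>0)" by (rule Min_le)
  moreover have "?D \<noteq> {}" using assms by blast
  ultimately show ?thesis using assms(4) unfolding dist_PT_def Let_def by (subst if_not_P) auto
qed

text \<open>Nothing is \<epsilon>-far once \<open>\<epsilon> \<ge> 1\<close>; this is what permits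
  \<open>\<eta> < 1 / 2\<close> in the estimates below.\<close>

lemma dist_PT_le_one:
  assumes "P \<subseteq> perms" "\<pi> \<in> perms"
  shows "dist_PT \<pi> P \<le> 1"
proof (cases "\<exists>\<pi>0 \<in> P. len \<pi>0 = len \<pi>")
  case True
  then obtain \<pi>0 where "\<pi>0 \<in> P" "len \<pi>0 = len \<pi>" by blast
  moreover have "rho_PT (len \<pi>) (app \<pi>) (app \<pi>0) \<le> 1"
    using assms calculation by (intro rho_PT_le_one) (auto simp: perms_def)
  ultimately show ?thesis using dist_PT_le assms(1) by blast
qed (auto simp: dist_PT_def)

section \<open>The Fueredi--Hajnal constant\<close>

text \<open>Containment of a permutation matrix, for matrices given as sets of ones with indices
  from \<open>0\<close>. No ranges are imposed on \<open>r\<close> and \<open>c\<close>, since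
  membership in \<open>A\<close> bounds them.\<close>

definition occurs :: "perm \<Rightarrow> (nat \<times> nat) set \<Rightarrow> bool" where
  "occurs \<sigma> A \<longleftrightarrow> (\<exists>r c. strict_mono_on {1..len \<sigma>} r \<and> strict_mono_on {1..len \<sigma>} c \<and>
     (\<forall>i\<in>{1..len \<sigma>}. (r i, c (app \<sigma> i)) \<in> A))"

lemma occursI:
  assumes "\<And>i j. i \<in> {1..len \<sigma>} \<Longrightarrow> j \<in> {1..len \<sigma>} \<Longrightarrow> i < j \<Longrightarrow> r i < r j"
    "\<And>i j. i \<in> {1..len \<sigma>} \<Longrightarrow> j \<in> {1..len \<sigma>} \<Longrightarrow> i < j \<Longrightarrow> c i < c j"
    "\<And>i. i \<in> {1..len \<sigma>} \<Longrightarrow> (r i, c (app \<sigma> i)) \<in> A"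
  shows "occurs \<sigma> A"
  unfolding occurs_def strict_mono_on_def using assms by blast

lemma occursE:
  assumes "occurs \<sigma> A"
  obtains r c where
    "\<forall>i\<in>{1..len \<sigma>}. \<forall>j\<in>{1..len \<sigma>}. i < j \<longrightarrow> r i < r j"
    "\<forall>i\<in>{1..len \<sigma>}. \<forall>j\<in>{1..len \<sigma>}. i < j \<longrightarrow> c i < c j"
    "\<forall>i\<in>{1..len \<sigma>}. (r i, c (app \<sigma> i)) \<in> A"
  using assms unfolding occurs_def strict_mono_on_def by blast

lemma perms_image: "\<sigma> \<in> perms \<Longrightarrow> app \<sigma> ` {1..len \<sigma>} = {1..len \<sigma>}"
  by (auto simp: perms_def permutes_image)

lemma perms_in: "\<sigma> \<in> perms \<Longrightarrow> i \<in> {1..len \<sigma>} \<Longrightarrow> app \<sigma> i \<in> {1..len \<sigma>}"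
  using perms_image by blast

lemma perms_surj:
  assumes "\<sigma> \<in> perms" "j \<in> {1..len \<sigma>}"
  obtains i where "i \<in> {1..len \<sigma>}" "j = app \<sigma> i"
  using perms_image[OF assms(1)] assms(2) by blast

lemma card_le_ex_ones:
  assumes \<sigma>: "\<sigma> \<in> perms" and A: "A \<subseteq> {..<n} \<times> {..<n}" and "\<not> occurs \<sigma> A"
  shows "card A \<le> ex_ones n \<sigma>"
proof -
  define M where "M = (\<lambda>i j. if (i - 1, j - 1) \<in> A then 1 else 0 :: nat)"
  have M_one: "(i - 1, j - 1) \<in> A" if "M i j = 1" for i j
    by (rule ccontr) (use that in \<open>simp add: M_def\<close>)
  let ?S = "{num_ones n n M | M. zero_one_matrix n n M \<and>
            \<not> matrix_contains n n M (len \<sigma>) (len \<sigma>) (perm_matrix \<sigma>)}"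
  have "{(i, j). i \<in> {1..n} \<and> j \<in> {1..n} \<and> M i j = 1} = (\<lambda>(i, j). (Suc i, Suc j)) ` A"
  proof safe
    fix i j assume "i \<in> {1..n}" "j \<in> {1..n}" "M i j = 1"
    moreover from this obtain i' j' where "i = Suc i'" "j = Suc j'" by (cases i; cases j) auto
    ultimately show "(i, j) \<in> (\<lambda>(i, j). (Suc i, Suc j)) ` A"
      using M_one[of i j] by force
  qed (use A in \<open>auto simp: M_def\<close>)
  then have num: "num_ones n n M = card A"
    unfolding num_ones_def by (simp only:) (auto intro!: card_image simp: inj_on_def)
  have "\<not> matrix_contains n n M (len \<sigma>) (len \<sigma>) (perm_matrix \<sigma>)"
  proof
    assume "matrix_contains n n M (len \<sigma>) (len \<sigma>) (perm_matrix \<sigma>)"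
    then obtain r c where rc: "strict_mono_on {1..len \<sigma>} r" "r ` {1..len \<sigma>} \<subseteq> {1..n}"
      "strict_mono_on {1..len \<sigma>} c" "c ` {1..len \<sigma>} \<subseteq> {1..n}"
      "\<forall>i\<in>{1..len \<sigma>}. \<forall>j\<in>{1..len \<sigma>}. perm_matrix \<sigma> i j = 1 \<longrightarrow> M (r i) (c j) = 1"
      unfolding matrix_contains_def by blast
    \<comment> \<open>The selected indices are at least \<open>1\<close>, so truncated subtraction
      keeps strict inequalities.\<close>
    have dec: "f i - 1 < f j - (1 :: nat)"
      if "strict_mono_on {1..len \<sigma>} f" "f ` {1..len \<sigma>} \<subseteq> {1..n}"
        "i \<in> {1..len \<sigma>}" "j \<in> {1..len \<sigma>}" "i < j" for f i j
    proof -
      have "f i \<in> {1..n}" using that by blast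
      then show ?thesis using strict_mono_onD[OF that(1) that(3-5)] by auto
    qed
    have "occurs \<sigma> A"
    proof (rule occursI[of \<sigma> "\<lambda>i. r i - 1" "\<lambda>i. c i - 1"])
      fix i assume i: "i \<in> {1..len \<sigma>}"
      then have "M (r i) (c (app \<sigma> i)) = 1"
        using rc(5) perms_in[OF \<sigma> i] by (auto simp: perm_matrix_def)
      then show "(r i - 1, c (app \<sigma> i) - 1) \<in> A" by (rule M_one)
    qed (use dec rc in blast)+
    then show False using assms by blast
  qed
  moreover have "zero_one_matrix n n M" by (auto simp: zero_one_matrix_def M_def)
  ultimately have "card A \<in> ?S" using num by force
  moreover have "?S \<subseteq> {..n * n}"
  proof
    fix x assume "x \<in> ?S"
    then obtain M where M: "x = num_ones n n M" by blast
    have "num_ones n n M \<le> card ({1..n} \<times> {1..n})"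
      unfolding num_ones_def by (rule card_mono) auto
    then show "x \<in> {..n * n}" by (simp add: M)
  qed
  then have "finite ?S" using finite_subset by blast
  ultimately show ?thesis unfolding ex_ones_def by (intro Max_ge) auto
qed

lemma ex_ones_attained:
  assumes \<sigma>: "\<sigma> \<in> perms"
  obtains A where "A \<subseteq> {..<n} \<times> {..<n}" "\<not> occurs \<sigma> A" "card A = ex_ones n \<sigma>"
proof -
  let ?S = "{num_ones n n M | M. zero_one_matrix n n M \<and>
            \<not> matrix_contains n n M (len \<sigma>) (len \<sigma>) (perm_matrix \<sigma>)}"
  have k: "1 \<in> {1..len \<sigma>}" using \<sigma> by (auto simp: perms_def)
  \<comment> \<open>The zero matrix shows that the maximum in \<open>ex_ones\<close> ranges over a
    nonempty set; it avoids \<open>\<sigma>\<close> because \<open>\<sigma>\<close> has at least one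
    entry.\<close>
  have "\<not> matrix_contains n n (\<lambda>i j. 0) (len \<sigma>) (len \<sigma>) (perm_matrix \<sigma>)"
    using k perms_in[OF \<sigma> k] by (auto simp: matrix_contains_def perm_matrix_def)
  moreover have "zero_one_matrix n n (\<lambda>i j. 0)" by (auto simp: zero_one_matrix_def)
  ultimately have "?S \<noteq> {}" by blast
  moreover have "?S \<subseteq> {..n * n}"
  proof
    fix x assume "x \<in> ?S"
    then obtain M where M: "x = num_ones n n M" by blast
    have "num_ones n n M \<le> card ({1..n} \<times> {1..n})"
      unfolding num_ones_def by (rule card_mono) auto
    then show "x \<in> {..n * n}" by (simp add: M)
  qed
  then have "finite ?S" using finite_subset by blast
  ultimately have "ex_ones n \<sigma> \<in> ?S" unfolding ex_ones_def using Max_in by blast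
  then obtain M where M: "ex_ones n \<sigma> = num_ones n n M"
    "\<not> matrix_contains n n M (len \<sigma>) (len \<sigma>) (perm_matrix \<sigma>)" by auto
  define A where "A = {(i, j). i < n \<and> j < n \<and> M (Suc i) (Suc j) = 1}"
  have "{(i, j). i \<in> {1..n} \<and> j \<in> {1..n} \<and> M i j = 1} = (\<lambda>(i, j). (Suc i, Suc j)) ` A"
  proof safe
    fix i j assume "i \<in> {1..n}" "j \<in> {1..n}" "M i j = 1"
    moreover from this obtain i' j' where "i = Suc i'" "j = Suc j'" by (cases i; cases j) auto
    ultimately show "(i, j) \<in> (\<lambda>(i, j). (Suc i, Suc j)) ` A"
      by (force simp: A_def)
  qed (auto simp: A_def)
  then have "card A = ex_ones n \<sigma>"
    unfolding M(1) num_ones_def by (simp only:) (auto intro!: card_image[symmetric] simp: inj_on_def)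
  moreover have "\<not> occurs \<sigma> A"
  proof
    assume "occurs \<sigma> A"
    then obtain r c where rc:
      "\<forall>i\<in>{1..len \<sigma>}. \<forall>j\<in>{1..len \<sigma>}. i < j \<longrightarrow> r i < r j"
      "\<forall>i\<in>{1..len \<sigma>}. \<forall>j\<in>{1..len \<sigma>}. i < j \<longrightarrow> c i < c j"
      "\<forall>i\<in>{1..len \<sigma>}. (r i, c (app \<sigma> i)) \<in> A"
      by (rule occursE)
    note rc = rc[rule_format]
    have "matrix_contains n n M (len \<sigma>) (len \<sigma>) (perm_matrix \<sigma>)"
      unfolding matrix_contains_def
    proof (rule exI[of _ "\<lambda>i. Suc (r i)"], rule exI[of _ "\<lambda>i. Suc (c i)"], intro conjI ballI impI)
      show "(\<lambda>i. Suc (r i)) ` {1..len \<sigma>} \<subseteq> {1..n}"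
        using rc(3) by (force simp: A_def)
      show "(\<lambda>i. Suc (c i)) ` {1..len \<sigma>} \<subseteq> {1..n}"
      proof (rule image_subsetI)
        fix j assume "j \<in> {1..len \<sigma>}"
        then obtain i where "i \<in> {1..len \<sigma>}" "j = app \<sigma> i" using perms_surj[OF \<sigma>] by blast
        then show "Suc (c j) \<in> {1..n}" using rc(3)[of i] by (auto simp: A_def)
      qed
      fix i j assume i: "i \<in> {1..len \<sigma>}" and "j \<in> {1..len \<sigma>}" and ij: "perm_matrix \<sigma> i j = 1"
      have "app \<sigma> i = j" by (rule ccontr) (use ij in \<open>simp add: perm_matrix_def\<close>)
      then have "(r i, c j) \<in> A" using rc(3)[OF i] by simp
      then show "M (Suc (r i)) (Suc (c j)) = 1" by (simp add: A_def)
    qed (use rc in \<open>auto simp: strict_mono_on_def\<close>)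
    then show False using M by blast
  qed
  ultimately show ?thesis by (intro that[of A]) (auto simp: A_def)
qed

section \<open>Superadditivity of the extremal function and Fekete's lemma\<close>

abbreviation shift :: "nat \<Rightarrow> nat \<Rightarrow> (nat \<times> nat) set \<Rightarrow> (nat \<times> nat) set" where
  "shift a b A \<equiv> (\<lambda>(i, j). (i + a, j + b)) ` A"

lemma occurs_shift:
  assumes \<sigma>: "\<sigma> \<in> perms" and "occurs \<sigma> (shift a b A)"
  shows "occurs \<sigma> A"
proof -
  obtain r c where rc:
    "\<forall>i\<in>{1..len \<sigma>}. \<forall>j\<in>{1..len \<sigma>}. i < j \<longrightarrow> r i < r j"
    "\<forall>i\<in>{1..len \<sigma>}. \<forall>j\<in>{1..len \<sigma>}. i < j \<longrightarrow> c i < c j"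
    "\<forall>i\<in>{1..len \<sigma>}. (r i, c (app \<sigma> i)) \<in> shift a b A"
    using assms(2) by (rule occursE)
    note rc = rc[rule_format]
  have r: "a \<le> r i" if "i \<in> {1..len \<sigma>}" for i using rc(3)[OF that] by auto
  have c: "b \<le> c j" if j: "j \<in> {1..len \<sigma>}" for j
  proof -
    obtain i where "i \<in> {1..len \<sigma>}" "j = app \<sigma> i" using perms_surj[OF \<sigma> j] by blast
    then show ?thesis using rc(3)[of i] by auto
  qed
  show ?thesis
  proof (rule occursI[of \<sigma> "\<lambda>i. r i - a" "\<lambda>i. c i - b"])
    fix i assume "i \<in> {1..len \<sigma>}"
    then show "(r i - a, c (app \<sigma> i) - b) \<in> A" using rc(3) by fastforce
  qed (use rc r c in \<open>simp_all add: diff_less_mono\<close>)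
qed

text \<open>Two extremal sets become diagonal blocks of one larger matrix. The diagonal runs against
  the direction from the first to the last entry of \<open>\<sigma>\<close>, so these two entries
  cannot fall into different blocks; then all entries lie in one block.\<close>

lemma ex_ones_superadditive:
  assumes \<sigma>: "\<sigma> \<in> perms"
  shows "ex_ones m \<sigma> + ex_ones n \<sigma> \<le> ex_ones (m + n) \<sigma>"
proof -
  let ?k = "len \<sigma>"
  have k: "1 \<in> {1..?k}" "?k \<in> {1..?k}" using \<sigma> by (auto simp: perms_def)
  obtain A where A: "A \<subseteq> {..<m} \<times> {..<m}" "\<not> occurs \<sigma> A" "card A = ex_ones m \<sigma>"
    using ex_ones_attained[OF \<sigma>] by blast
  obtain B where B: "B \<subseteq> {..<n} \<times> {..<n}" "\<not> occurs \<sigma> B" "card B = ex_ones n \<sigma>"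
    using ex_ones_attained[OF \<sigma>] by blast
  define up where "up \<longleftrightarrow> app \<sigma> 1 < app \<sigma> ?k"
  define a b where "a = (if up then n else 0)" and "b = (if up then 0 else m)"
  have inj: "inj_on (\<lambda>(i, j). (i + p, j + q)) X" for p q :: nat and X
    by (auto simp: inj_on_def)
  let ?C = "shift 0 a A \<union> shift m b B"
  have "\<not> occurs \<sigma> ?C"
  proof
    assume "occurs \<sigma> ?C"
    then obtain r c where rc:
      "\<forall>i\<in>{1..?k}. \<forall>j\<in>{1..?k}. i < j \<longrightarrow> r i < r j"
      "\<forall>i\<in>{1..?k}. \<forall>j\<in>{1..?k}. i < j \<longrightarrow> c i < c j"
      "\<forall>i\<in>{1..?k}. (r i, c (app \<sigma> i)) \<in> ?C"
      by (rule occursE)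
    note rc = rc[rule_format]
    consider "m \<le> r 1" | "r ?k < m" | "r 1 < m" "m \<le> r ?k" by linarith
    then show False
    proof cases
      case 1
      have "m \<le> r i" if "i \<in> {1..?k}" for i
        using 1 rc(1)[OF k(1) that] that by (cases "i = 1") auto
      then have "(r i, c (app \<sigma> i)) \<in> shift m b B" if "i \<in> {1..?k}" for i
        using rc(3)[OF that] A(1) that by fastforce
      then have "occurs \<sigma> (shift m b B)" using rc(1,2) by (intro occursI[of \<sigma> r c]) auto
      then show False using occurs_shift[OF \<sigma>] B(2) by blast
    next
      case 2
      have "r i < m" if "i \<in> {1..?k}" for i
        using 2 rc(1)[OF that k(2)] that by (cases "i = ?k") auto
      then have "(r i, c (app \<sigma> i)) \<in> shift 0 a A" if "i \<in> {1..?k}" for i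
        using rc(3)[OF that] that by fastforce
      then have "occurs \<sigma> (shift 0 a A)" using rc(1,2) by (intro occursI[of \<sigma> r c]) auto
      then show False using occurs_shift[OF \<sigma>] A(2) by blast
    next
      case 3
      have "(r 1, c (app \<sigma> 1)) \<in> shift 0 a A" using rc(3)[OF k(1)] 3(1) by auto
      then have c1: "a \<le> c (app \<sigma> 1)" "c (app \<sigma> 1) < m + a" using A(1) by auto
      have "(r ?k, c (app \<sigma> ?k)) \<in> shift m b B" using rc(3)[OF k(2)] 3(2) A(1) by auto
      then have ck: "b \<le> c (app \<sigma> ?k)" "c (app \<sigma> ?k) < n + b" using B(1) by auto
      note in1 = perms_in[OF \<sigma> k(1)] and ink = perms_in[OF \<sigma> k(2)]
      show False
      proof (cases up)
        case True
        then show False using c1 ck rc(2)[OF in1 ink] by (auto simp: up_def a_def b_def)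
      next
        case False
        then have "c (app \<sigma> ?k) \<le> c (app \<sigma> 1)"
          using rc(2)[OF ink in1] by (cases "app \<sigma> ?k = app \<sigma> 1") (auto simp: up_def)
        then show False using c1 ck False by (auto simp: a_def b_def)
      qed
    qed
  qed
  moreover have "?C \<subseteq> {..<m + n} \<times> {..<m + n}"
    using A(1) B(1) by (auto simp: a_def b_def)
  ultimately have "card ?C \<le> ex_ones (m + n) \<sigma>" using card_le_ex_ones[OF \<sigma>] by blast
  moreover have "finite A" "finite B" using A(1) B(1) by (auto intro: finite_subset)
  moreover have "shift 0 a A \<inter> shift m b B = {}" using A(1) by auto
  ultimately have "card (shift 0 a A) + card (shift m b B) \<le> ex_ones (m + n) \<sigma>"
    by (simp only: card_Un_disjoint finite_imageI)
  then show ?thesis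
    unfolding card_image[OF inj[of 0 a A]] card_image[OF inj[of m b B]] A(3) B(3) .
qed

text \<open>Fekete's lemma: the quotients converge to their supremum, which the linear bound makes
  finite. The supremum is what bounds every single term.\<close>

lemma superadditive_le_lim:
  fixes a :: "nat \<Rightarrow> real"
  assumes super: "\<And>m n. a m + a n \<le> a (m + n)" and nonneg: "\<And>n. 0 \<le> a n"
    and bound: "\<And>n. a n \<le> D * real n"
  shows "a n \<le> lim (\<lambda>n. a n / n) * n"
proof -
  define L where "L = (SUP n\<in>{1..}. a n / real n)"
  have bdd: "bdd_above ((\<lambda>n. a n / real n) ` {1..})"
    using bound by (intro bdd_aboveI[of _ D]) (auto simp: divide_simps)
  have le: "a n / n \<le> L" if "n \<ge> 1" for n
    unfolding L_def using that bdd by (intro cSUP_upper) auto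
  have mult: "real q * a m \<le> a (q * m)" for q m
  proof (induction q)
    case (Suc q)
    then show ?case using super[of m "q * m"] by (simp add: algebra_simps)
  qed (simp add: nonneg)
  have "L \<ge> 0" using le[of 1] nonneg[of 1] by auto
  have "(\<lambda>n. a n / n) \<longlonglongrightarrow> L"
  proof (rule LIMSEQ_I)
    fix e :: real assume "e > 0"
    have "L - e / 2 < L" using \<open>e > 0\<close> by simp
    then obtain m where m: "m \<ge> 1" "L - e / 2 < a m / m"
      unfolding L_def using less_cSUP_iff[OF _ bdd, of "(L - e/2)"] by (auto simp: L_def)
    \<comment> \<open>\<open>N\<close> is so large that discarding the remainder of \<open>n\<close>
      modulo \<open>m\<close> costs less than \<open>n * e / 2\<close>; the other half of
      \<open>e\<close> is lost in the choice of \<open>m\<close>.\<close>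
    obtain N :: nat where N: "N > 2 * m * (L + 1) / e" using reals_Archimedean2 by blast
    have "norm (a n / n - L) < e" if "n \<ge> max N 1" for n
    proof -
      have n: "n \<ge> 1" using that by auto
      define q where "q = n div m"
      have qm: "real n - m \<le> real q * m"
      proof -
        have "n mod m < m" using m by simp
        then have "n \<le> q * m + m" using div_mult_mod_eq[of n m] unfolding q_def by linarith
        then have "real n \<le> real (q * m + m)" using of_nat_le_iff by blast
        then show ?thesis by simp
      qed
      have "(L - e / 2) * m \<le> a m" using m by (simp add: divide_simps split: if_splits)
      have "a (q * m) \<le> a n"
        using super[of "q * m" "n mod m"] nonneg[of "n mod m"] by (simp add: q_def)
      then have "real q * a m \<le> a n" using mult[of q m] by linarith
      moreover have "real q * a m \<ge> real q * m * (L - e / 2)"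
        using mult_left_mono[OF \<open>(L - e / 2) * m \<le> a m\<close>, of "real q"] by (simp add: algebra_simps)
      moreover have "real q * m * (L - e / 2) > n * (L - e)"
      proof -
        have "real q * m \<le> n" by (simp add: q_def flip: of_nat_mult)
        then have "real q * m * (e / 2) \<le> n * (e / 2)" using \<open>e > 0\<close> by (intro mult_right_mono) auto
        moreover have "real q * m * L \<ge> (real n - m) * L" using qm \<open>L \<ge> 0\<close> by (intro mult_right_mono) auto
        moreover have "m * L < n * (e / 2)"
        proof -
          have "2 * m * (L + 1) < N * e" using N \<open>e > 0\<close> by (simp add: divide_simps)
          also have "\<dots> \<le> n * e" using that \<open>e > 0\<close> by (intro mult_right_mono) auto
          finally have "m * L + m < n * (e / 2)" by (simp add: algebra_simps)
          then show ?thesis by (smt (verit) of_nat_0_le_iff)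
        qed
        ultimately show ?thesis by (simp add: algebra_simps)
      qed
      ultimately have "n * (L - e) < a n" by linarith
      then have "L - e < a n / n" using n by (simp add: divide_simps mult.commute)
      then show ?thesis using le[OF n] by auto
    qed
    then show "\<exists>no. \<forall>n\<ge>no. norm (a n / n - L) < e" by blast
  qed
  then have L: "lim (\<lambda>n. a n / n) = L" by (rule limI)
  show ?thesis
  proof (cases "n = 0")
    case True
    then show ?thesis using bound[of 0] by simp
  next
    case False
    then show ?thesis using le[of n] L by (simp add: divide_simps split: if_splits)
  qed
qed

section \<open>The linear bound of Marcus and Tardos\<close>

text \<open>In a column of blocks, more than \<open>k * (s choose k)\<close> blocks with ones in at least \<open>k\<close>
  columns would, by pigeonhole, contain \<open>k\<close> blocks with ones in the same \<open>k\<close> columns, and these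
  contain every permutation matrix of size \<open>k\<close>.\<close>

lemma wide_blocks_bound:
  assumes \<sigma>: "\<sigma> \<in> perms" and avoid: "\<not> occurs \<sigma> A" and s: "0 < s" and k: "k = len \<sigma>"
  shows "card {x. x < t \<and> k \<le> card {v. v div s = y \<and> (\<exists>u. u div s = x \<and> (u, v) \<in> A)}}
           \<le> k * (s choose k)" (is "card ?X \<le> _")
proof (rule ccontr)
  assume big: "\<not> card ?X \<le> k * (s choose k)"
  define cols where "cols x = {v. v div s = y \<and> (\<exists>u. u div s = x \<and> (u, v) \<in> A)}" for x
  let ?R = "{y * s..<y * s + s}"
  have sub: "cols x \<subseteq> ?R" for x
  proof
    fix v assume "v \<in> cols x"
    then have "v div s = y" by (auto simp: cols_def)
    then show "v \<in> ?R" using s div_mult_mod_eq[of v s] mod_less_divisor[OF s, of v] by auto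
  qed
  have "\<exists>J. J \<subseteq> cols x \<and> card J = k" if "x \<in> ?X" for x
  proof -
    have "k \<le> card (cols x)" using that unfolding cols_def by blast
    then show ?thesis by (rule obtain_subset_with_card_n) blast
  qed
  then have "\<forall>x\<in>?X. \<exists>J. J \<subseteq> cols x \<and> card J = k" by blast
  from bchoice[OF this] obtain J where J: "\<forall>x\<in>?X. J x \<subseteq> cols x \<and> card (J x) = k" by (rule exE)
  let ?S = "{K. K \<subseteq> ?R \<and> card K = k}"
  have "J \<in> ?X \<rightarrow> ?S" using J sub by blast
  moreover have "card ?S = s choose k" using n_subsets[of ?R k] by simp
  moreover have "finite ?S" by simp
  ultimately have "\<exists>K\<in>?S. k < card (J -` {K} \<inter> ?X)"
  proof -
    have "\<not> (\<forall>K\<in>?S. card (J -` {K} \<inter> ?X) \<le> k)"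
    proof
      assume le: "\<forall>K\<in>?S. card (J -` {K} \<inter> ?X) \<le> k"
      have "?X = (\<Union>K\<in>?S. J -` {K} \<inter> ?X)" using \<open>J \<in> ?X \<rightarrow> ?S\<close> by blast
      then have "card ?X \<le> (\<Sum>K\<in>?S. card (J -` {K} \<inter> ?X))"
        using card_UN_le[OF \<open>finite ?S\<close>, of "\<lambda>K. J -` {K} \<inter> ?X"] by argo
      also have "\<dots> \<le> (\<Sum>K\<in>?S. k)" using le by (intro sum_mono) auto
      also have "\<dots> = k * (s choose k)" using \<open>card ?S = _\<close> by simp
      finally show False using big by simp
    qed
    then show ?thesis by force
  qed
  then obtain K where K: "card K = k" "k < card (J -` {K} \<inter> ?X)" by blast
  obtain X' where X': "X' \<subseteq> J -` {K} \<inter> ?X" "card X' = k" "finite X'"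
    by (rule obtain_subset_with_card_n[OF less_imp_le[OF K(2)]])
  have "k \<ge> 1" using \<sigma> k by (auto simp: perms_def)
  then have finK: "finite K" using K(1) card.infinite by force
  obtain e where e: "strict_mono_on {1..k} e" "e ` {1..k} = X'"
    using finite_set_enum[OF X'(3)] X'(2) by metis
  obtain c where c: "strict_mono_on {1..k} c" "c ` {1..k} = K"
    using finite_set_enum[OF finK] K(1) by metis
  \<comment> \<open>Row \<open>i\<close> of the matrix goes into the \<open>i\<close>-th chosen
    block, which has a one in every column of \<open>K\<close>. Distinct blocks lie in distinct
    block rows, so the rows increase by themselves.\<close>
  have "\<exists>u. u div s = e i \<and> (u, c (app \<sigma> i)) \<in> A" if "i \<in> {1..k}" for i
  proof -
    have "e i \<in> X'" using e(2) that by blast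
    then have "J (e i) = K" "e i \<in> ?X" using X'(1) by auto
    moreover have "c (app \<sigma> i) \<in> K" using c(2) perms_in[OF \<sigma>] that k by blast
    ultimately have "c (app \<sigma> i) \<in> cols (e i)" using J by blast
    then show ?thesis by (auto simp: cols_def)
  qed
  then obtain r where r: "\<And>i. i \<in> {1..k} \<Longrightarrow> r i div s = e i \<and> (r i, c (app \<sigma> i)) \<in> A" by metis
  have "r i < r j" if "i \<in> {1..k}" "j \<in> {1..k}" "i < j" for i j
  proof (rule ccontr)
    assume "\<not> r i < r j"
    then have "r j div s \<le> r i div s" by (intro div_le_mono) auto
    then show False using r that strict_mono_onD[OF e(1) that] by auto
  qed
  then have "occurs \<sigma> A"
    using r k strict_mono_onD[OF c(1)] by (intro occursI[of \<sigma> r c]) auto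
  then show False using avoid by blast
qed

text \<open>A one picked in each contracted block gives an occurrence in \<open>A\<close>, because
  strictly increasing quotients force strictly increasing numbers.\<close>

lemma occurs_blocks:
  assumes \<sigma>: "\<sigma> \<in> perms" and "occurs \<sigma> ((\<lambda>(u, v). (u div s, v div s)) ` A)"
  shows "occurs \<sigma> A"
proof -
  let ?I = "{1..len \<sigma>}"
  obtain r c where rc: "\<forall>i\<in>?I. \<forall>j\<in>?I. i < j \<longrightarrow> r i < r j" "\<forall>i\<in>?I. \<forall>j\<in>?I. i < j \<longrightarrow> c i < c j"
    "\<forall>i\<in>?I. (r i, c (app \<sigma> i)) \<in> (\<lambda>(u, v). (u div s, v div s)) ` A"
    using assms(2) by (rule occursE)
  have "\<forall>i\<in>?I. \<exists>u v. u div s = r i \<and> v div s = c (app \<sigma> i) \<and> (u, v) \<in> A"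
  proof
    fix i assume "i \<in> ?I"
    then have "(r i, c (app \<sigma> i)) \<in> (\<lambda>(u, v). (u div s, v div s)) ` A" using rc(3) by blast
    then show "\<exists>u v. u div s = r i \<and> v div s = c (app \<sigma> i) \<and> (u, v) \<in> A"
      by (elim imageE) (metis case_prod_beta prod.collapse prod.inject)
  qed
  then obtain u v where uv: "\<forall>i\<in>?I. u i div s = r i \<and> v i div s = c (app \<sigma> i) \<and> (u i, v i) \<in> A"
    by metis
  have perm: "app \<sigma> permutes ?I" using \<sigma> by (auto simp: perms_def)
  have inv: "inv (app \<sigma>) i \<in> ?I" "app \<sigma> (inv (app \<sigma>) i) = i" if "i \<in> ?I" for i
    using permutes_in_image[OF permutes_inv[OF perm]] that permutes_inverses[OF perm] by auto
  have div: "a < b" if "a div s < b div s" for a b :: nat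
    using that div_le_mono[of b a s] by (meson leD leI)
  show ?thesis
  proof (rule occursI[of \<sigma> u "\<lambda>j. v (inv (app \<sigma>) j)"])
    fix i j assume ij: "i \<in> ?I" "j \<in> ?I" "i < j"
    have "u i div s < u j div s" using ij rc(1) uv by simp
    then show "u i < u j" by (rule div)
    have "v (inv (app \<sigma>) i) div s = c i" "v (inv (app \<sigma>) j) div s = c j"
      using uv inv ij by simp_all
    then have "v (inv (app \<sigma>) i) div s < v (inv (app \<sigma>) j) div s" using ij rc(2) by simp
    then show "v (inv (app \<sigma>) i) < v (inv (app \<sigma>) j)" by (rule div)
  next
    fix i assume "i \<in> ?I"
    then show "(u i, v (inv (app \<sigma>) (app \<sigma> i))) \<in> A" using uv permutes_inverses[OF perm] by simp
  qed
qed

text \<open>Transposition carries the bound on wide blocks over to tall ones.\<close>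

lemma occurs_transpose:
  assumes \<sigma>: "\<sigma> \<in> perms" and "occurs (len \<sigma>, inv (app \<sigma>)) (A\<inverse>)"
  shows "occurs \<sigma> A"
proof -
  have perm: "app \<sigma> permutes {1..len \<sigma>}" using \<sigma> by (auto simp: perms_def)
  obtain r c where rc: "\<forall>i\<in>{1..len \<sigma>}. \<forall>j\<in>{1..len \<sigma>}. i < j \<longrightarrow> r i < r j"
    "\<forall>i\<in>{1..len \<sigma>}. \<forall>j\<in>{1..len \<sigma>}. i < j \<longrightarrow> c i < c j"
    "\<forall>i\<in>{1..len \<sigma>}. (r i, c (inv (app \<sigma>) i)) \<in> A\<inverse>"
    using occursE[OF assms(2)] by (metis fst_conv snd_conv)
  show ?thesis
  proof (rule occursI[of \<sigma> c r])
    fix i assume "i \<in> {1..len \<sigma>}"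
    then have "(r (app \<sigma> i), c (inv (app \<sigma>) (app \<sigma> i))) \<in> A\<inverse>" using rc(3) perms_in[OF \<sigma>] by blast
    then show "(c i, r (app \<sigma> i)) \<in> A" using permutes_inverses[OF perm] by simp
  qed (use rc in blast)+
qed

lemma card_le_block_sum:
  assumes "finite B" "f ` A \<subseteq> B" "finite A" "W \<subseteq> B"
    "\<And>b. b \<in> B - W \<Longrightarrow> card {a \<in> A. f a = b} \<le> p" "\<And>b. b \<in> W \<Longrightarrow> card {a \<in> A. f a = b} \<le> q"
  shows "card A \<le> p * card B + q * card W"
proof -
  have "A = (\<Union>b\<in>B. {a \<in> A. f a = b})" using assms(2) by auto
  then have "card A \<le> (\<Sum>b\<in>B. card {a \<in> A. f a = b})"
    using card_UN_le[OF assms(1), of "\<lambda>b. {a \<in> A. f a = b}"] by argo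
  also have "\<dots> = (\<Sum>b\<in>B - W. card {a \<in> A. f a = b}) + (\<Sum>b\<in>W. card {a \<in> A. f a = b})"
    using assms(1,4) by (intro sum.subset_diff) auto
  also have "\<dots> \<le> (\<Sum>b\<in>B - W. p) + (\<Sum>b\<in>W. q)"
    using assms(5,6) by (intro add_mono sum_mono) auto
  also have "\<dots> \<le> p * card B + q * card W"
    using card_mono[OF assms(1), of "B - W"] by simp
  finally show ?thesis .
qed

lemma card_wide_blocks:
  assumes \<sigma>: "\<sigma> \<in> perms" and avoid: "\<not> occurs \<sigma> A" and s: "0 < s" and k: "k = len \<sigma>"
  shows "card {(x, y). x < t \<and> y < t \<and>
           k \<le> card {v. v div s = y \<and> (\<exists>u. u div s = x \<and> (u, v) \<in> A)}} \<le> t * (k * (s choose k))"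
    (is "card ?W \<le> _")
proof -
  let ?X = "\<lambda>y. {x. x < t \<and> k \<le> card {v. v div s = y \<and> (\<exists>u. u div s = x \<and> (u, v) \<in> A)}}"
  have "?W = (\<Union>y\<in>{..<t}. (\<lambda>x. (x, y)) ` ?X y)" by auto
  then have "card ?W \<le> (\<Sum>y<t. card ((\<lambda>x. (x, y)) ` ?X y))" by (simp only: card_UN_le finite_lessThan)
  also have "\<dots> \<le> (\<Sum>y<t. k * (s choose k))"
  proof (rule sum_mono)
    fix y
    have "card ((\<lambda>x. (x, y)) ` ?X y) \<le> card (?X y)" by (rule card_image_le) simp
    then show "card ((\<lambda>x. (x, y)) ` ?X y) \<le> k * (s choose k)"
      using wide_blocks_bound[OF \<sigma> avoid s k] by (rule le_trans)
  qed
  finally show ?thesis by simp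
qed

text \<open>The recursion after contracting \<open>s \<times> s\<close> blocks. A block that is
  neither wide (in \<open>W\<close>) nor tall (in \<open>T\<close>) has ones in at most
  \<open>k - 1\<close> rows and columns, hence at most \<open>(k - 1)\<^sup>2\<close> ones, and the
  nonempty blocks again avoid \<open>\<sigma>\<close>. Wide and tall blocks may be full, but they
  are few.\<close>

lemma marcus_tardos_step:
  assumes \<sigma>: "\<sigma> \<in> perms" and avoid: "\<not> occurs \<sigma> A" and k: "k = len \<sigma>" and s: "s > 0"
    and A: "A \<subseteq> {..<s * t} \<times> {..<s * t}"
    and IH: "\<And>B. B \<subseteq> {..<t} \<times> {..<t} \<Longrightarrow> \<not> occurs \<sigma> B \<Longrightarrow> card B \<le> b"
  shows "card A \<le> (k - 1)\<^sup>2 * b + s\<^sup>2 * (2 * (t * (k * (s choose k))))"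
proof -
  let ?f = "\<lambda>(u, v). (u div s, v div s)"
  define B where "B = ?f ` A"
  define W where "W = {(x, y). x < t \<and> y < t \<and>
    k \<le> card {v. v div s = y \<and> (\<exists>u. u div s = x \<and> (u, v) \<in> A)}}"
  define T where "T = {(x, y). x < t \<and> y < t \<and>
    k \<le> card {u. u div s = x \<and> (\<exists>v. v div s = y \<and> (u, v) \<in> A)}}"
  have finA: "finite A" using A finite_subset by blast
  have dv: "u div s < t" if "u < s * t" for u
    using that s by (simp add: div_less_iff_less_mult mult.commute)
  have B: "B \<subseteq> {..<t} \<times> {..<t}"
    unfolding B_def
  proof clarify
    fix u v assume "(u, v) \<in> A"
    then have "u < s * t" "v < s * t" using A by auto
    then show "u div s \<in> {..<t} \<and> v div s \<in> {..<t}" using dv by simp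
  qed
  have "\<not> occurs \<sigma> B" using occurs_blocks[OF \<sigma>] avoid unfolding B_def by blast
  then have cB: "card B \<le> b" using IH B by blast
  have cW: "card W \<le> t * (k * (s choose k))"
    unfolding W_def by (rule card_wide_blocks[OF \<sigma> avoid s k])
  have \<sigma>': "(len \<sigma>, inv (app \<sigma>)) \<in> perms" using \<sigma> by (auto simp: perms_def permutes_inv)
  have "\<not> occurs (len \<sigma>, inv (app \<sigma>)) (A\<inverse>)" using occurs_transpose[OF \<sigma>] avoid by blast
  from card_wide_blocks[OF \<sigma>' this s, of k t]
  have "card {(x, y). x < t \<and> y < t \<and>
           k \<le> card {v. v div s = y \<and> (\<exists>u. u div s = x \<and> (v, u) \<in> A)}} \<le> t * (k * (s choose k))"
    using k by simp
  moreover have "T = {(x, y). x < t \<and> y < t \<and>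
           k \<le> card {v. v div s = y \<and> (\<exists>u. u div s = x \<and> (v, u) \<in> A)}}\<inverse>"
    by (auto simp: T_def)
  ultimately have cT: "card T \<le> t * (k * (s choose k))" by (simp only: card_inverse)
  have fin_cell: "finite {v. v div s = y}" "card {v. v div s = y} \<le> s" for y
  proof -
    have "{v. v div s = y} \<subseteq> {y * s..<y * s + s}"
    proof
      fix v assume "v \<in> {v. v div s = y}"
      then show "v \<in> {y * s..<y * s + s}"
        using s div_mult_mod_eq[of v s] mod_less_divisor[OF s, of v] by auto
    qed
    then show "finite {v. v div s = y}" "card {v. v div s = y} \<le> s"
      using card_mono[of "{y * s..<y * s + s}" "{v. v div s = y}"] finite_subset[of _ "{y * s..<y * s + s}"]
      by simp_all
  qed
  have cell: "card {a \<in> A. ?f a = b} \<le>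
      card {u. u div s = fst b \<and> (\<exists>v. v div s = snd b \<and> (u, v) \<in> A)} *
      card {v. v div s = snd b \<and> (\<exists>u. u div s = fst b \<and> (u, v) \<in> A)}" for b
  proof -
    let ?P = "{u. u div s = fst b \<and> (\<exists>v. v div s = snd b \<and> (u, v) \<in> A)}"
    let ?Q = "{v. v div s = snd b \<and> (\<exists>u. u div s = fst b \<and> (u, v) \<in> A)}"
    have "finite ?P" "finite ?Q" using fin_cell(1) by (auto intro: finite_subset[rotated])
    moreover have "{a \<in> A. ?f a = b} \<subseteq> ?P \<times> ?Q" by auto
    ultimately show ?thesis using card_mono[of "?P \<times> ?Q" "{a \<in> A. ?f a = b}"]
      by (simp only: card_cartesian_product finite_cartesian_product)
  qed
  have "card A \<le> (k - 1)\<^sup>2 * card B + s\<^sup>2 * card (B \<inter> (W \<union> T))"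
  proof (rule card_le_block_sum[of B ?f])
    show "finite B" "?f ` A \<subseteq> B" using finA by (auto simp: B_def)
    show "card {a \<in> A. ?f a = b} \<le> (k - 1)\<^sup>2" if "b \<in> B - B \<inter> (W \<union> T)" for b
    proof -
      obtain x y where b: "b = (x, y)" by fastforce
      have "x < t" "y < t" using that B b by auto
      then have "card {v. v div s = y \<and> (\<exists>u. u div s = x \<and> (u, v) \<in> A)} \<le> k - 1"
        "card {u. u div s = x \<and> (\<exists>v. v div s = y \<and> (u, v) \<in> A)} \<le> k - 1"
        using that b by (auto simp: W_def T_def)
      then show ?thesis
        using le_trans[OF cell[of b] mult_le_mono] b by (simp add: power2_eq_square)
    qed
    show "card {a \<in> A. ?f a = b} \<le> s\<^sup>2" for b
    proof -
      have "card {u. u div s = fst b \<and> (\<exists>v. v div s = snd b \<and> (u, v) \<in> A)} \<le> s"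
        "card {v. v div s = snd b \<and> (\<exists>u. u div s = fst b \<and> (u, v) \<in> A)} \<le> s"
        by (rule le_trans[OF card_mono[OF fin_cell(1)] fin_cell(2)]; blast)+
      then show ?thesis
        using le_trans[OF cell[of b] mult_le_mono] by (simp add: power2_eq_square)
    qed
  qed (use finA in auto)
  moreover have "card (B \<inter> (W \<union> T)) \<le> card (W \<union> T)"
  proof (rule card_mono)
    have "W \<union> T \<subseteq> {..<t} \<times> {..<t}" by (auto simp: W_def T_def)
    then show "finite (W \<union> T)" using finite_subset by blast
  qed auto
  moreover have "card (W \<union> T) \<le> 2 * (t * (k * (s choose k)))"
    using card_Un_le[of W T] cW cT by linarith
  ultimately show ?thesis
    using cB by (meson add_mono le_trans mult_le_mono2)
qed

text \<open>Only the existence of \<open>D\<close> matters: it bounds the quotients in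
  \<open>fh_const\<close>, so that their limit exists and is finite.\<close>

lemma marcus_tardos:
  assumes \<sigma>: "\<sigma> \<in> perms" and k: "2 \<le> len \<sigma>"
  obtains D where "\<And>n. ex_ones n \<sigma> \<le> D * n"
proof -
  define k where "k = len \<sigma>"
  \<comment> \<open>With this \<open>s\<close> one has \<open>(k - 1)\<^sup>2 + 1 \<le> s\<close>,
    so passing from \<open>s ^ i\<close> to \<open>s ^ Suc i\<close> reproduces the same constant
    \<open>D\<close>; the summand \<open>1\<close> in \<open>D\<close> serves the base case.\<close>
  define s where "s = k\<^sup>2"
  define D where "D = s\<^sup>2 * (2 * (k * (s choose k))) + 1"
  have "k \<ge> 2" using k k_def by simp
  then have "1 < k\<^sup>2" by (intro one_less_power) auto
  then have s: "s > 1" by (simp add: s_def)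
  have pow: "card A \<le> D * s ^ i" if "A \<subseteq> {..<s ^ i} \<times> {..<s ^ i}" "\<not> occurs \<sigma> A" for A i
    using that
  proof (induction i arbitrary: A)
    case 0
    then have "card A \<le> card ({..<1 :: nat} \<times> {..<1 :: nat})" by (intro card_mono) auto
    then show ?case by (simp add: D_def)
  next
    case (Suc i)
    have "card A \<le> (k - 1)\<^sup>2 * (D * s ^ i) + s\<^sup>2 * (2 * (s ^ i * (k * (s choose k))))"
      using Suc s by (intro marcus_tardos_step[OF \<sigma> _ k_def]) auto
    also have "\<dots> \<le> (k - 1)\<^sup>2 * (D * s ^ i) + D * s ^ i"
      by (simp add: D_def algebra_simps)
    also have "\<dots> = ((k - 1)\<^sup>2 + 1) * (D * s ^ i)" by (simp add: algebra_simps)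
    also have "\<dots> \<le> s * (D * s ^ i)"
    proof -
      obtain j where "k = Suc j" using \<open>k \<ge> 2\<close> by (cases k) auto
      then have "(k - 1)\<^sup>2 + 1 \<le> s" by (simp add: s_def power2_eq_square)
      then show ?thesis by (rule mult_le_mono1)
    qed
    finally show ?case by (simp add: algebra_simps)
  qed
  have "ex_ones n \<sigma> \<le> D * s * n" for n
  proof (cases "n = 0")
    case True
    then show ?thesis using ex_ones_attained[OF \<sigma>, of n] by (metis card.empty lessThan_0 Sigma_empty1 subset_empty zero_le)
  next
    case False
    define i where "i = (LEAST i. n \<le> s ^ i)"
    have "n \<le> s ^ n" using s by (simp add: less_imp_le)
    then have ni: "n \<le> s ^ i" unfolding i_def by (rule LeastI)
    have "s ^ i \<le> s * n"
    proof (cases i)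
      case 0
      then show ?thesis using False s by (simp add: Suc_leI)
    next
      case (Suc j)
      then have "\<not> n \<le> s ^ j" unfolding i_def using not_less_Least[of j "\<lambda>i. n \<le> s ^ i"] by auto
      then show ?thesis using Suc by simp
    qed
    obtain A where A: "A \<subseteq> {..<n} \<times> {..<n}" "\<not> occurs \<sigma> A" "card A = ex_ones n \<sigma>"
      using ex_ones_attained[OF \<sigma>] by blast
    have "A \<subseteq> {..<s ^ i} \<times> {..<s ^ i}" using A(1) ni by force
    then have "ex_ones n \<sigma> \<le> D * s ^ i" using pow A by metis
    also have "\<dots> \<le> D * (s * n)" using \<open>s ^ i \<le> s * n\<close> by simp
    finally show ?thesis by (simp add: mult.assoc)
  qed
  then show ?thesis using that by blast
qed

lemma ex_ones_le_fh_const: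
  assumes "\<sigma> \<in> perms" "2 \<le> len \<sigma>"
  shows "real (ex_ones n \<sigma>) \<le> fh_const \<sigma> * n"
proof -
  obtain D where D: "\<And>n. ex_ones n \<sigma> \<le> D * n" using marcus_tardos[OF assms] by blast
  show ?thesis
    unfolding fh_const_def
  proof (rule superadditive_le_lim[where D = "real D"])
    show "real (ex_ones m \<sigma>) + real (ex_ones n \<sigma>) \<le> real (ex_ones (m + n) \<sigma>)" for m n
      using ex_ones_superadditive[OF assms(1), of m n] by (simp flip: of_nat_add)
    show "real (ex_ones n \<sigma>) \<le> real D * real n" for n
      using D[of n] by (simp flip: of_nat_mult)
  qed auto
qed

text \<open>A single one avoids every pattern of length at least \<open>2\<close>. The bound makes
  \<open>M1\<close> positive and of order at least \<open>1 / \<eta>\<close>.\<close>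

lemma fh_const_ge_one:
  assumes "\<sigma> \<in> perms" "2 \<le> len \<sigma>"
  shows "1 \<le> fh_const \<sigma>"
proof -
  have "\<not> occurs \<sigma> {(0, 0)}"
  proof
    assume "occurs \<sigma> {(0, 0)}"
    then obtain r c :: "nat \<Rightarrow> nat" where "\<forall>i\<in>{1..len \<sigma>}. \<forall>j\<in>{1..len \<sigma>}. i < j \<longrightarrow> r i < r j"
      "\<forall>i\<in>{1..len \<sigma>}. \<forall>j\<in>{1..len \<sigma>}. i < j \<longrightarrow> c i < c j"
      "\<forall>i\<in>{1..len \<sigma>}. (r i, c (app \<sigma> i)) \<in> {(0, 0)}"
      by (rule occursE)
    moreover have "1 \<in> {1..len \<sigma>}" "2 \<in> {1..len \<sigma>}" using assms(2) by auto
    moreover have "(1 :: nat) < 2" by simp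
    ultimately have "r 1 < r 2" "r 2 = 0" by blast+
    then show False by simp
  qed
  then have "card {(0 :: nat, 0 :: nat)} \<le> ex_ones 1 \<sigma>" by (intro card_le_ex_ones assms) auto
  then show ?thesis using ex_ones_le_fh_const[OF assms, of 1] by simp
qed

section \<open>Blow-ups inside a sample\<close>

lemma app_inj: "\<pi> \<in> perms \<Longrightarrow> app \<pi> x = app \<pi> y \<longleftrightarrow> x = y"
  by (auto simp: perms_def dest: permutes_inj injD)

lemma hereditary_pattern:
  assumes "hereditary P" "\<beta> \<in> P" "\<beta> \<in> perms" "1 \<le> n"
    and e: "strict_mono_on {1..n} e" "e ` {1..n} \<subseteq> {1..len \<beta>}"
  obtains \<rho> where "(n, \<rho>) \<in> P" "\<rho> permutes {1..n}"
    "\<forall>i\<in>{1..n}. \<forall>j\<in>{1..n}. \<rho> i < \<rho> j \<longleftrightarrow> app \<beta> (e i) < app \<beta> (e j)"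
proof -
  have "inj_on e {1..n}" using e(1) strict_mono_on_imp_inj_on by blast
  then have "inj_on (\<lambda>i. app \<beta> (e i)) {1..n}"
    unfolding inj_on_def app_inj[OF assms(3)] .
  then obtain \<rho> where \<rho>: "\<rho> permutes {1..n}"
    "\<forall>i\<in>{1..n}. \<forall>j\<in>{1..n}. \<rho> i < \<rho> j \<longleftrightarrow> app \<beta> (e i) < app \<beta> (e j)"
    by (rule standardization)
  have "(n, \<rho>) \<in> perms" using \<rho>(1) assms(4) by (simp add: perms_def)
  moreover have "subpermutation (n, \<rho>) \<beta>"
    unfolding subpermutation_def using e \<rho>(2) by (intro exI[of _ e]) auto
  ultimately have "(n, \<rho>) \<in> P" using assms(1,2) unfolding hereditary_def by blast
  then show ?thesis using \<rho> that by blast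
qed

text \<open>Cutting every box down to exactly \<open>k\<close> points and reading the boxes from
  left to right lists the positions of a pattern of \<open>\<beta>\<close> whose blocks are the
  boxes; heredity puts it in \<open>P\<close>.\<close>

lemma blow_up_from_boxes:
  assumes P: "hereditary P" "\<beta> \<in> P" "\<beta> \<in> perms" and M: "1 \<le> M" "1 \<le> k"
    and B: "\<And>j. j \<in> {1..M} \<Longrightarrow> B j \<subseteq> {1..len \<beta>}" "\<And>j. j \<in> {1..M} \<Longrightarrow> k \<le> card (B j)"
    and pos: "\<And>i j x y. i \<in> {1..M} \<Longrightarrow> j \<in> {1..M} \<Longrightarrow> i < j \<Longrightarrow> x \<in> B i \<Longrightarrow> y \<in> B j \<Longrightarrow> x < y"
    and val: "\<And>i j x y. i \<in> {1..M} \<Longrightarrow> j \<in> {1..M} \<Longrightarrow> i \<noteq> j \<Longrightarrow> x \<in> B i \<Longrightarrow> y \<in> B j \<Longrightarrow>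
       app \<beta> x < app \<beta> y \<longleftrightarrow> \<alpha> i < \<alpha> j"
  shows "\<exists>\<alpha>'\<in>P. k_blow_up k (M, \<alpha>) \<alpha>'"
proof -
  have "\<forall>j\<in>{1..M}. \<exists>e. strict_mono_on {1..k} e \<and> e ` {1..k} \<subseteq> B j"
  proof
    fix j assume j: "j \<in> {1..M}"
    obtain J where J: "J \<subseteq> B j" "card J = k" "finite J"
      using obtain_subset_with_card_n[OF B(2)[OF j]] by blast
    obtain e where "strict_mono_on {1..k} e" "e ` {1..k} = J"
      using finite_set_enum[OF J(3)] J(2) by blast
    then show "\<exists>e. strict_mono_on {1..k} e \<and> e ` {1..k} \<subseteq> B j" using J(1) by blast
  qed
  from bchoice[OF this] obtain en where
    en: "\<forall>j\<in>{1..M}. strict_mono_on {1..k} (en j) \<and> en j ` {1..k} \<subseteq> B j" by (rule exE)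
  \<comment> \<open>Index \<open>i\<close> stands for point \<open>(i - 1) mod k + 1\<close> of
    block \<open>bl i\<close>; the shifts are due to counting from \<open>1\<close>.\<close>
  define bl where "bl i = (i - 1) div k + 1" for i
  define e where "e i = en (bl i) ((i - 1) mod k + 1)" for i
  have bl: "bl i \<in> {1..M}" if i: "i \<in> {1..M * k}" for i
  proof -
    have "i - 1 < M * k" using i M by auto
    then have "(i - 1) div k < M" by (simp add: less_mult_imp_div_less)
    then show ?thesis by (simp add: bl_def)
  qed
  have md: "(i - 1) mod k + 1 \<in> {1..k}" for i
    using M(2) mod_less_divisor[of k "i - 1"] unfolding atLeastAtMost_iff by linarith
  have eB: "e i \<in> B (bl i)" if "i \<in> {1..M * k}" for i
    using en bl[OF that] md[of i] unfolding e_def by blast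
  have mono: "strict_mono_on {1..M * k} e"
  proof (rule strict_mono_onI')
    fix i j assume ij: "i \<in> {1..M * k}" "j \<in> {1..M * k}" "i < j"
    have "(i - 1) div k \<le> (j - 1) div k" using ij by (intro div_le_mono) auto
    then consider "bl i < bl j" | "bl i = bl j" unfolding bl_def by linarith
    then show "e i < e j"
    proof cases
      case 1
      then show ?thesis using pos[OF bl[OF ij(1)] bl[OF ij(2)]] eB ij by blast
    next
      case 2
      then have "(i - 1) div k = (j - 1) div k" by (simp add: bl_def)
      moreover have "i - 1 < j - 1" using ij by auto
      ultimately have "(i - 1) mod k + 1 < (j - 1) mod k + 1"
        using div_mult_mod_eq[of "i - 1" k] div_mult_mod_eq[of "j - 1" k] by (metis add_less_cancel_left add_less_cancel_right)
      moreover have "strict_mono_on {1..k} (en (bl j))" using en bl[OF ij(2)] by blast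
      ultimately show ?thesis
        using strict_mono_onD[OF _ md md] unfolding e_def 2 by blast
    qed
  qed
  have range: "e ` {1..M * k} \<subseteq> {1..len \<beta>}" using eB bl B(1) by blast
  have "1 \<le> M * k" using M by simp
  then obtain \<rho> where \<rho>: "(M * k, \<rho>) \<in> P" "\<rho> permutes {1..M * k}"
    "\<forall>i\<in>{1..M * k}. \<forall>j\<in>{1..M * k}. \<rho> i < \<rho> j \<longleftrightarrow> app \<beta> (e i) < app \<beta> (e j)"
    by (rule hereditary_pattern[OF P _ mono range])
  note \<rho> = \<rho>(1,2) \<rho>(3)[rule_format]
  define b where "b j = (j - 1) * k + 1" for j
  have block: "i \<in> {1..M * k} \<and> bl i = j" if "j \<in> {1..M}" "i \<in> {b j..<b (j + 1)}" for i j
  proof -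
    have i: "(j - 1) * k \<le> i - 1" "i - 1 < j * k" "1 \<le> i" using that by (auto simp: b_def)
    have "j * k \<le> M * k" using that by auto
    then have "i \<le> M * k" using i by linarith
    moreover have "(i - 1) div k = j - 1"
    proof (rule div_nat_eqI)
      show "k * (j - 1) \<le> i - 1" using i by (simp add: mult.commute)
      show "i - 1 < k * Suc (j - 1)" using i that by (simp add: mult.commute)
    qed
    ultimately show ?thesis using i that by (auto simp: bl_def)
  qed
  have "blow_up_via b (M, \<alpha>) (M * k, \<rho>)"
    unfolding blow_up_via_def fst_conv snd_conv
  proof (intro conjI ballI impI)
    show "b 1 = 1" "b (M + 1) = M * k + 1" by (auto simp: b_def)
    show "strict_mono_on {1..M + 1} b"
      using M(2) by (intro strict_mono_onI') (auto simp: b_def)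
    fix j1 j2 i1 i2
    assume j: "j1 \<in> {1..M}" "j2 \<in> {1..M}" "j1 \<noteq> j2"
      and i: "i1 \<in> {b j1..<b (j1 + 1)}" "i2 \<in> {b j2..<b (j2 + 1)}"
    note b1 = block[OF j(1) i(1)] and b2 = block[OF j(2) i(2)]
    have "e i1 \<in> B j1" "e i2 \<in> B j2" using eB b1 b2 by blast+
    then show "\<rho> i2 < \<rho> i1 \<longleftrightarrow> \<alpha> j2 < \<alpha> j1"
      using \<rho>(3)[of i2 i1] b1 b2 val[of j2 j1 "e i2" "e i1"] j by simp
  qed
  then have "k_blow_up k (M, \<alpha>) (M * k, \<rho>)"
    unfolding k_blow_up_def using M by (intro exI[of _ b]) (auto simp: b_def algebra_simps)
  then show ?thesis using \<rho>(1) by blast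
qed

text \<open>If \<open>kstar_perm P \<alpha>\<close> were finite, it would be one of the numbers
  whose maximum is \<open>kstar P M\<close>, hence at most \<open>k\<close>; but no size up to
  \<open>k\<close> is missing.\<close>

lemma kstar_blow_up:
  assumes P: "P \<subseteq> perms" and \<alpha>: "\<alpha> \<in> perms" "len \<alpha> = M" and k: "kstar P M = enat k"
    and small: "\<And>k0. 1 \<le> k0 \<Longrightarrow> k0 \<le> k \<Longrightarrow> \<exists>\<alpha>'\<in>P. k_blow_up k0 \<alpha> \<alpha>'"
    and "1 \<le> K"
  shows "\<exists>\<alpha>'\<in>P. k_blow_up K \<alpha> \<alpha>'"
proof (rule ccontr)
  assume "\<not> ?thesis"
  then have no: "no_k_blow_up_in P \<alpha> K" using P by (auto simp: no_k_blow_up_in_def)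
  define k1 where "k1 = (LEAST k. 1 \<le> k \<and> no_k_blow_up_in P \<alpha> k)"
  have k1: "1 \<le> k1 \<and> no_k_blow_up_in P \<alpha> k1"
    unfolding k1_def by (rule LeastI[of _ K]) (use no assms(6) in blast)
  have ks: "kstar_perm P \<alpha> = enat k1"
    using no assms(6) unfolding kstar_perm_def k1_def by auto
  let ?S = "{kstar_perm P \<alpha> |\<alpha>. \<alpha> \<in> perms \<and> len \<alpha> = M \<and> kstar_perm P \<alpha> < \<infinity>}"
  have "?S \<subseteq> kstar_perm P ` {\<alpha> \<in> perms. len \<alpha> = M}" by blast
  then have fin: "finite ?S" using finite_perms_len finite_subset by blast
  have "kstar_perm P \<alpha> < \<infinity>" using ks by simp
  then have "kstar_perm P \<alpha> \<in> ?S" using \<alpha> by blast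
  then have "kstar_perm P \<alpha> \<le> Max ?S" "?S \<noteq> {}" using Max_ge[OF fin] by blast+
  moreover have "kstar P M = Max ?S"
    unfolding kstar_def Let_def using \<open>?S \<noteq> {}\<close> by (rule if_not_P)
  ultimately have "enat k1 \<le> enat k" using ks k by argo
  then have "\<exists>\<alpha>'\<in>P. k_blow_up k1 \<alpha> \<alpha>'" using small k1 by simp
  then show False using k1 P unfolding no_k_blow_up_in_def by blast
qed

text \<open>A finite \<open>kstar P M\<close> comes from a nonempty set, so it is attained at some
  \<open>\<alpha>\<close>, where it is a least positive number.\<close>

lemma kstar_pos:
  assumes k: "kstar P M = enat k"
  shows "1 \<le> k"
proof -
  let ?S = "{kstar_perm P \<alpha> |\<alpha>. \<alpha> \<in> perms \<and> len \<alpha> = M \<and> kstar_perm P \<alpha> < \<infinity>}"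
  have "?S \<subseteq> kstar_perm P ` {\<alpha> \<in> perms. len \<alpha> = M}" by blast
  then have fin: "finite ?S" using finite_perms_len finite_subset by blast
  have ne: "?S \<noteq> {}"
  proof
    assume "?S = {}"
    then have "kstar P M = \<infinity>" unfolding kstar_def Let_def by (rule if_P)
    then show False using k by simp
  qed
  have "kstar P M = Max ?S" unfolding kstar_def Let_def using ne by (rule if_not_P)
  moreover have "Max ?S \<in> ?S" using fin ne by (rule Max_in)
  ultimately have "enat k \<in> ?S" using k by argo
  then obtain \<alpha> where \<alpha>: "kstar_perm P \<alpha> = enat k" by auto
  then have ex: "\<exists>k\<ge>1. no_k_blow_up_in P \<alpha> k" unfolding kstar_perm_def by (metis enat.distinct(2))
  then have "k = (LEAST k. 1 \<le> k \<and> no_k_blow_up_in P \<alpha> k)"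
    using \<alpha> unfolding kstar_perm_def by simp
  then show ?thesis using LeastI_ex[of "\<lambda>k. 1 \<le> k \<and> no_k_blow_up_in P \<alpha> k"] ex by blast
qed

section \<open>Moving a permutation into a blow-up and the cost of it\<close>

text \<open>The points are sent to the blocks prescribed by \<open>\<phi>\<close>, keeping their
  order of position inside each block; size \<open>n\<close> leaves room for all of them in one
  block. Positions cost the pairs that change order between blocks. For values, every pair inside a
  block is counted, as the pattern there is arbitrary.\<close>

lemma blow_up_approximation:
  assumes P: "hereditary P" "P \<subseteq> perms" and n: "1 \<le> n"
    and \<alpha>': "\<alpha>' \<in> P" "k_blow_up n (M, \<alpha>) \<alpha>'"
    and \<pi>: "\<pi> permutes {1..n}" and \<phi>: "\<And>p. p \<in> {1..n} \<Longrightarrow> \<phi> p \<in> {1..M}"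
  shows "\<exists>\<rho> d. (n, \<rho>) \<in> P \<and> (planar_simple_transposition n ^^ d) \<pi> \<rho> \<and>
    d \<le> card {(p, q). p \<in> {1..n} \<and> q \<in> {1..n} \<and> p < q \<and> \<phi> q < \<phi> p}
      + card {(p, q). p \<in> {1..n} \<and> q \<in> {1..n} \<and> \<pi> p < \<pi> q \<and> (\<phi> p = \<phi> q \<or> \<alpha> (\<phi> q) < \<alpha> (\<phi> p))}"
    (is "\<exists>\<rho> d. _ \<and> _ \<and> d \<le> card ?I1 + card ?I2")
proof -
  obtain b where b: "blow_up_via b (M, \<alpha>) \<alpha>'" "\<forall>j\<in>{1..M}. b (j + 1) - b j = n"
    using \<alpha>'(2) unfolding k_blow_up_def by auto
  have b_mono: "b i < b j" if "i \<in> {1..M + 1}" "j \<in> {1..M + 1}" "i < j" for i j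
  proof -
    have "strict_mono_on {1..M + 1} b" using b(1) unfolding blow_up_via_def by simp
    then show ?thesis using that by (rule strict_mono_onD)
  qed
  have b_size: "b (j + 1) = b j + n" if "j \<in> {1..M}" for j
    using b(2) that b_mono[of j "j + 1"] by force
  have b_ends: "b 1 = 1" "b (M + 1) = len \<alpha>' + 1"
    using b(1) unfolding blow_up_via_def by auto
  have b_val: "app \<alpha>' i2 < app \<alpha>' i1 \<longleftrightarrow> \<alpha> j2 < \<alpha> j1"
    if "j1 \<in> {1..M}" "j2 \<in> {1..M}" "j1 \<noteq> j2" "i1 \<in> {b j1..<b (j1 + 1)}" "i2 \<in> {b j2..<b (j2 + 1)}"
    for i1 i2 j1 j2
    using b(1) that unfolding blow_up_via_def by auto
  \<comment> \<open>The place of \<open>p\<close> inside its block, counted from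
    \<open>0\<close>.\<close>
  define cnt where "cnt p = card {q \<in> {1..n}. q < p \<and> \<phi> q = \<phi> p}" for p
  define \<theta> where "\<theta> p = b (\<phi> p) + cnt p" for p
  have cnt: "cnt p < n" if p: "p \<in> {1..n}" for p
  proof -
    have "cnt p \<le> card {1..<p}" unfolding cnt_def by (rule card_mono) auto
    then show ?thesis using p by auto
  qed
  have \<theta>_block: "\<theta> p \<in> {b (\<phi> p)..<b (\<phi> p + 1)}" if "p \<in> {1..n}" for p
    using cnt[OF that] b_size[OF \<phi>[OF that]] by (auto simp: \<theta>_def)
  have \<theta>_less: "\<theta> p < \<theta> q" if pq: "p \<in> {1..n}" "q \<in> {1..n}" "\<phi> p < \<phi> q" for p q
  proof -
    have "b (\<phi> p + 1) \<le> b (\<phi> q)"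
    proof (cases "\<phi> p + 1 = \<phi> q")
      case False
      then show ?thesis using b_mono[of "\<phi> p + 1" "\<phi> q"] \<phi>[OF pq(1)] \<phi>[OF pq(2)] pq(3) by force
    qed simp
    then show ?thesis using \<theta>_block[OF pq(1)] \<theta>_block[OF pq(2)] by auto
  qed
  have \<theta>_less': "\<theta> p < \<theta> q" if pq: "p \<in> {1..n}" "q \<in> {1..n}" "\<phi> p = \<phi> q" "p < q" for p q
  proof -
    have "{r \<in> {1..n}. r < p \<and> \<phi> r = \<phi> p} \<subseteq> {r \<in> {1..n}. r < q \<and> \<phi> r = \<phi> q}"
      "p \<in> {r \<in> {1..n}. r < q \<and> \<phi> r = \<phi> q}" "p \<notin> {r \<in> {1..n}. r < p \<and> \<phi> r = \<phi> p}"
      using pq by auto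
    then have "{r \<in> {1..n}. r < p \<and> \<phi> r = \<phi> p} \<subset> {r \<in> {1..n}. r < q \<and> \<phi> r = \<phi> q}" by blast
    then have "cnt p < cnt q" unfolding cnt_def by (intro psubset_card_mono) auto
    then show ?thesis using pq by (simp add: \<theta>_def)
  qed
  have \<theta>_cases: "\<phi> p < \<phi> q \<or> \<phi> p = \<phi> q \<and> p < q"
    if "p \<in> {1..n}" "q \<in> {1..n}" "\<theta> p < \<theta> q" for p q
    using \<theta>_less[of q p] \<theta>_less'[of q p] that by (metis less_asym linorder_neqE_nat)
  have "inj_on \<theta> {1..n}"
    using \<theta>_less \<theta>_less' by (intro inj_onI) (metis less_irrefl linorder_neqE_nat)
  then obtain \<Phi> where \<Phi>: "\<Phi> permutes {1..n}"
    "\<forall>i\<in>{1..n}. \<forall>j\<in>{1..n}. \<Phi> i < \<Phi> j \<longleftrightarrow> \<theta> i < \<theta> j"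
    by (rule standardization)
  note \<Phi> = \<Phi>(1) \<Phi>(2)[rule_format]
  let ?f = "inv \<Phi>"
  have f: "?f permutes {1..n}" using \<Phi>(1) by (rule permutes_inv)
  have f_in: "?f i \<in> {1..n}" if "i \<in> {1..n}" for i using permutes_in_image[OF f] that by blast
  have \<Phi>f: "\<Phi> (?f i) = i" "?f (\<Phi> i) = i" for i using permutes_inverses[OF \<Phi>(1)] by auto
  define e where "e i = \<theta> (?f i)" for i
  have mono: "strict_mono_on {1..n} e"
    unfolding e_def by (intro strict_mono_onI') (use \<Phi>(2) f_in \<Phi>f in metis)
  have range: "e ` {1..n} \<subseteq> {1..len \<alpha>'}"
  proof (rule image_subsetI)
    fix i assume "i \<in> {1..n}"
    then have p: "?f i \<in> {1..n}" by (rule f_in)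
    note \<phi>p = \<phi>[OF p]
    have "b 1 \<le> b (\<phi> (?f i))" using b_mono[of 1 "\<phi> (?f i)"] \<phi>p by (cases "\<phi> (?f i) = 1") auto
    moreover have "b (\<phi> (?f i) + 1) \<le> b (M + 1)"
      using b_mono[of "\<phi> (?f i) + 1" "M + 1"] \<phi>p by (cases "\<phi> (?f i) = M") auto
    ultimately show "e i \<in> {1..len \<alpha>'}" using \<theta>_block[OF p] b_ends by (auto simp: e_def)
  qed
  have \<alpha>'p: "\<alpha>' \<in> perms" using P(2) \<alpha>'(1) by blast
  obtain \<rho> where \<rho>: "(n, \<rho>) \<in> P" "\<rho> permutes {1..n}"
    "\<forall>i\<in>{1..n}. \<forall>j\<in>{1..n}. \<rho> i < \<rho> j \<longleftrightarrow> app \<alpha>' (e i) < app \<alpha>' (e j)"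
    by (rule hereditary_pattern[OF P(1) \<alpha>'(1) \<alpha>'p n mono range])
  note \<rho> = \<rho>(1,2) \<rho>(3)[rule_format]
  let ?r = "inv \<rho>"
  have r: "?r permutes {1..n}" using \<rho>(2) by (rule permutes_inv)
  have r_in: "?r i \<in> {1..n}" if "i \<in> {1..n}" for i using permutes_in_image[OF r] that by blast
  have \<rho>r: "\<rho> (?r i) = i" for i using permutes_inverses[OF \<rho>(2)] by auto
  \<comment> \<open>The rearrangement of values that remains after the positions have been arranged
    by \<open>?f\<close>: it is chosen so that \<open>inv g \<circ> \<pi> \<circ> ?f\<close> equals
    \<open>\<rho>\<close>.\<close>
  define g where "g = \<pi> \<circ> ?f \<circ> ?r"
  have g: "g permutes {1..n}" unfolding g_def using \<pi> f r permutes_compose by blast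
  obtain d where d: "d \<le> card (inversions n ?f) + card (inversions n g)"
    "(planar_simple_transposition n ^^ d) \<pi> (inv g \<circ> \<pi> \<circ> ?f)"
    using planar_path[OF \<pi> f g] by blast
  have "inv g \<circ> \<pi> \<circ> ?f = \<rho>"
  proof
    fix i
    have "g (\<rho> i) = \<pi> (?f i)" using permutes_inverses[OF \<rho>(2)] by (simp add: g_def)
    then show "(inv g \<circ> \<pi> \<circ> ?f) i = \<rho> i" using permutes_inverses(2)[OF g, of "\<rho> i"] by simp
  qed
  then have path: "(planar_simple_transposition n ^^ d) \<pi> \<rho>" using d(2) by simp
  have finI: "finite ?I1" "finite ?I2"
    by (rule finite_subset[of _ "{1..n} \<times> {1..n}"]; auto)+
  have inj_f: "inj ?f" and inj_r: "inj ?r" using f r permutes_inj by blast+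
  have "card (inversions n ?f) \<le> card ?I1"
  proof (rule card_inj_on_le[of "\<lambda>(i, j). (?f j, ?f i)"])
    show "inj_on (\<lambda>(i, j). (?f j, ?f i)) (inversions n ?f)"
      using inj_f by (auto simp: inj_on_def)
    show "(\<lambda>(i, j). (?f j, ?f i)) ` inversions n ?f \<subseteq> ?I1"
    proof clarify
      fix i j assume "(i, j) \<in> inversions n ?f"
      then have ij: "i \<in> {1..n}" "j \<in> {1..n}" "i < j" "?f j < ?f i" by (auto simp: inversions_def)
      then have "\<theta> (?f i) < \<theta> (?f j)" using \<Phi>(2)[of "?f i" "?f j"] f_in \<Phi>f by simp
      then have "\<phi> (?f i) < \<phi> (?f j)" using \<theta>_cases[of "?f i" "?f j"] ij f_in by auto
      then show "?f j \<in> {1..n} \<and> ?f i \<in> {1..n} \<and> ?f j < ?f i \<and> \<phi> (?f i) < \<phi> (?f j)"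
        using ij f_in by blast
    qed
  qed (rule finI)
  moreover have "card (inversions n g) \<le> card ?I2"
  proof (rule card_inj_on_le[of "\<lambda>(i, j). (?f (?r j), ?f (?r i))"])
    show "inj_on (\<lambda>(i, j). (?f (?r j), ?f (?r i))) (inversions n g)"
      using inj_f inj_r by (auto simp: inj_on_def dest: injD)
    show "(\<lambda>(i, j). (?f (?r j), ?f (?r i))) ` inversions n g \<subseteq> ?I2"
    proof clarify
      fix i j assume "(i, j) \<in> inversions n g"
      then have ij: "i \<in> {1..n}" "j \<in> {1..n}" "i < j" "g j < g i" by (auto simp: inversions_def)
      let ?p = "?f (?r j)" and ?q = "?f (?r i)"
      have pq: "?p \<in> {1..n}" "?q \<in> {1..n}" using ij f_in r_in by blast+
      have "app \<alpha>' (\<theta> ?q) < app \<alpha>' (\<theta> ?p)"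
        using \<rho>(3)[of "?r i" "?r j"] \<rho>r r_in ij by (simp add: e_def)
      then have "\<phi> ?p = \<phi> ?q \<or> \<alpha> (\<phi> ?q) < \<alpha> (\<phi> ?p)"
        using b_val[of "\<phi> ?p" "\<phi> ?q" "\<theta> ?p" "\<theta> ?q"] \<phi> \<theta>_block pq by blast
      then show "?p \<in> {1..n} \<and> ?q \<in> {1..n} \<and> \<pi> ?p < \<pi> ?q \<and> (\<phi> ?p = \<phi> ?q \<or> \<alpha> (\<phi> ?q) < \<alpha> (\<phi> ?p))"
        using pq ij(4) by (simp add: g_def)
    qed
  qed (rule finI)
  ultimately have "d \<le> card ?I1 + card ?I2" using d(1) by linarith
  then show ?thesis using \<rho>(1) path by blast
qed

text \<open>For an inverted pair, \<open>x q - x p\<close> is at most the rise of \<open>p\<close>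
  plus the fall of \<open>q\<close>, hence at most twice the larger one. The pair is charged to the
  point that moves more, and injectivity of \<open>x\<close> limits the charges to twice its
  displacement. One of the two truncated differences always vanishes.\<close>

lemma card_inverted_pairs_le:
  fixes x X :: "'a \<Rightarrow> nat"
  assumes A: "finite A" "inj_on x A"
  shows "card {(p, q). p \<in> A \<and> q \<in> A \<and> x p < x q \<and> X q \<le> X p}
           \<le> 2 * (\<Sum>p\<in>A. (X p - x p) + (x p - X p))"
proof -
  let ?U = "\<lambda>p. {q \<in> A. x q \<in> {x p<..x p + 2 * (X p - x p)}}"
  let ?V = "\<lambda>q. {p \<in> A. x p \<in> {x q - 2 * (x q - X q)..<x q}}"
  have inv: "card {q \<in> A. x q \<in> I} \<le> card I" if "finite I" for I
    using that A(2) by (intro card_inj_on_le[of x]) (auto intro: inj_on_subset)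
  have "{(p, q). p \<in> A \<and> q \<in> A \<and> x p < x q \<and> X q \<le> X p} \<subseteq> (\<Union>p\<in>A. Pair p ` ?U p) \<union> (\<Union>q\<in>A. (\<lambda>p. (p, q)) ` ?V q)"
  proof clarify
    fix p q assume pq: "p \<in> A" "q \<in> A" "x p < x q" "X q \<le> X p"
      "(p, q) \<notin> (\<Union>q\<in>A. (\<lambda>p. (p, q)) ` ?V q)"
    then have "\<not> x q - 2 * (x q - X q) \<le> x p" by auto
    then have "x q \<le> x p + 2 * (X p - x p)" using pq by linarith
    then show "(p, q) \<in> (\<Union>p\<in>A. Pair p ` ?U p)" using pq by auto
  qed
  then have "card {(p, q). p \<in> A \<and> q \<in> A \<and> x p < x q \<and> X q \<le> X p}
      \<le> card ((\<Union>p\<in>A. Pair p ` ?U p) \<union> (\<Union>q\<in>A. (\<lambda>p. (p, q)) ` ?V q))"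
    using A(1) by (intro card_mono) auto
  also have "\<dots> \<le> card (\<Union>p\<in>A. Pair p ` ?U p) + card (\<Union>q\<in>A. (\<lambda>p. (p, q)) ` ?V q)"
    by (rule card_Un_le)
  also have "card (\<Union>p\<in>A. Pair p ` ?U p) \<le> (\<Sum>p\<in>A. 2 * (X p - x p))"
  proof -
    have "card (\<Union>p\<in>A. Pair p ` ?U p) \<le> (\<Sum>p\<in>A. card (Pair p ` ?U p))" using A(1) by (rule card_UN_le)
    also have "\<dots> \<le> (\<Sum>p\<in>A. 2 * (X p - x p))"
    proof (rule sum_mono)
      fix p
      have "card (Pair p ` ?U p) \<le> card (?U p)" using A(1) by (intro card_image_le) auto
      also have "\<dots> \<le> 2 * (X p - x p)" using inv[of "{x p<..x p + 2 * (X p - x p)}"] by simp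
      finally show "card (Pair p ` ?U p) \<le> 2 * (X p - x p)" .
    qed
    finally show ?thesis .
  qed
  also have "card (\<Union>q\<in>A. (\<lambda>p. (p, q)) ` ?V q) \<le> (\<Sum>q\<in>A. 2 * (x q - X q))"
  proof -
    have "card (\<Union>q\<in>A. (\<lambda>p. (p, q)) ` ?V q) \<le> (\<Sum>q\<in>A. card ((\<lambda>p. (p, q)) ` ?V q))"
      using A(1) by (rule card_UN_le)
    also have "\<dots> \<le> (\<Sum>q\<in>A. 2 * (x q - X q))"
    proof (rule sum_mono)
      fix q
      have "card ((\<lambda>p. (p, q)) ` ?V q) \<le> card (?V q)" using A(1) by (intro card_image_le) auto
      also have "\<dots> \<le> card {x q - 2 * (x q - X q)..<x q}" by (rule inv) simp
      also have "\<dots> \<le> 2 * (x q - X q)" by simp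
      finally show "card ((\<lambda>p. (p, q)) ` ?V q) \<le> 2 * (x q - X q)" .
    qed
    finally show ?thesis .
  qed
  finally show ?thesis by (simp add: sum.distrib sum_distrib_left algebra_simps)
qed

section \<open>Choosing heavy cells and boxes inside them\<close>

lemma pigeonhole_cell:
  assumes "finite T" "finite C" "f ` T \<subseteq> C" "k * card C \<le> card T" "C \<noteq> {}"
  shows "\<exists>c\<in>C. k \<le> card {x \<in> T. f x = c}"
proof (rule ccontr)
  assume "\<not> ?thesis"
  then have less: "card {x \<in> T. f x = c} < k" if "c \<in> C" for c using that by force
  have "T = (\<Union>c\<in>C. {x \<in> T. f x = c})" using assms(3) by auto
  then have "card T \<le> (\<Sum>c\<in>C. card {x \<in> T. f x = c})"
    using card_UN_le[OF assms(2), of "\<lambda>c. {x \<in> T. f x = c}"] by argo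
  also have "\<dots> < (\<Sum>c\<in>C. k)" using assms less by (intro sum_strict_mono) auto
  finally show False using assms(4) by (simp add: mult.commute)
qed

text \<open>Boxes are chosen greedily: the at most \<open>M\<close> columns and \<open>M\<close> rows used so far cover at most
  \<open>2 * M * w\<close> points of the next host, and the remaining points lie in \<open>N\<^sup>2\<close> boxes.\<close>

lemma greedy_boxes:
  fixes col row :: "'a \<Rightarrow> nat"
  assumes "finite U" "0 < N" "1 \<le> k"
    and N: "\<And>x. x \<in> U \<Longrightarrow> col x < N" "\<And>x. x \<in> U \<Longrightarrow> row x < N"
    and w: "\<And>c. card {x \<in> U. col x = c} \<le> w" "\<And>c. card {x \<in> U. row x = c} \<le> w"
    and H: "\<And>j. j \<in> {1..M} \<Longrightarrow> H j \<subseteq> U" "\<And>j. j \<in> {1..M} \<Longrightarrow> 2 * M * w + k * N\<^sup>2 \<le> card (H j)"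
  shows "\<exists>c r. inj_on c {1..M} \<and> inj_on r {1..M} \<and>
           (\<forall>j\<in>{1..M}. k \<le> card {x \<in> H j. col x = c j \<and> row x = r j})"
proof -
  have "\<exists>c r. inj_on c {1..t} \<and> inj_on r {1..t} \<and>
           (\<forall>j\<in>{1..t}. k \<le> card {x \<in> H j. col x = c j \<and> row x = r j})" if "t \<le> M" for t
    using that
  proof (induction t)
    case 0
    show ?case by simp
  next
    case (Suc t)
    then obtain c r where cr: "inj_on c {1..t}" "inj_on r {1..t}"
      "\<forall>j\<in>{1..t}. k \<le> card {x \<in> H j. col x = c j \<and> row x = r j}" by auto
    let ?H = "H (Suc t)"
    have S: "Suc t \<in> {1..M}" using Suc.prems by simp
    let ?R = "(\<Union>i\<in>{1..t}. {x \<in> U. col x = c i}) \<union> (\<Union>i\<in>{1..t}. {x \<in> U. row x = r i})"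
    have bd: "card (\<Union>i\<in>{1..t}. {x \<in> U. g x = h i}) \<le> M * w"
      if "\<And>c. card {x \<in> U. g x = c} \<le> w" for g :: "'b \<Rightarrow> nat" and U :: "'b set" and h :: "nat \<Rightarrow> nat"
    proof -
      have "card (\<Union>i\<in>{1..t}. {x \<in> U. g x = h i}) \<le> (\<Sum>i\<in>{1..t}. card {x \<in> U. g x = h i})"
        by (rule card_UN_le) simp
      also have "\<dots> \<le> (\<Sum>i\<in>{1..t}. w)" using that by (intro sum_mono) auto
      also have "\<dots> \<le> M * w" using Suc.prems by simp
      finally show ?thesis .
    qed
    have "card ?R \<le> 2 * M * w"
      using card_Un_le[of "\<Union>i\<in>{1..t}. {x \<in> U. col x = c i}" "\<Union>i\<in>{1..t}. {x \<in> U. row x = r i}"]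
        bd[OF w(1), of c] bd[OF w(2), of r] by linarith
    moreover have "card ?H - card ?R \<le> card (?H - ?R)"
      by (rule diff_card_le_card_Diff) (use assms(1) in auto)
    ultimately have big: "k * N\<^sup>2 \<le> card (?H - ?R)" using H(2)[OF S] by linarith
    have finH: "finite (?H - ?R)" using assms(1) H(1)[OF S] by (meson finite_Diff finite_subset)
    have "\<exists>z\<in>{..<N} \<times> {..<N}. k \<le> card {x \<in> ?H - ?R. (col x, row x) = z}"
    proof (rule pigeonhole_cell)
      show "(\<lambda>x. (col x, row x)) ` (?H - ?R) \<subseteq> {..<N} \<times> {..<N}" using N H(1)[OF S] by auto
      show "k * card ({..<N} \<times> {..<N}) \<le> card (?H - ?R)" using big by (simp add: power2_eq_square)
    qed (use finH assms in auto)
    then obtain c0 r0 where z: "k \<le> card {x \<in> ?H - ?R. (col x, row x) = (c0, r0)}" by blast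
    \<comment> \<open>Since \<open>k \<ge> 1\<close>, the new box has a point, and that point lies
      outside all used columns and rows; so the column and the row of the box are new.\<close>
    then have "card {x \<in> ?H - ?R. (col x, row x) = (c0, r0)} \<noteq> 0" using assms(3) by linarith
    then have "{x \<in> ?H - ?R. (col x, row x) = (c0, r0)} \<noteq> {}" by (metis card.empty)
    then obtain x0 where x0: "x0 \<in> ?H - ?R" "col x0 = c0" "row x0 = r0" by blast
    then have "x0 \<in> U" using H(1)[OF S] by blast
    then have new: "c0 \<notin> c ` {1..t}" "r0 \<notin> r ` {1..t}" using x0 by auto
    have "card {x \<in> ?H - ?R. (col x, row x) = (c0, r0)} \<le> card {x \<in> ?H. col x = c0 \<and> row x = r0}"
      by (rule card_mono) (use assms(1) H(1)[OF S] in \<open>auto intro: finite_subset\<close>)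
    then have k0: "k \<le> card {x \<in> ?H. col x = c0 \<and> row x = r0}" using z by linarith
    define c' where "c' = c(Suc t := c0)"
    define r' where "r' = r(Suc t := r0)"
    have I: "{1..Suc t} = insert (Suc t) {1..t}" by auto
    have upd: "inj_on (f(Suc t := y)) {1..Suc t}" if "inj_on f {1..t}" "y \<notin> f ` {1..t}"
      for f :: "nat \<Rightarrow> nat" and y
    proof -
      have "inj_on (f(Suc t := y)) {1..t} \<longleftrightarrow> inj_on f {1..t}" by (rule inj_on_cong) simp
      moreover have "(f(Suc t := y)) ` ({1..t} - {Suc t}) = f ` {1..t}" by (rule image_cong) auto
      ultimately show ?thesis unfolding I inj_on_insert using that by simp
    qed
    have "inj_on c' {1..Suc t}" "inj_on r' {1..Suc t}"
      unfolding c'_def r'_def by (rule upd; fact)+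
    moreover have "\<forall>j\<in>{1..Suc t}. k \<le> card {x \<in> H j. col x = c' j \<and> row x = r' j}"
      using cr(3) k0 unfolding I c'_def r'_def by auto
    ultimately show ?case by blast
  qed
  then show ?thesis by blast
qed

text \<open>Inclusion-minimal members of a laminar family are pairwise disjoint, and each takes at
  least the share \<open>1 / M\<close> of \<open>U\<close>, so there are at most \<open>M\<close> of
  them. Finiteness puts one inside every member.\<close>

lemma laminar_hosts:
  fixes m M :: nat
  assumes fin: "finite U" "card U = m" "0 < m" and F: "F \<noteq> {}" "\<And>Q. Q \<in> F \<Longrightarrow> Q \<subseteq> U"
    and lam: "\<And>Q R. Q \<in> F \<Longrightarrow> R \<in> F \<Longrightarrow> Q \<subseteq> R \<or> R \<subseteq> Q \<or> Q \<inter> R = {}"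
    and heavy: "\<And>Q. Q \<in> F \<Longrightarrow> m \<le> M * card Q"
  obtains H where "\<And>j. j \<in> {1..M} \<Longrightarrow> H j \<in> F" "\<And>Q. Q \<in> F \<Longrightarrow> \<exists>j\<in>{1..M}. H j \<subseteq> Q"
proof -
  have finF: "finite F"
  proof -
    have "F \<subseteq> Pow U" using F(2) by blast
    then show ?thesis using fin(1) finite_subset by blast
  qed
  define Mi where "Mi = {Q \<in> F. \<forall>R\<in>F. R \<subseteq> Q \<longrightarrow> Q = R}"
  have min: "\<exists>R\<in>Mi. R \<subseteq> Q" if "Q \<in> F" for Q
    using finite_has_minimal2[OF finF that] unfolding Mi_def by blast
  have ne: "Mi \<noteq> {}" using F(1) min by blast
  have finM: "finite Mi" using finF by (simp add: Mi_def)
  have "card (\<Union>Mi) = (\<Sum>Q\<in>Mi. card Q)"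
  proof (rule card_Union_disjoint)
    show "pairwise disjnt Mi"
    proof (rule pairwiseI)
      fix Q R assume "Q \<in> Mi" "R \<in> Mi" "Q \<noteq> R"
      then have "Q \<in> F" "R \<in> F" "\<not> Q \<subseteq> R" "\<not> R \<subseteq> Q" unfolding Mi_def by auto
      then show "disjnt Q R" using lam[of Q R] unfolding disjnt_def by blast
    qed
    show "finite Q" if "Q \<in> Mi" for Q
    proof -
      have "Q \<in> F" using that by (simp add: Mi_def)
      then show ?thesis using finite_subset[OF F(2) fin(1)] by blast
    qed
  qed
  moreover have "card (\<Union>Mi) \<le> m"
  proof -
    have "\<Union>Mi \<subseteq> U" using F(2) unfolding Mi_def by blast
    then show ?thesis using card_mono[OF fin(1), of "\<Union>Mi"] fin(2) by simp
  qed
  ultimately have "(\<Sum>Q\<in>Mi. card Q) \<le> m" by simp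
  then have "M * (\<Sum>Q\<in>Mi. card Q) \<le> M * m" by simp
  moreover have "card Mi * m \<le> M * (\<Sum>Q\<in>Mi. card Q)"
  proof -
    have "(\<Sum>Q\<in>Mi. m) \<le> (\<Sum>Q\<in>Mi. M * card Q)" using heavy by (intro sum_mono) (auto simp: Mi_def)
    then show ?thesis by (simp add: sum_distrib_left)
  qed
  ultimately have "card Mi * m \<le> M * m" by linarith
  then have cM: "card Mi \<le> M" using fin(3) by simp
  obtain h where h: "bij_betw h {1..card Mi} Mi"
    using ex_bij_betw_nat_finite_1[OF finM] by blast
  obtain Q0 where Q0: "Q0 \<in> Mi" using ne by blast
  show ?thesis
  \<comment> \<open>A minimal set is repeated when there are fewer than \<open>M\<close>, because
    the later blow-up needs exactly \<open>M\<close> boxes; several boxes may share a host.\<close>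
  proof (rule that[of "\<lambda>j. if j \<in> {1..card Mi} then h j else Q0"])
    note img = bij_betw_imp_surj_on[OF h]
    have "h j \<in> Mi" if "j \<in> {1..card Mi}" for j using imageI[OF that, of h] unfolding img .
    then show "(if j \<in> {1..card Mi} then h j else Q0) \<in> F" for j
      using Q0 by (auto simp: Mi_def)
    fix Q assume "Q \<in> F"
    then obtain R where R: "R \<in> Mi" "R \<subseteq> Q" using min by blast
    have "R \<in> h ` {1..card Mi}" unfolding img by (rule R(1))
    then obtain j where "j \<in> {1..card Mi}" "h j = R" by (metis imageE)
    then show "\<exists>j\<in>{1..M}. (if j \<in> {1..card Mi} then h j else Q0) \<subseteq> Q"
      using R(2) cM by (intro bexI[of _ j]) auto
  qed
qed

section \<open>Dyadic cells\<close>

text \<open>The absolute difference; truncated subtraction makes one summand zero.\<close>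

definition gap :: "nat \<Rightarrow> nat \<Rightarrow> nat" where
  "gap a b = (a - b) + (b - a)"

text \<open>The index of the strip of \<open>p\<close> among \<open>2 ^ l\<close> strips of length
  \<open>n / 2 ^ l\<close>, which need not be an integer. The shift makes positions start at
  \<open>0\<close>.\<close>

definition dyadic :: "nat \<Rightarrow> nat \<Rightarrow> nat \<Rightarrow> nat" where
  "dyadic n l p = (p - 1) * 2 ^ l div n"

definition cell :: "nat \<Rightarrow> (nat \<Rightarrow> nat) \<Rightarrow> nat \<Rightarrow> nat \<Rightarrow> nat \<times> nat" where
  "cell n \<pi> l p = (dyadic n l p, dyadic n l (\<pi> p))"

text \<open>Nested integer divisions collapse, so the grids refine each other for every
  \<open>n\<close>. This is what makes the cells of all scales laminar.\<close>

lemma dyadic_coarsen: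
  assumes "l \<le> l'"
  shows "dyadic n l p = dyadic n l' p div 2 ^ (l' - l)"
proof -
  have "(2 :: nat) ^ l' = 2 ^ l * 2 ^ (l' - l)" using assms by (simp flip: power_add)
  then have "dyadic n l' p div 2 ^ (l' - l) = ((p - 1) * 2 ^ l * 2 ^ (l' - l)) div (n * 2 ^ (l' - l))"
    by (simp add: dyadic_def div_mult2_eq mult.assoc)
  also have "\<dots> = dyadic n l p" by (simp add: dyadic_def)
  finally show ?thesis by simp
qed

lemma cell_coarsen:
  assumes "l \<le> l'" "cell n \<pi> l' p = cell n \<pi> l' q"
  shows "cell n \<pi> l p = cell n \<pi> l q"
  using assms(2) unfolding cell_def by (simp add: dyadic_coarsen[OF assms(1)])

lemma dyadic_less:
  assumes "p \<in> {1..n}"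
  shows "dyadic n l p < 2 ^ l"
proof -
  have "p - 1 < n" "0 < n" using assms by auto
  then have "(p - 1) * 2 ^ l < 2 ^ l * n" by (simp add: mult.commute)
  then show ?thesis using \<open>0 < n\<close> unfolding dyadic_def by (simp add: div_less_iff_less_mult)
qed

lemma same_quotient_gap:
  fixes a b N m :: nat
  assumes "a * N div m = b * N div m" "0 < m"
  shows "(a - b) * N < m"
proof -
  define t where "t = b * N div m * m"
  have "a * N = t + a * N mod m" "b * N = t + b * N mod m"
    unfolding t_def using assms(1) div_mult_mod_eq[of "a * N" m] div_mult_mod_eq[of "b * N" m] by simp_all
  moreover have "a * N mod m < m" using assms(2) by simp
  ultimately have "a * N - b * N < m" using assms(2) by linarith
  then show ?thesis by (simp add: diff_mult_distrib)
qed

lemma dyadic_gap: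
  assumes "p \<in> {1..n}" "q \<in> {1..n}" "dyadic n l p = dyadic n l q"
  shows "gap p q * 2 ^ l \<le> n"
proof -
  have "0 < n" using assms by auto
  then have "((p - 1) - (q - 1)) * 2 ^ l < n" "((q - 1) - (p - 1)) * 2 ^ l < n"
    using assms(3) same_quotient_gap[of "p - 1" "2 ^ l" n "q - 1"] same_quotient_gap[of "q - 1" "2 ^ l" n "p - 1"]
    unfolding dyadic_def by simp_all
  moreover have "gap p q = (p - 1) - (q - 1) \<or> gap p q = (q - 1) - (p - 1)"
    using assms(1,2) by (auto simp: gap_def)
  ultimately show ?thesis by (metis less_imp_le)
qed

text \<open>Values with the same quotient differ by at most \<open>m div N\<close>, so they lie in
  an interval that starts at the least of them. Positions of \<open>\<beta>\<close> use it with the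
  identity for \<open>g\<close>, values with \<open>app \<beta>\<close>.\<close>

lemma card_quotient_class:
  assumes g: "inj_on g {1..m}" "g ` {1..m} \<subseteq> {1..m}" and "0 < m" "0 < N"
  shows "card {x \<in> {1..m}. (g x - 1) * N div m = c} \<le> m div N + 1"
proof (cases "{x \<in> {1..m}. (g x - 1) * N div m = c} = {}")
  case False
  let ?X = "{x \<in> {1..m}. (g x - 1) * N div m = c}"
  have "inj_on g ?X" using g(1) by (rule inj_on_subset) auto
  define a where "a = Min (g ` ?X)"
  have fin: "finite (g ` ?X)" by simp
  have "a \<in> g ` ?X" unfolding a_def using False by (intro Min_in) auto
  then obtain x0 where x0: "x0 \<in> ?X" "a = g x0" by blast
  have "g ` ?X \<subseteq> {a..a + m div N}"
  proof (rule image_subsetI)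
    fix x assume x: "x \<in> ?X"
    then have "a \<le> g x" unfolding a_def using fin by (intro Min_le) auto
    have q: "(g x - 1) * N div m = (g x0 - 1) * N div m" using x x0(1) by simp
    have "((g x - 1) - (g x0 - 1)) * N < m" by (rule same_quotient_gap[OF q assms(3)])
    then have "((g x - 1) - (g x0 - 1)) * N div N \<le> m div N" by (intro div_le_mono) simp
    then have "(g x - 1) - (g x0 - 1) \<le> m div N" using assms(4) by simp
    moreover have "1 \<le> g x0"
    proof -
      have "x0 \<in> {1..m}" using x0(1) by simp
      then have "g x0 \<in> {1..m}" using g(2) by blast
      then show ?thesis by simp
    qed
    ultimately show "g x \<in> {a..a + m div N}" using \<open>a \<le> g x\<close> x0(2) by simp
  qed
  then have "card (g ` ?X) \<le> card {a..a + m div N}" by (intro card_mono) auto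
  then show ?thesis using card_image[OF \<open>inj_on g ?X\<close>] by simp
next
  case True
  show ?thesis unfolding True by simp
qed

text \<open>The deterministic core, which asks for no closeness between sample and
  \<open>\<pi>\<close>. \<open>D p\<close> is the distance, summed over both coordinates, from
  \<open>p\<close> to the nearest box representative. A heavy cell around \<open>p\<close> contains
  a host and therefore a representative, so each coordinate differs by at most the side of the
  cell.\<close>

lemma sample_approximation:
  assumes P: "hereditary P" "P \<subseteq> perms" and n: "1 \<le> n" and \<pi>: "\<pi> permutes {1..n}"
    and \<beta>: "\<beta> \<in> P" "len \<beta> = m" and f: "strict_mono_on {1..m} f" "f ` {1..m} \<subseteq> {1..n}"
    and ord: "\<And>x y. x \<in> {1..m} \<Longrightarrow> y \<in> {1..m} \<Longrightarrow> app \<beta> x < app \<beta> y \<longleftrightarrow> \<pi> (f x) < \<pi> (f y)"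
    and M: "1 \<le> M" and k: "kstar P M = enat k"
    and size: "\<And>c. m \<le> M * c \<Longrightarrow> 2 * M * (m div (4 * M\<^sup>2) + 1) + k * (4 * M\<^sup>2)\<^sup>2 \<le> c"
  shows "\<exists>\<rho> d D. (n, \<rho>) \<in> P \<and> (planar_simple_transposition n ^^ d) \<pi> \<rho> \<and> d \<le> 2 * (\<Sum>p\<in>{1..n}. D p) \<and>
    (\<forall>p\<in>{1..n}. \<forall>l\<le>L. m \<le> M * card {x \<in> {1..m}. cell n \<pi> l (f x) = cell n \<pi> l p} \<longrightarrow> D p * 2 ^ l \<le> 2 * n)"
proof -
  define Q where "Q l p = {x \<in> {1..m}. cell n \<pi> l (f x) = cell n \<pi> l p}" for l p
  define F where "F = {Q l p | l p. p \<in> {1..n} \<and> l \<le> L \<and> m \<le> M * card (Q l p)}"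
  have \<beta>p: "\<beta> \<in> perms" using \<beta> P by blast
  then have m: "0 < m" using \<beta>(2) by (auto simp: perms_def)
  have k1: "1 \<le> k" using kstar_pos[OF k] .
  have \<pi>_in: "\<pi> p \<in> {1..n}" if "p \<in> {1..n}" for p using permutes_in_image[OF \<pi>] that by blast
  have f_in: "f x \<in> {1..n}" if "x \<in> {1..m}" for x using f(2) that by blast
  \<comment> \<open>At scale \<open>0\<close> there is one cell, which holds the whole sample and is
    heavy; so the family is not empty.\<close>
  have "cell n \<pi> 0 p = (0, 0)" if "p \<in> {1..n}" for p
    using dyadic_less[OF that, of 0] dyadic_less[OF \<pi>_in[OF that], of 0] by (simp add: cell_def)
  then have "Q 0 1 = {1..m}" unfolding Q_def using n f_in by auto
  then have "Q 0 1 \<in> F" unfolding F_def using n M by force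
  then have ne: "F \<noteq> {}" by blast
  have QQ: "Q l p \<subseteq> Q l' p' \<or> Q l p \<inter> Q l' p' = {}" if "l' \<le> l" for l l' p p'
  proof (cases "\<exists>x. x \<in> Q l p \<and> x \<in> Q l' p'")
    case True
    then obtain x where x: "cell n \<pi> l (f x) = cell n \<pi> l p" "cell n \<pi> l' (f x) = cell n \<pi> l' p'"
      unfolding Q_def by blast
    have "y \<in> Q l' p'" if "y \<in> Q l p" for y
    proof -
      have "cell n \<pi> l (f y) = cell n \<pi> l (f x)" using that x(1) unfolding Q_def by simp
      then have "cell n \<pi> l' (f y) = cell n \<pi> l' p'" using cell_coarsen[OF \<open>l' \<le> l\<close>] x(2) by metis
      then show ?thesis using that unfolding Q_def by simp
    qed
    then show ?thesis by blast
  next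
    case False
    then show ?thesis by blast
  qed
  have lam: "A \<subseteq> B \<or> B \<subseteq> A \<or> A \<inter> B = {}" if AB: "A \<in> F" "B \<in> F" for A B
  proof -
    obtain l p where A: "A = Q l p" using AB(1) unfolding F_def by blast
    obtain l' p' where B: "B = Q l' p'" using AB(2) unfolding F_def by blast
    show ?thesis
    proof (cases "l' \<le> l")
      case True
      then show ?thesis using QQ[of l' l p p'] unfolding A B by blast
    next
      case False
      then show ?thesis using QQ[of l l' p' p] unfolding A B by auto
    qed
  qed
  obtain H where H: "\<And>j. j \<in> {1..M} \<Longrightarrow> H j \<in> F" "\<And>A. A \<in> F \<Longrightarrow> \<exists>j\<in>{1..M}. H j \<subseteq> A"
  proof (rule laminar_hosts[of "{1..m}" m F M])
    show "A \<subseteq> {1..m}" if "A \<in> F" for A using that unfolding F_def Q_def by blast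
    show "m \<le> M * card A" if "A \<in> F" for A using that unfolding F_def by blast
    show "A \<subseteq> B \<or> B \<subseteq> A \<or> A \<inter> B = {}" if "A \<in> F" "B \<in> F" for A B using lam that by blast
  qed (use ne m in auto)
  \<comment> \<open>With this \<open>N\<close>, the \<open>2 * M\<close> strips that may be in use
    cover about \<open>m / (2 * M)\<close> points, half of the least possible size of a
    host.\<close>
  define N where "N = 4 * M\<^sup>2"
  have N: "0 < N" using M by (simp add: N_def)
  define col where "col x = (x - 1) * N div m" for x
  define row where "row x = (app \<beta> x - 1) * N div m" for x
  have \<beta>_in: "app \<beta> x \<in> {1..m}" if "x \<in> {1..m}" for x
    using perms_in[OF \<beta>p] that \<beta>(2) by simp
  have lessN: "(y - 1) * N div m < N" if "y \<in> {1..m}" for y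
  proof -
    have "y - 1 < m" using that by auto
    then have "(y - 1) * N < N * m" using N by (simp add: mult.commute)
    then show ?thesis using m by (simp add: div_less_iff_less_mult)
  qed
  have "\<exists>c r. inj_on c {1..M} \<and> inj_on r {1..M} \<and>
           (\<forall>j\<in>{1..M}. k \<le> card {x \<in> H j. col x = c j \<and> row x = r j})"
  proof (rule greedy_boxes[of "{1..m}" N k col row "m div N + 1"])
    show "col x < N" "row x < N" if "x \<in> {1..m}" for x
      using lessN that \<beta>_in unfolding col_def row_def by blast+
    show "card {x \<in> {1..m}. col x = c} \<le> m div N + 1" for c
      using card_quotient_class[of "\<lambda>x. x" m N c] m N unfolding col_def by simp
    show "card {x \<in> {1..m}. row x = c} \<le> m div N + 1" for c
      unfolding row_def
    proof (rule card_quotient_class[OF _ _ m N])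
      show "inj_on (app \<beta>) {1..m}" using app_inj[OF \<beta>p] by (rule inj_onI[OF iffD1])
      show "app \<beta> ` {1..m} \<subseteq> {1..m}" using \<beta>_in by blast
    qed
    fix j assume j: "j \<in> {1..M}"
    show "H j \<subseteq> {1..m}" using H(1)[OF j] unfolding F_def Q_def by blast
    have "m \<le> M * card (H j)" using H(1)[OF j] unfolding F_def by fastforce
    then show "2 * M * (m div N + 1) + k * N\<^sup>2 \<le> card (H j)" unfolding N_def by (rule size)
  qed (use N k1 in auto)
  then obtain c r where c: "inj_on c {1..M}" and r: "inj_on r {1..M}"
    and box: "\<forall>j\<in>{1..M}. k \<le> card {x \<in> H j. col x = c j \<and> row x = r j}" by blast
  \<comment> \<open>Renumbering from left to right: \<open>s\<close> gives the rank of a box by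
    column, and \<open>t\<close> inverts it. Below, \<open>\<alpha>\<close> records the order of the
    rows along this numbering.\<close>
  obtain s where s: "s permutes {1..M}" "\<forall>i\<in>{1..M}. \<forall>j\<in>{1..M}. s i < s j \<longleftrightarrow> c i < c j"
    using c by (rule standardization)
  define t where "t = inv s"
  have t: "t permutes {1..M}" unfolding t_def using s(1) by (rule permutes_inv)
  have t_in: "t j \<in> {1..M}" if "j \<in> {1..M}" for j using permutes_in_image[OF t] that by blast
  have s_in: "s j \<in> {1..M}" if "j \<in> {1..M}" for j using permutes_in_image[OF s(1)] that by blast
  have st: "s (t j) = j" "t (s j) = j" for j
    unfolding t_def using permutes_inverses[OF s(1)] by auto
  have "inj_on (\<lambda>j. r (t j)) {1..M}"
    using inj_onD[OF r] t_in permutes_inj[OF t] by (intro inj_onI) (metis injD)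
  then obtain \<alpha> where \<alpha>: "\<alpha> permutes {1..M}"
    "\<forall>i\<in>{1..M}. \<forall>j\<in>{1..M}. \<alpha> i < \<alpha> j \<longleftrightarrow> r (t i) < r (t j)"
    by (rule standardization)
  define B where "B j = {x \<in> H (t j). col x = c (t j) \<and> row x = r (t j)}" for j
  have B_sub: "B j \<subseteq> H (t j)" for j unfolding B_def by blast
  have H_sub: "H j \<subseteq> {1..m}" if "j \<in> {1..M}" for j using H(1)[OF that] unfolding F_def Q_def by blast
  have B_in: "B j \<subseteq> {1..m}" if "j \<in> {1..M}" for j using B_sub H_sub[OF t_in[OF that]] by blast
  have B_card: "k \<le> card (B j)" if "j \<in> {1..M}" for j using box t_in[OF that] unfolding B_def by blast
  have pos: "x < y" if "i \<in> {1..M}" "j \<in> {1..M}" "i < j" "x \<in> B i" "y \<in> B j" for i j x y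
  proof (rule ccontr)
    assume "\<not> x < y"
    then have "col y \<le> col x" unfolding col_def by (intro div_le_mono mult_le_mono1) simp
    moreover have "c (t i) < c (t j)" using s(2) t_in that st by metis
    ultimately show False using that(4,5) unfolding B_def by simp
  qed
  have val': "app \<beta> x < app \<beta> y" if "r (t i) < r (t j)" "x \<in> B i" "y \<in> B j" for i j x y
  proof (rule ccontr)
    assume "\<not> app \<beta> x < app \<beta> y"
    then have "row y \<le> row x" unfolding row_def by (intro div_le_mono mult_le_mono1) simp
    then show False using that unfolding B_def by simp
  qed
  have val: "app \<beta> x < app \<beta> y \<longleftrightarrow> \<alpha> i < \<alpha> j"
    if ij: "i \<in> {1..M}" "j \<in> {1..M}" "i \<noteq> j" and xy: "x \<in> B i" "y \<in> B j" for i j x y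
  proof -
    have "t i \<noteq> t j" using ij(3) permutes_inj[OF t] by (metis injD)
    then have "r (t i) \<noteq> r (t j)" using inj_onD[OF r] t_in ij by blast
    then consider "r (t i) < r (t j)" | "r (t j) < r (t i)" by linarith
    then show ?thesis using val'[of i j x y] val'[of j i y x] \<alpha>(2) ij xy by cases auto
  qed
  have \<alpha>p: "(M, \<alpha>) \<in> perms" using M \<alpha>(1) by (simp add: perms_def)
  \<comment> \<open>The block size jumps from at most \<open>k\<close>, which the sample provides,
    to \<open>n\<close>, which places all of \<open>\<pi>\<close>.\<close>
  have "\<exists>\<alpha>'\<in>P. k_blow_up n (M, \<alpha>) \<alpha>'"
  proof (rule kstar_blow_up[OF P(2) \<alpha>p _ k _ n])
    fix k0 assume k0: "1 \<le> k0" "k0 \<le> k"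
    show "\<exists>\<alpha>'\<in>P. k_blow_up k0 (M, \<alpha>) \<alpha>'"
    proof (rule blow_up_from_boxes[OF P(1) \<beta>(1) \<beta>p M k0(1), of B])
      show "k0 \<le> card (B j)" if "j \<in> {1..M}" for j using B_card[OF that] k0(2) by simp
      show "B j \<subseteq> {1..len \<beta>}" if "j \<in> {1..M}" for j using B_in[OF that] \<beta>(2) by simp
    qed (use pos val in blast)+
  qed simp
  then obtain \<alpha>' where \<alpha>': "\<alpha>' \<in> P" "k_blow_up n (M, \<alpha>) \<alpha>'" by blast
  have "\<forall>j\<in>{1..M}. \<exists>x. x \<in> B j"
  proof
    fix j assume "j \<in> {1..M}"
    then have "card (B j) \<noteq> 0" using B_card[of j] k1 by linarith
    then show "\<exists>x. x \<in> B j" by (metis card.empty ex_in_conv)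
  qed
  from bchoice[OF this] obtain rep where rep: "\<forall>j\<in>{1..M}. rep j \<in> B j" by (rule exE)
  define D' where "D' p j = gap p (f (rep j)) + gap (\<pi> p) (\<pi> (f (rep j)))" for p j
  have "\<exists>j. j \<in> {1..M} \<and> (\<forall>i. i \<in> {1..M} \<longrightarrow> D' p j \<le> D' p i)" for p
    by (rule ex_has_least_nat[of _ 1]) (use M in simp)
  then have "\<forall>p. \<exists>j. j \<in> {1..M} \<and> (\<forall>i\<in>{1..M}. D' p j \<le> D' p i)" by blast
  from choice[OF this] obtain \<phi> where
    \<phi>: "\<forall>p. \<phi> p \<in> {1..M} \<and> (\<forall>i\<in>{1..M}. D' p (\<phi> p) \<le> D' p i)" by (rule exE)
  define D where "D p = D' p (\<phi> p)" for p
  have \<phi>_in: "\<phi> p \<in> {1..M}" for p using \<phi> by blast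
  have rep_in: "rep j \<in> {1..m}" if "j \<in> {1..M}" for j using rep B_in that by blast
  let ?I1 = "{(p, q). p \<in> {1..n} \<and> q \<in> {1..n} \<and> p < q \<and> \<phi> q < \<phi> p}"
  let ?I2 = "{(p, q). p \<in> {1..n} \<and> q \<in> {1..n} \<and> \<pi> p < \<pi> q \<and> (\<phi> p = \<phi> q \<or> \<alpha> (\<phi> q) < \<alpha> (\<phi> p))}"
  obtain \<rho> d where \<rho>: "(n, \<rho>) \<in> P" "(planar_simple_transposition n ^^ d) \<pi> \<rho>"
    and d: "d \<le> card ?I1 + card ?I2"
    using blow_up_approximation[OF P n \<alpha>' \<pi>, of \<phi>] \<phi>_in by blast
  have fin_pairs: "finite {(p, q). p \<in> {1..n} \<and> q \<in> {1..n} \<and> R p q}" for R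
    by (rule finite_subset[of _ "{1..n} \<times> {1..n}"]) auto
  define X where "X p = f (rep (\<phi> p))" for p
  have "card ?I1 \<le> card {(p, q). p \<in> {1..n} \<and> q \<in> {1..n} \<and> p < q \<and> X q \<le> X p}"
  proof (rule card_mono[OF fin_pairs], clarify)
    fix p q assume "p \<in> {1..n}" "q \<in> {1..n}" "\<phi> q < \<phi> p"
    then have "rep (\<phi> q) < rep (\<phi> p)" using pos \<phi>_in rep by blast
    then have "X q < X p" unfolding X_def using strict_mono_onD[OF f(1)] rep_in \<phi>_in by blast
    then show "X q \<le> X p" by simp
  qed
  also have "\<dots> \<le> 2 * (\<Sum>p\<in>{1..n}. (X p - p) + (p - X p))"
    by (rule card_inverted_pairs_le) auto
  finally have 1: "card ?I1 \<le> 2 * (\<Sum>p\<in>{1..n}. gap p (X p))"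
    by (simp add: gap_def add.commute)
  \<comment> \<open>Points sent to the same box share a representative; this is why inverted pairs
    are counted with a weak inequality.\<close>
  have "card ?I2 \<le> card {(p, q). p \<in> {1..n} \<and> q \<in> {1..n} \<and> \<pi> p < \<pi> q \<and> \<pi> (X q) \<le> \<pi> (X p)}"
  proof (rule card_mono[OF fin_pairs], clarify)
    fix p q assume pq: "p \<in> {1..n}" "q \<in> {1..n}" "\<phi> p = \<phi> q \<or> \<alpha> (\<phi> q) < \<alpha> (\<phi> p)"
    show "\<pi> (X q) \<le> \<pi> (X p)"
    proof (cases "\<phi> p = \<phi> q")
      case False
      then have "app \<beta> (rep (\<phi> q)) < app \<beta> (rep (\<phi> p))"
        using pq(3) val[OF \<phi>_in[of q] \<phi>_in[of p], of "rep (\<phi> q)" "rep (\<phi> p)"] rep \<phi>_in by auto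
      then have "\<pi> (X q) < \<pi> (X p)" unfolding X_def using ord rep_in \<phi>_in by blast
      then show ?thesis by simp
    qed (simp add: X_def)
  qed
  also have "\<dots> \<le> 2 * (\<Sum>p\<in>{1..n}. (\<pi> (X p) - \<pi> p) + (\<pi> p - \<pi> (X p)))"
    using permutes_inj_on[OF \<pi>] by (intro card_inverted_pairs_le) auto
  finally have 2: "card ?I2 \<le> 2 * (\<Sum>p\<in>{1..n}. gap (\<pi> p) (\<pi> (X p)))"
    by (simp add: gap_def add.commute)
  have "(\<Sum>p\<in>{1..n}. D p) = (\<Sum>p\<in>{1..n}. gap p (X p)) + (\<Sum>p\<in>{1..n}. gap (\<pi> p) (\<pi> (X p)))"
    by (simp add: D_def D'_def X_def sum.distrib)
  then have "d \<le> 2 * (\<Sum>p\<in>{1..n}. D p)" using d 1 2 by linarith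
  moreover have "D p * 2 ^ l \<le> 2 * n"
    if p: "p \<in> {1..n}" and l: "l \<le> L" and heavy: "m \<le> M * card {x \<in> {1..m}. cell n \<pi> l (f x) = cell n \<pi> l p}" for p l
  proof -
    have "Q l p \<in> F" using p l heavy unfolding F_def Q_def by blast
    then obtain j where j: "j \<in> {1..M}" "H j \<subseteq> Q l p" using H(2) by blast
    \<comment> \<open>The box chosen in host \<open>H j\<close> has number \<open>s j\<close>, since
      \<open>t (s j) = j\<close>.\<close>
    have "rep (s j) \<in> B (s j)" using rep s_in[OF j(1)] by blast
    then have "rep (s j) \<in> Q l p" using B_sub[of "s j"] j(2) unfolding st by blast
    then have x: "rep (s j) \<in> {1..m}" and eq: "cell n \<pi> l (f (rep (s j))) = cell n \<pi> l p"
      unfolding Q_def by auto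
    let ?q = "f (rep (s j))"
    have q: "?q \<in> {1..n}" using f_in x by blast
    have eqs: "dyadic n l p = dyadic n l ?q" "dyadic n l (\<pi> p) = dyadic n l (\<pi> ?q)"
      using eq by (auto simp: cell_def)
    have "gap p ?q * 2 ^ l \<le> n" using p q eqs(1) by (rule dyadic_gap)
    moreover have "gap (\<pi> p) (\<pi> ?q) * 2 ^ l \<le> n"
      using \<pi>_in[OF p] \<pi>_in[OF q] eqs(2) by (rule dyadic_gap)
    ultimately have "D' p (s j) * 2 ^ l \<le> 2 * n" by (simp add: D'_def algebra_simps)
    moreover have "D p \<le> D' p (s j)" using \<phi> s_in[OF j(1)] unfolding D_def by blast
    ultimately show ?thesis by (meson le_trans mult_le_mono1)
  qed
  ultimately show ?thesis using \<rho> by blast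
qed

section \<open>Mass of the light cells\<close>

lemma card_eq_sum_fibres:
  assumes "finite A" "finite Z" "g ` A \<subseteq> Z"
  shows "card A = (\<Sum>z\<in>Z. card {x \<in> A. g x = z})"
  using sum.group[OF assms, of "\<lambda>_. 1 :: nat"] by simp

text \<open>Here \<open>g\<close> is the finest cell and \<open>h\<close> passes to a coarser scale.
  Each occupied light cell has fewer than \<open>m / M\<close> sample points, which bounds the share
  of light cells in the sample. That share is compared with the one in \<open>\<pi>\<close> cell by
  cell at the finest scale, so the error term does not depend on \<open>h\<close>.\<close>

lemma light_cells_bound:
  fixes g :: "nat \<Rightarrow> 'b" and h :: "'b \<Rightarrow> 'c" and f :: "nat \<Rightarrow> nat"
  assumes n: "0 < n" and m: "0 < m" and M: "0 < M" and f: "f ` {1..m} \<subseteq> {1..n}"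
    and Z: "finite Z" "g ` {1..n} \<subseteq> Z"
  defines "light \<equiv> {p \<in> {1..n}. M * card {x \<in> {1..m}. h (g (f x)) = h (g p)} < m}"
  shows "real (card light) \<le> n * (card ((\<lambda>x. h (g (f x))) ` {1..m}) / M +
     (\<Sum>z\<in>Z. \<bar>card {p \<in> {1..n}. g p = z} / n - card {x \<in> {1..m}. g (f x) = z} / m\<bar>))"
proof -
  \<comment> \<open>The finest cells that lie in light coarser cells.\<close>
  define W where "W = {z \<in> Z. M * card {x \<in> {1..m}. h (g (f x)) = h z} < m}"
  have finW: "finite W" "W \<subseteq> Z" using Z(1) by (auto simp: W_def)
  let ?n = "\<lambda>z. card {p \<in> {1..n}. g p = z}" and ?s = "\<lambda>z. card {x \<in> {1..m}. g (f x) = z}"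
  let ?S = "{x \<in> {1..m}. f x \<in> light}"
  have gin: "g p \<in> Z" if "p \<in> {1..n}" for p using Z(2) that by blast
  have lW: "p \<in> light \<longleftrightarrow> g p \<in> W" if "p \<in> {1..n}" for p
    using that gin[OF that] by (simp add: light_def W_def)
  have fin: "f x \<in> {1..n}" if "x \<in> {1..m}" for x using f that by blast
  have "card light = (\<Sum>z\<in>W. card {p \<in> light. g p = z})"
    by (rule card_eq_sum_fibres) (use finW lW in \<open>auto simp: light_def\<close>)
  also have "\<dots> = (\<Sum>z\<in>W. ?n z)"
  proof (rule sum.cong[OF refl])
    fix z assume "z \<in> W"
    then have "{p \<in> light. g p = z} = {p \<in> {1..n}. g p = z}"
      using lW by (auto simp: light_def W_def)
    then show "card {p \<in> light. g p = z} = ?n z" by simp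
  qed
  finally have cl: "card light = (\<Sum>z\<in>W. ?n z)" .
  have "card ?S = (\<Sum>z\<in>W. card {x \<in> ?S. g (f x) = z})"
  proof (rule card_eq_sum_fibres[OF _ finW(1)])
    show "(\<lambda>x. g (f x)) ` ?S \<subseteq> W" using lW fin by blast
  qed simp
  also have "\<dots> = (\<Sum>z\<in>W. ?s z)"
  proof (rule sum.cong[OF refl])
    fix z assume "z \<in> W"
    then have "{x \<in> ?S. g (f x) = z} = {x \<in> {1..m}. g (f x) = z}"
      using lW fin by blast
    then show "card {x \<in> ?S. g (f x) = z} = ?s z" by simp
  qed
  finally have cS: "card ?S = (\<Sum>z\<in>W. ?s z)" .
  let ?V = "(\<lambda>x. h (g (f x))) ` {1..m}"
  have "card ?S = (\<Sum>v\<in>?V. card {x \<in> ?S. h (g (f x)) = v})"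
    by (rule card_eq_sum_fibres) auto
  then have "M * card ?S = (\<Sum>v\<in>?V. M * card {x \<in> ?S. h (g (f x)) = v})"
    by (simp add: sum_distrib_left)
  also have "\<dots> \<le> (\<Sum>v\<in>?V. m)"
  proof (rule sum_mono)
    fix v
    show "M * card {x \<in> ?S. h (g (f x)) = v} \<le> m"
    proof (cases "{x \<in> ?S. h (g (f x)) = v} = {}")
      case True
      show ?thesis unfolding True by simp
    next
      case False
      then obtain x where x: "x \<in> {1..m}" "f x \<in> light" "h (g (f x)) = v" by blast
      have "card {x \<in> ?S. h (g (f x)) = v} \<le> card {x' \<in> {1..m}. h (g (f x')) = h (g (f x))}"
        using x(3) by (intro card_mono) auto
      then have "M * card {x \<in> ?S. h (g (f x)) = v} \<le> M * card {x' \<in> {1..m}. h (g (f x')) = h (g (f x))}"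
        by simp
      also have "\<dots> < m" using x(2) by (simp add: light_def)
      finally show ?thesis by simp
    qed
  qed
  finally have "M * card ?S \<le> card ?V * m" by simp
  then have "real (M * card ?S) \<le> real (card ?V * m)" by (simp only: of_nat_le_iff)
  then have S: "card ?S / m \<le> card ?V / M"
    using m M by (simp add: field_simps)
  have "card light / n = (\<Sum>z\<in>W. ?n z / n)" by (simp add: cl sum_divide_distrib)
  also have "\<dots> \<le> (\<Sum>z\<in>W. ?s z / m + \<bar>?n z / n - ?s z / m\<bar>)" by (intro sum_mono) linarith
  also have "\<dots> = card ?S / m + (\<Sum>z\<in>W. \<bar>?n z / n - ?s z / m\<bar>)"
    by (simp only: cS sum.distrib sum_divide_distrib of_nat_sum)
  also have "\<dots> \<le> card ?V / M + (\<Sum>z\<in>Z. \<bar>?n z / n - ?s z / m\<bar>)"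
    using finW Z(1) by (intro add_mono S sum_mono2) auto
  finally show ?thesis using n by (simp add: divide_simps mult.commute)
qed

text \<open>If \<open>l\<close> is the first bad scale of \<open>p\<close>, then scale
  \<open>l - 1\<close> is good and gives \<open>D p \<le> 4 * n / 2 ^ l\<close>. Charging this to
  scale \<open>l\<close> and summing over all bad scales avoids any assumption that the bad sets are
  nested. Emptiness of \<open>bad 0\<close> guarantees that \<open>l - 1\<close> exists.\<close>

lemma multiscale_sum_bound:
  fixes D :: "nat \<Rightarrow> nat" and bad :: "nat \<Rightarrow> nat set"
  assumes D: "\<And>p l. p \<in> {1..n} \<Longrightarrow> l \<le> L \<Longrightarrow> p \<notin> bad l \<Longrightarrow> D p * 2 ^ l \<le> 2 * n"
    and bad: "bad 0 = {}" "\<And>l. bad l \<subseteq> {1..n}"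
    and b: "\<And>l. l \<in> {1..L} \<Longrightarrow> real (card (bad l)) \<le> n * b l"
  shows "real (\<Sum>p\<in>{1..n}. D p) \<le> 2 * (real n)\<^sup>2 * (1 / 2 ^ L + 2 * (\<Sum>l\<in>{1..L}. b l / 2 ^ l))"
proof -
  define t where "t p = (\<Sum>l\<in>{1..L}. of_bool (p \<in> bad l) * (2 / 2 ^ l :: real))" for p
  have "real (D p) \<le> 2 * n * (1 / 2 ^ L + t p)" if p: "p \<in> {1..n}" for p
  proof (cases "p \<in> bad L")
    case False
    then have "D p * 2 ^ L \<le> 2 * n" using D[OF p] by blast
    then have "real (D p * 2 ^ L) \<le> real (2 * n)" by (simp only: of_nat_le_iff)
    then have "real (D p) \<le> 2 * n * (1 / 2 ^ L)" by (simp add: field_simps)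
    moreover have "0 \<le> t p" unfolding t_def by (intro sum_nonneg) auto
    then have "2 * n * (1 / 2 ^ L) \<le> 2 * n * (1 / 2 ^ L + t p)" by (intro mult_left_mono) auto
    ultimately show ?thesis by linarith
  next
    case True
    define l where "l = (LEAST l. p \<in> bad l)"
    have l: "p \<in> bad l" "l \<le> L" unfolding l_def using True by (auto intro: LeastI Least_le)
    then have "l \<noteq> 0" using bad(1) by (metis empty_iff)
    then obtain l' where l': "l = Suc l'" by (cases l) auto
    then have "p \<notin> bad l'" using not_less_Least[of l' "\<lambda>l. p \<in> bad l"] unfolding l_def by auto
    then have "D p * 2 ^ l' \<le> 2 * n" using D[OF p, of l'] l l' by simp
    then have "real (D p * 2 ^ l') \<le> real (2 * n)" by (simp only: of_nat_le_iff)
    then have "real (D p) \<le> 2 * n * (2 / 2 ^ l)" by (simp add: field_simps l')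
    moreover have "of_bool (p \<in> bad l) * (2 / 2 ^ l) \<le> t p"
      unfolding t_def using l l' by (intro member_le_sum) auto
    then have "2 / 2 ^ l \<le> 1 / 2 ^ L + t p" using l(1) by (simp add: add_increasing)
    then have "2 * n * (2 / 2 ^ l) \<le> 2 * n * (1 / 2 ^ L + t p)" by (intro mult_left_mono) auto
    ultimately show ?thesis by linarith
  qed
  then have "real (\<Sum>p\<in>{1..n}. D p) \<le> (\<Sum>p\<in>{1..n}. 2 * n * (1 / 2 ^ L + t p))"
    unfolding of_nat_sum by (rule sum_mono)
  also have "\<dots> = 2 * n * (n / 2 ^ L + (\<Sum>p\<in>{1..n}. \<Sum>l\<in>{1..L}. of_bool (p \<in> bad l) * (2 / 2 ^ l)))"
    by (simp add: t_def sum.distrib sum_distrib_left[symmetric])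
  also have "(\<Sum>p\<in>{1..n}. \<Sum>l\<in>{1..L}. of_bool (p \<in> bad l) * (2 / 2 ^ l :: real)) =
      (\<Sum>l\<in>{1..L}. \<Sum>p\<in>{1..n}. of_bool (p \<in> bad l) * (2 / 2 ^ l))" by (rule sum.swap)
  also have "\<dots> \<le> (\<Sum>l\<in>{1..L}. n * (2 * (b l / 2 ^ l)))"
  proof (rule sum_mono)
    fix l assume l: "l \<in> {1..L}"
    have "(\<Sum>p\<in>{1..n}. of_bool (p \<in> bad l) * (2 / 2 ^ l :: real)) = card (bad l) * (2 / 2 ^ l)"
    proof -
      have "(\<Sum>p\<in>{1..n}. of_bool (p \<in> bad l) * (2 / 2 ^ l :: real)) = (\<Sum>p\<in>bad l. 2 / 2 ^ l)"
        by (rule sum.mono_neutral_cong_right) (use bad(2) in auto)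
      then show ?thesis by simp
    qed
    also have "\<dots> \<le> n * b l * (2 / 2 ^ l)" using b[OF l] by (intro mult_right_mono) auto
    finally show "(\<Sum>p\<in>{1..n}. of_bool (p \<in> bad l) * (2 / 2 ^ l :: real)) \<le> n * (2 * (b l / 2 ^ l))"
      by (simp add: algebra_simps)
  qed
  also have "\<dots> = n * (2 * (\<Sum>l\<in>{1..L}. b l / 2 ^ l))" by (simp add: sum_distrib_left)
  finally have "real (\<Sum>p\<in>{1..n}. D p) \<le> 2 * n * (n / 2 ^ L + n * (2 * (\<Sum>l\<in>{1..L}. b l / 2 ^ l)))"
    by (simp add: mult_left_mono)
  also have "\<dots> = 2 * (real n)\<^sup>2 * (1 / 2 ^ L + 2 * (\<Sum>l\<in>{1..L}. b l / 2 ^ l))"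
    by (simp add: power2_eq_square algebra_simps)
  finally show ?thesis .
qed

lemma occupied_cells_le:
  assumes "\<pi> permutes {1..n}" "f ` {1..m} \<subseteq> {1..n}"
  shows "(\<lambda>x. cell n \<pi> l (f x)) ` {1..m} \<subseteq> {..<2 ^ l} \<times> {..<2 ^ l}"
    "card ((\<lambda>x. cell n \<pi> l (f x)) ` {1..m}) \<le> 4 ^ l"
proof -
  show sub: "(\<lambda>x. cell n \<pi> l (f x)) ` {1..m} \<subseteq> {..<2 ^ l} \<times> {..<2 ^ l}"
  proof (rule image_subsetI)
    fix x assume "x \<in> {1..m}"
    then have "f x \<in> {1..n}" using assms(2) by blast
    moreover then have "\<pi> (f x) \<in> {1..n}" using permutes_in_image[OF assms(1)] by blast
    ultimately show "cell n \<pi> l (f x) \<in> {..<2 ^ l} \<times> {..<2 ^ l}"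
      using dyadic_less by (simp add: cell_def)
  qed
  have "card ((\<lambda>x. cell n \<pi> l (f x)) ` {1..m}) \<le> card ({..<2 ^ l :: nat} \<times> {..<2 ^ l :: nat})"
    using sub by (rule card_mono[rotated]) simp
  then show "card ((\<lambda>x. cell n \<pi> l (f x)) ` {1..m}) \<le> 4 ^ l"
    by (simp add: power_mult_distrib[symmetric])
qed

lemma dyadic_mono: "p \<le> q \<Longrightarrow> dyadic n l p \<le> dyadic n l q"
  unfolding dyadic_def by (intro div_le_mono mult_le_mono1) simp

text \<open>Points in different strips are ordered like the strips. Sample points picked in the
  cells of an occurrence would thus form \<open>\<sigma>\<close> inside \<open>\<beta>\<close>, and
  heredity would put \<open>\<sigma>\<close> in \<open>P\<close>.\<close>

lemma occupied_cells_le_ex_ones: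
  assumes P: "hereditary P" and \<sigma>: "\<sigma> \<in> perms" "\<sigma> \<notin> P" and \<beta>: "\<beta> \<in> P" "len \<beta> = m"
    and \<pi>: "\<pi> permutes {1..n}" and f: "strict_mono_on {1..m} f" "f ` {1..m} \<subseteq> {1..n}"
    and ord: "\<And>x y. x \<in> {1..m} \<Longrightarrow> y \<in> {1..m} \<Longrightarrow> app \<beta> x < app \<beta> y \<longleftrightarrow> \<pi> (f x) < \<pi> (f y)"
  shows "card ((\<lambda>x. cell n \<pi> l (f x)) ` {1..m}) \<le> ex_ones (2 ^ l) \<sigma>"
proof (rule card_le_ex_ones[OF \<sigma>(1) occupied_cells_le(1)[OF \<pi> f(2)]])
  let ?I = "{1..len \<sigma>}"
  show "\<not> occurs \<sigma> ((\<lambda>x. cell n \<pi> l (f x)) ` {1..m})"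
  proof
    assume "occurs \<sigma> ((\<lambda>x. cell n \<pi> l (f x)) ` {1..m})"
    then obtain r c where r: "\<forall>i\<in>?I. \<forall>j\<in>?I. i < j \<longrightarrow> r i < r j"
      and c: "\<forall>i\<in>?I. \<forall>j\<in>?I. i < j \<longrightarrow> c i < c j"
      and occ: "\<forall>i\<in>?I. (r i, c (app \<sigma> i)) \<in> (\<lambda>x. cell n \<pi> l (f x)) ` {1..m}"
      by (rule occursE)
    have "\<forall>i\<in>?I. \<exists>x. x \<in> {1..m} \<and> cell n \<pi> l (f x) = (r i, c (app \<sigma> i))"
    proof
      fix i assume "i \<in> ?I"
      then have "(r i, c (app \<sigma> i)) \<in> (\<lambda>x. cell n \<pi> l (f x)) ` {1..m}" using occ by blast
      then obtain x where "(r i, c (app \<sigma> i)) = cell n \<pi> l (f x)" "x \<in> {1..m}" by (rule imageE)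
      then show "\<exists>x. x \<in> {1..m} \<and> cell n \<pi> l (f x) = (r i, c (app \<sigma> i))"
        by (intro exI[of _ x]) simp
    qed
    from bchoice[OF this] obtain g where
      g: "\<forall>i\<in>?I. g i \<in> {1..m} \<and> cell n \<pi> l (f (g i)) = (r i, c (app \<sigma> i))" by (rule exE)
    have less: "p < q" if "dyadic n l p < dyadic n l q" for p q
      using that dyadic_mono[of q p n l] by (meson leD not_le)
    have g_mono: "strict_mono_on ?I g"
    proof (rule strict_mono_onI')
      fix i j assume ij: "i \<in> ?I" "j \<in> ?I" "i < j"
      then have "r i < r j" using r by blast
      moreover have "dyadic n l (f (g i)) = r i" "dyadic n l (f (g j)) = r j"
        using g ij by (auto simp: cell_def)
      ultimately have "f (g i) < f (g j)" using less by metis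
      then show "g i < g j"
        using strict_mono_on_leD[OF f(1)] g ij by (meson leD not_le)
    qed
    have lt: "app \<beta> (g i) < app \<beta> (g j)" if ij: "i \<in> ?I" "j \<in> ?I" "app \<sigma> i < app \<sigma> j" for i j
    proof -
      have "c (app \<sigma> i) < c (app \<sigma> j)" using c perms_in[OF \<sigma>(1)] ij by blast
      moreover have "dyadic n l (\<pi> (f (g i))) = c (app \<sigma> i)" "dyadic n l (\<pi> (f (g j))) = c (app \<sigma> j)"
        using g ij by (auto simp: cell_def)
      ultimately have "\<pi> (f (g i)) < \<pi> (f (g j))" using less by metis
      then show ?thesis using ord g ij by blast
    qed
    have "app \<beta> (g i) < app \<beta> (g j) \<longleftrightarrow> app \<sigma> i < app \<sigma> j" if ij: "i \<in> ?I" "j \<in> ?I" for i j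
    proof (cases "i = j")
      case False
      then have "app \<sigma> i \<noteq> app \<sigma> j" using app_inj[OF \<sigma>(1)] by blast
      then show ?thesis using lt[of i j] lt[of j i] ij by (meson less_asym linorder_neqE_nat)
    qed simp
    then have "subpermutation \<sigma> \<beta>"
      unfolding subpermutation_def using g_mono g \<beta>(2) by (intro exI[of _ g]) auto
    then show False using P \<sigma> \<beta>(1) unfolding hereditary_def by blast
  qed
qed

section \<open>A sample in the property forces closeness\<close>

lemma sum_half_powers_le_one: "(\<Sum>l\<in>{1..L}. 1 / 2 ^ l :: real) \<le> 1"
proof -
  have "(\<Sum>l\<in>{1..L}. 1 / 2 ^ l :: real) = 1 - 1 / 2 ^ L" by (induction L) auto
  then show ?thesis by simp
qed

lemma sum_powers_two_le: "(\<Sum>l\<in>{1..L}. 2 ^ l :: real) \<le> 2 * 2 ^ L"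
proof -
  have "(\<Sum>l\<in>{1..L}. 2 ^ l :: real) = 2 * 2 ^ L - 2" by (induction L) auto
  then show ?thesis by simp
qed

text \<open>Multiplied by \<open>2 * M\<close>, the left side is at most
  \<open>m + 4 * M\<^sup>2 + 32 * M ^ 5 * k\<close>: here the term \<open>32 * M ^ 5 * k\<close> of
  the threshold originates. Since \<open>\<eta> < 1 / 2\<close>, the denominator contributes a
  factor \<open>8\<close>, which also absorbs \<open>4 * M\<^sup>2\<close>.\<close>

lemma box_count_bound:
  fixes m M k c :: nat and \<eta> :: real
  assumes \<eta>: "0 < \<eta>" "\<eta> < 1 / 2" and M: "1 \<le> M" and k: "1 \<le> k"
    and m: "32 * real M ^ 5 * real k / \<eta> ^ 3 \<le> m" and c: "m \<le> M * c"
  shows "2 * M * (m div (4 * M\<^sup>2) + 1) + k * (4 * M\<^sup>2)\<^sup>2 \<le> c"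
proof -
  have "\<eta> ^ 3 \<le> (1 / 2) ^ 3" using \<eta> by (intro power_mono) auto
  then have "32 * real M ^ 5 * real k * 8 \<le> 32 * real M ^ 5 * real k / \<eta> ^ 3"
    using \<eta> by (simp add: field_simps power3_eq_cube) (use M k in \<open>simp add: mult_left_le\<close>)
  then have "256 * real M ^ 5 * real k \<le> m" using m by linarith
  then have "real (256 * M ^ 5 * k) \<le> real m" by simp
  then have m': "256 * M ^ 5 * k \<le> m" by (simp only: of_nat_le_iff)
  have "M * (2 * M * (m div (4 * M\<^sup>2) + 1) + k * (4 * M\<^sup>2)\<^sup>2) * 2 = 4 * M\<^sup>2 * (m div (4 * M\<^sup>2)) + 4 * M\<^sup>2 + 32 * M ^ 5 * k"
    by (simp add: algebra_simps power2_eq_square numeral_eq_Suc)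
  also have "4 * M\<^sup>2 * (m div (4 * M\<^sup>2)) \<le> m" by (rule times_div_less_eq_dividend)
  also have "4 * M\<^sup>2 \<le> 4 * (M ^ 5 * k)"
  proof -
    have "M\<^sup>2 * 1 \<le> M ^ 5 * k" using M k by (intro mult_le_mono power_increasing) auto
    then show ?thesis by simp
  qed
  finally have "M * (2 * M * (m div (4 * M\<^sup>2) + 1) + k * (4 * M\<^sup>2)\<^sup>2) * 2 \<le> m + 36 * (M ^ 5 * k)"
    by linarith
  also have "\<dots> \<le> m + m" using m' by simp
  also have "\<dots> \<le> M * c * 2" using c by simp
  finally have "M * (2 * M * (m div (4 * M\<^sup>2) + 1) + k * (4 * M\<^sup>2)\<^sup>2) \<le> M * c" by simp
  then show ?thesis using M by simp
qed

lemma close_to_property: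
  fixes P :: "perm set" and \<eta> :: real
  assumes P: "hereditary P" "P \<subseteq> perms" and \<sigma>: "\<sigma> \<in> perms" "\<sigma> \<notin> P" "2 \<le> len \<sigma>"
    and \<eta>: "0 < \<eta>" "\<eta> < 1 / 2" and \<pi>: "\<pi> permutes {1..n}"
    and k: "kstar P M = enat k"
    and M: "2000 * (1000 * fh_const \<sigma>) / \<eta> * (log 2 (\<eta> / 2))\<^sup>2 \<le> M \<or> 20000 / \<eta>\<^sup>2 \<le> M"
    and m: "32 * real M ^ 5 * real k / \<eta> ^ 3 \<le> m"
    and \<beta>: "\<beta> \<in> P" "len \<beta> = m" and f: "strict_mono_on {1..m} f" "f ` {1..m} \<subseteq> {1..n}"
    and ord: "\<And>x y. x \<in> {1..m} \<Longrightarrow> y \<in> {1..m} \<Longrightarrow> app \<beta> x < app \<beta> y \<longleftrightarrow> \<pi> (f x) < \<pi> (f y)"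
    and L: "16 / \<eta> \<le> 2 ^ L" "2 ^ L < 32 / \<eta>"
    and disc: "(\<Sum>z\<in>{..<2 ^ L} \<times> {..<2 ^ L}. (real (card {p \<in> {1..n}. cell n \<pi> L p = z}) / n
        - real (card {x \<in> {1..m}. cell n \<pi> L (f x) = z}) / m)\<^sup>2) \<le> 3 / m"
  shows "dist_PT (n, \<pi>) P \<le> 2 * \<eta>"
proof -
  define c where "c = fh_const \<sigma>"
  have c: "1 \<le> c" unfolding c_def using \<sigma> by (intro fh_const_ge_one) auto
  define Y where "Y = - log 2 (\<eta> / 2)"
  have Y: "2 \<le> Y"
  proof -
    have "log 2 (\<eta> / 2) \<le> log 2 (2 powr (-2))" using \<eta> by (subst log_le_cancel_iff) (auto simp: powr_minus)
    then show ?thesis by (simp add: Y_def)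
  qed
  have M': "2000000 * c * Y\<^sup>2 / \<eta> \<le> M \<or> 20000 / \<eta>\<^sup>2 \<le> M"
    using M by (simp add: c_def Y_def)
  \<comment> \<open>Both choices of \<open>M\<close> are at least of order
    \<open>1 / \<eta>\<close>, so \<open>M ^ 5\<close> brings two further powers of
    \<open>1 / \<eta>\<close> and more into \<open>m\<close>.\<close>
  have Mbig: "40000 / \<eta> \<le> M"
    using M'
  proof
    assume a: "2000000 * c * Y\<^sup>2 / \<eta> \<le> M"
    have "1 * 2\<^sup>2 \<le> c * Y\<^sup>2" using c Y by (intro mult_mono power_mono) auto
    then have "40000 / \<eta> \<le> 2000000 * c * Y\<^sup>2 / \<eta>" using \<eta> by (intro divide_right_mono) auto
    then show ?thesis using a by linarith
  next
    assume a: "20000 / \<eta>\<^sup>2 \<le> M"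
    have "40000 / \<eta> \<le> 20000 / \<eta>\<^sup>2" using \<eta> by (simp add: field_simps power2_eq_square)
    then show ?thesis using a by linarith
  qed
  have M1: "1 \<le> M"
  proof -
    have "0 < 40000 / \<eta>" using \<eta> by simp
    then show ?thesis using Mbig by (cases M) auto
  qed
  have k1: "1 \<le> k" using kstar_pos[OF k] .
  \<comment> \<open>The numerator is \<open>3 * 32\<^sup>2 * 64\<^sup>2\<close>, exactly what the
    estimate of \<open>\<tau>\<close> consumes.\<close>
  have m_big: "12582912 / \<eta> ^ 4 \<le> m"
  proof -
    have "(40000 / \<eta>)\<^sup>2 \<le> (real M)\<^sup>2" using Mbig \<eta> by (intro power_mono) auto
    also have "\<dots> \<le> real M ^ 5" using M1 by (intro power_increasing) auto
    also have "\<dots> \<le> real M ^ 5 * real k" using k1 by (simp add: mult_le_cancel_left1)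
    finally have "32 * (40000 / \<eta>)\<^sup>2 / \<eta> ^ 3 \<le> 32 * real M ^ 5 * real k / \<eta> ^ 3"
      using \<eta> by (intro divide_right_mono) auto
    moreover have "12582912 / \<eta> ^ 4 \<le> 32 * (40000 / \<eta>)\<^sup>2 / \<eta> ^ 3"
    proof -
      have "12582912 / \<eta> ^ 4 \<le> (51200000000 / \<eta>) / \<eta> ^ 4"
        using \<eta> by (intro divide_right_mono) (auto simp: field_simps)
      also have "\<dots> = 32 * (40000 / \<eta>)\<^sup>2 / \<eta> ^ 3" using \<eta> by (simp add: field_simps numeral_eq_Suc)
      finally show ?thesis .
    qed
    ultimately show ?thesis using m by linarith
  qed
  have m_pos: "0 < m" using m_big \<eta> by (cases m) (auto simp: field_simps)
  have m2: "2 \<le> m"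
  proof -
    have "\<eta> ^ 4 \<le> 1" using \<eta> by (intro power_le_one) auto
    then have "12582912 \<le> 12582912 / \<eta> ^ 4" using \<eta> by (simp add: field_simps)
    then have "2 \<le> real m" using m_big by linarith
    then show ?thesis by simp
  qed
  have "card {1..m} \<le> card {1..n}"
    using f strict_mono_on_imp_inj_on by (intro card_inj_on_le[of f]) auto
  then have n2: "2 \<le> n" using m2 by simp
  define Z where "Z = {..<2 ^ L :: nat} \<times> {..<2 ^ L :: nat}"
  define \<delta> where "\<delta> z = real (card {p \<in> {1..n}. cell n \<pi> L p = z}) / n
        - real (card {x \<in> {1..m}. cell n \<pi> L (f x) = z}) / m" for z
  define \<tau> where "\<tau> = (\<Sum>z\<in>Z. \<bar>\<delta> z\<bar>)"
  have \<tau>: "\<tau> \<le> \<eta> / 64"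
  proof -
    \<comment> \<open>Cauchy-Schwarz over the \<open>4 ^ L\<close> finest cells turns the bound on
      squares into one on absolute values; the upper bound on \<open>2 ^ L\<close> limits the
      loss.\<close>
    have "\<tau>\<^sup>2 \<le> (\<Sum>z\<in>Z. \<bar>\<delta> z\<bar>\<^sup>2) * card Z"
      unfolding \<tau>_def by (rule sum_squared_le_sum_of_squares)
    also have "\<dots> \<le> 3 / m * (2 ^ L)\<^sup>2"
      using disc by (intro mult_mono) (auto simp: Z_def \<delta>_def power2_eq_square)
    also have "\<dots> \<le> 3 / m * (32 / \<eta>)\<^sup>2"
      using L(2) by (intro mult_left_mono power_mono) auto
    also have "\<dots> \<le> (\<eta> / 64)\<^sup>2"
    proof -
      have "12582912 \<le> m * \<eta> ^ 4" using m_big \<eta> by (simp add: field_simps)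
      then have "3072 / (m * \<eta>\<^sup>2) \<le> m * \<eta> ^ 4 / 4096 / (m * \<eta>\<^sup>2)"
        using m_pos by (intro divide_right_mono) auto
      also have "m * \<eta> ^ 4 / 4096 / (m * \<eta>\<^sup>2) = (\<eta> / 64)\<^sup>2"
        using m_pos \<eta> by (simp add: power_divide power4_eq_xxxx power2_eq_square)
      also have "3072 / (m * \<eta>\<^sup>2) = 3 / m * (32 / \<eta>)\<^sup>2" by (simp add: power_divide)
      finally show ?thesis .
    qed
    finally show ?thesis by (rule power2_le_imp_le) (use \<eta> in simp)
  qed
  have \<tau>0: "0 \<le> \<tau>" unfolding \<tau>_def by (intro sum_nonneg) auto
  have size: "2 * M * (m div (4 * M\<^sup>2) + 1) + k * (4 * M\<^sup>2)\<^sup>2 \<le> c" if "m \<le> M * c" for c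
    using \<eta> M1 k1 m that by (rule box_count_bound)
  have n1: "1 \<le> n" using n2 by simp
  obtain \<rho> d D where \<rho>: "(n, \<rho>) \<in> P" "(planar_simple_transposition n ^^ d) \<pi> \<rho>"
    and d: "d \<le> 2 * (\<Sum>p\<in>{1..n}. D p)"
    and D: "\<forall>p\<in>{1..n}. \<forall>l\<le>L. m \<le> M * card {x \<in> {1..m}. cell n \<pi> l (f x) = cell n \<pi> l p} \<longrightarrow> D p * 2 ^ l \<le> 2 * n"
    using sample_approximation[OF P n1 \<pi> \<beta> f ord M1 k size, of L] by blast
  define bad where "bad l = {p \<in> {1..n}. l \<le> L \<and> M * card {x \<in> {1..m}. cell n \<pi> l (f x) = cell n \<pi> l p} < m}" for l
  define K where "K l = card ((\<lambda>x. cell n \<pi> l (f x)) ` {1..m})" for l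
  have \<pi>_in: "\<pi> p \<in> {1..n}" if "p \<in> {1..n}" for p using permutes_in_image[OF \<pi>] that by blast
  have bad0: "bad 0 = {}"
  proof -
    have z: "cell n \<pi> 0 p = (0, 0)" if "p \<in> {1..n}" for p
      using dyadic_less[OF that, of 0] dyadic_less[OF \<pi>_in[OF that], of 0] by (simp add: cell_def)
    have "cell n \<pi> 0 (f x) = cell n \<pi> 0 p" if "x \<in> {1..m}" "p \<in> {1..n}" for x p
    proof -
      have "f x \<in> {1..n}" using f(2) that(1) by blast
      then show ?thesis using z that(2) by metis
    qed
    then have "{x \<in> {1..m}. cell n \<pi> 0 (f x) = cell n \<pi> 0 p} = {1..m}" if "p \<in> {1..n}" for p
      using that by blast
    then have "card {x \<in> {1..m}. cell n \<pi> 0 (f x) = cell n \<pi> 0 p} = m" if "p \<in> {1..n}" for p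
      using that by (metis card_atLeastAtMost diff_Suc_1)
    moreover have "\<not> M * m < m" using M1 by simp
    ultimately show ?thesis unfolding bad_def by fastforce
  qed
  have bad_card: "real (card (bad l)) \<le> n * (K l / M + \<tau>)" if l: "l \<in> {1..L}" for l
  proof -
    let ?h = "\<lambda>(a, b). (a div 2 ^ (L - l), b div 2 ^ (L - l))"
    have h: "?h (cell n \<pi> L p) = cell n \<pi> l p" for p
      using l by (simp add: cell_def dyadic_coarsen[of l L])
    have sub: "cell n \<pi> L ` {1..n} \<subseteq> Z"
      unfolding Z_def using occupied_cells_le(1)[OF \<pi>, of "\<lambda>x. x" n L] by simp
    have "finite Z" by (simp add: Z_def)
    from light_cells_bound[of n m M f Z "cell n \<pi> L" ?h, OF _ _ _ f(2) this sub]
    have "real (card {p \<in> {1..n}. M * card {x \<in> {1..m}. cell n \<pi> l (f x) = cell n \<pi> l p} < m}) \<le> n * (K l / M + \<tau>)"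
      unfolding h K_def \<tau>_def \<delta>_def using n1 m_pos M1 by simp
    then show ?thesis using l unfolding bad_def by simp
  qed
  have "real (\<Sum>p\<in>{1..n}. D p) \<le> 2 * (real n)\<^sup>2 * (1 / 2 ^ L + 2 * (\<Sum>l\<in>{1..L}. (K l / M + \<tau>) / 2 ^ l))"
  proof (rule multiscale_sum_bound)
    show "D p * 2 ^ l \<le> 2 * n" if "p \<in> {1..n}" "l \<le> L" "p \<notin> bad l" for p l
      using D that unfolding bad_def by (simp add: not_less)
    show "bad l \<subseteq> {1..n}" for l unfolding bad_def by blast
  qed (use bad0 bad_card in auto)
  \<comment> \<open>The budget: \<open>\<eta> / 16\<close> for the finest scale, and twice
    \<open>\<eta> / 64 + \<eta> / 64\<close> for the light cells and the deviation of the
    sample.\<close>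
  moreover have "1 / 2 ^ L + 2 * (\<Sum>l\<in>{1..L}. (K l / M + \<tau>) / 2 ^ l) \<le> \<eta> / 8"
  proof -
    have "1 / 2 ^ L \<le> \<eta> / 16" using L(1) \<eta> by (simp add: field_simps)
    moreover have "(\<Sum>l\<in>{1..L}. (K l / M + \<tau>) / 2 ^ l) = (\<Sum>l\<in>{1..L}. K l / 2 ^ l) / M + \<tau> * (\<Sum>l\<in>{1..L}. 1 / 2 ^ l)"
      by (simp add: sum.distrib add_divide_distrib sum_distrib_left sum_divide_distrib mult.commute)
    moreover have "\<tau> * (\<Sum>l\<in>{1..L}. 1 / 2 ^ l) \<le> \<eta> / 64"
      using mult_left_mono[OF sum_half_powers_le_one \<tau>0, of L] \<tau> by linarith
    moreover have "(\<Sum>l\<in>{1..L}. K l / 2 ^ l) / M \<le> \<eta> / 64"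
    proof -
      have "(\<Sum>l\<in>{1..L}. K l / 2 ^ l) \<le> \<eta> / 64 * M"
        using M'
      proof
        assume a: "2000000 * c * Y\<^sup>2 / \<eta> \<le> M"
        \<comment> \<open>Every scale contributes at most \<open>c\<close>, so the number
          \<open>L\<close> of scales enters, which is logarithmic in
          \<open>1 / \<eta>\<close>.\<close>
        have "(\<Sum>l\<in>{1..L}. K l / 2 ^ l) \<le> (\<Sum>l\<in>{1..L}. c)"
        proof (rule sum_mono)
          fix l
          have "K l \<le> ex_ones (2 ^ l) \<sigma>"
            unfolding K_def using P(1) \<sigma>(1,2) \<beta> \<pi> f ord by (rule occupied_cells_le_ex_ones)
          then have "real (K l) \<le> real (ex_ones (2 ^ l) \<sigma>)" by simp
          also have "\<dots> \<le> c * 2 ^ l" using ex_ones_le_fh_const[OF \<sigma>(1,3), of "2 ^ l"] by (simp add: c_def)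
          finally show "K l / 2 ^ l \<le> c" by (simp add: field_simps)
        qed
        also have "\<dots> = c * L" by simp
        \<comment> \<open>From \<open>2 ^ L < 32 / \<eta>\<close> follows
          \<open>L \<le> 4 + Y\<close>, and \<open>Y \<ge> 2\<close> gives
          \<open>4 \<le> 2 * Y\<close>.\<close>
        also have "\<dots> \<le> c * (3 * Y)"
        proof (rule mult_left_mono)
          have "real L = log 2 (2 ^ L)" by simp
          also have "\<dots> \<le> log 2 (32 / \<eta>)" using L(2) \<eta> by (subst log_le_cancel_iff) auto
          also have "32 / \<eta> = 16 * inverse (\<eta> / 2)" using \<eta> by (simp add: field_simps)
          also have "log 2 (16 * inverse (\<eta> / 2)) = log 2 16 + log 2 (inverse (\<eta> / 2))"
            using \<eta> by (intro log_mult_pos) auto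
          also have "log 2 (inverse (\<eta> / 2)) = Y"
            unfolding Y_def by (rule log_inverse)
          also have "log 2 (16 :: real) = log 2 (2 ^ 4)" by simp
          also have "log 2 (2 ^ 4 :: real) = 4" by (subst log_nat_power) auto
          finally show "real L \<le> 3 * Y" using Y by linarith
        qed (use c in auto)
        also have "\<dots> \<le> \<eta> / 64 * (2000000 * c * Y\<^sup>2 / \<eta>)"
        proof -
          have "c * Y * 3 \<le> c * Y * (31250 * Y)" using c Y by (intro mult_left_mono) auto
          then show ?thesis using \<eta> by (simp add: power2_eq_square algebra_simps)
        qed
        also have "\<dots> \<le> \<eta> / 64 * M" using a \<eta> by (intro mult_left_mono) auto
        finally show ?thesis .
      next
        assume a: "20000 / \<eta>\<^sup>2 \<le> M"
        \<comment> \<open>With the trivial count \<open>4 ^ l\<close> the sum is geometric and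
          dominated by the finest scale, of order \<open>1 / \<eta>\<close>; hence the square in
          \<open>M2\<close>.\<close>
        have "(\<Sum>l\<in>{1..L}. K l / 2 ^ l) \<le> (\<Sum>l\<in>{1..L}. 2 ^ l :: real)"
        proof (rule sum_mono)
          fix l
          have "K l \<le> 4 ^ l" unfolding K_def using \<pi> f(2) by (rule occupied_cells_le(2))
          then have "real (K l) \<le> real (4 ^ l)" by (simp only: of_nat_le_iff)
          also have "real (4 ^ l) = 2 ^ l * 2 ^ l" by (simp flip: power_mult_distrib)
          finally show "K l / 2 ^ l \<le> 2 ^ l" by (simp add: field_simps)
        qed
        also have "\<dots> \<le> 2 * 2 ^ L" by (rule sum_powers_two_le)
        also have "\<dots> \<le> 2 * (32 / \<eta>)" using L(2) by simp
        also have "\<dots> \<le> \<eta> / 64 * (20000 / \<eta>\<^sup>2)" using \<eta> by (simp add: field_simps power2_eq_square)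
        also have "\<dots> \<le> \<eta> / 64 * M" using a \<eta> by (intro mult_left_mono) auto
        finally show ?thesis .
      qed
      then show ?thesis using M1 by (simp add: field_simps)
    qed
    ultimately show ?thesis by argo
  qed
  ultimately have "real (\<Sum>p\<in>{1..n}. D p) \<le> 2 * (real n)\<^sup>2 * (\<eta> / 8)"
    by (meson mult_left_mono order_trans zero_le_mult_iff zero_le_numeral zero_le_power2)
  then have "real d \<le> \<eta> / 2 * (real n)\<^sup>2"
    using d by (simp flip: of_nat_sum)
  \<comment> \<open>Since \<open>n \<ge> 2\<close>, one has \<open>n \<le> 2 * (n - 1)\<close>;
    dividing by \<open>n choose 2\<close> then leaves \<open>2 * \<eta>\<close>, which is
    \<open>\<epsilon>\<close> in the application.\<close>
  also have "\<dots> \<le> \<eta> / 2 * (2 * real n * (real n - 1))"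
    using n2 \<eta> by (intro mult_left_mono) (auto simp: power2_eq_square)
  also have "\<dots> = 2 * \<eta> * real (n choose 2)"
  proof -
    have "real (n choose 2) = real n * (real n - 1) / 2"
      using n2 by (simp add: choose_two real_of_nat_div of_nat_diff)
    then show ?thesis by simp
  qed
  finally have "rho_PT n \<pi> \<rho> \<le> 2 * \<eta>"
    using \<rho>(2) \<eta> by (intro rho_PT_le) auto
  then show ?thesis using \<rho>(1) P(2) by (intro dist_PT_le[of P "(n, \<rho>)"]) auto
qed

section \<open>Uniform random subsets and the tester\<close>

lemma card_subsets_containing:
  assumes "finite U" "T \<subseteq> U" "card T \<le> m"
  shows "card {S. S \<subseteq> U \<and> card S = m \<and> T \<subseteq> S} = (card U - card T) choose (m - card T)"
proof -
  have finT: "finite T" using assms finite_subset by blast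
  let ?A = "{R. R \<subseteq> U - T \<and> card R = m - card T}" and ?B = "{S. S \<subseteq> U \<and> card S = m \<and> T \<subseteq> S}"
  have "bij_betw (\<lambda>R. R \<union> T) ?A ?B"
  proof (rule bij_betwI[where g = "\<lambda>S. S - T"])
    show "(\<lambda>R. R \<union> T) \<in> ?A \<rightarrow> ?B"
    proof
      fix R assume "R \<in> ?A"
      then have R: "R \<subseteq> U - T" "card R = m - card T" by auto
      then have "finite R" using assms(1) finite_subset by blast
      then have "card (R \<union> T) = card R + card T" using R(1) finT by (intro card_Un_disjoint) auto
      then have "card (R \<union> T) = m" using R(2) assms(3) by simp
      then show "R \<union> T \<in> ?B" using R(1) assms(2) by blast
    qed
    show "(\<lambda>S. S - T) \<in> ?B \<rightarrow> ?A"
    proof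
      fix S assume "S \<in> ?B"
      then have S: "S \<subseteq> U" "card S = m" "T \<subseteq> S" by auto
      then have "card (S - T) = m - card T" using finT by (simp add: card_Diff_subset)
      then show "S - T \<in> ?A" using S(1) by blast
    qed
  qed blast+
  then have "card ?B = card ?A" by (rule bij_betw_same_card[symmetric])
  also have "\<dots> = (card (U - T)) choose (m - card T)" using assms(1) by (intro n_subsets) auto
  finally show ?thesis using finT assms(2) by (simp add: card_Diff_subset)
qed

lemma sum_card_Int:
  assumes "finite A" "finite F"
  shows "(\<Sum>S\<in>F. card (S \<inter> A)) = (\<Sum>a\<in>A. card {S \<in> F. a \<in> S})"
proof -
  have "(\<Sum>S\<in>F. card (S \<inter> A)) = (\<Sum>S\<in>F. \<Sum>a\<in>A. of_bool (a \<in> S))"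
  proof (rule sum.cong[OF refl])
    fix S
    have "card (S \<inter> A) = (\<Sum>a\<in>S \<inter> A. 1)" by simp
    also have "\<dots> = (\<Sum>a\<in>A. of_bool (a \<in> S))"
      by (rule sum.mono_neutral_cong_left) (use assms in auto)
    finally show "card (S \<inter> A) = (\<Sum>a\<in>A. of_bool (a \<in> S))" .
  qed
  also have "\<dots> = (\<Sum>a\<in>A. \<Sum>S\<in>F. of_bool (a \<in> S))" by (rule sum.swap)
  also have "\<dots> = (\<Sum>a\<in>A. card {S \<in> F. a \<in> S})"
  proof (rule sum.cong[OF refl])
    fix a
    have "card {S \<in> F. a \<in> S} = (\<Sum>S\<in>{S \<in> F. a \<in> S}. 1)" by simp
    also have "\<dots> = (\<Sum>S\<in>F. of_bool (a \<in> S))"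
      by (rule sum.mono_neutral_cong_left) (use assms in auto)
    finally show "(\<Sum>S\<in>F. of_bool (a \<in> S)) = card {S \<in> F. a \<in> S}" by simp
  qed
  finally show ?thesis .
qed

lemma sum_card_Int_square:
  assumes "finite A" "finite F"
  shows "(\<Sum>S\<in>F. (card (S \<inter> A))\<^sup>2) = (\<Sum>a\<in>A. \<Sum>b\<in>A. card {S \<in> F. {a, b} \<subseteq> S})"
proof -
  have "(\<Sum>S\<in>F. (card (S \<inter> A))\<^sup>2) = (\<Sum>S\<in>F. \<Sum>a\<in>A. of_bool (a \<in> S) * card (S \<inter> A))"
  proof (rule sum.cong[OF refl])
    fix S
    have "card (S \<inter> A) = (\<Sum>a\<in>S \<inter> A. 1)" by simp
    also have "\<dots> = (\<Sum>a\<in>A. of_bool (a \<in> S))"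
      by (rule sum.mono_neutral_cong_left) (use assms in auto)
    finally have "(card (S \<inter> A))\<^sup>2 = (\<Sum>a\<in>A. of_bool (a \<in> S)) * card (S \<inter> A)"
      by (simp add: power2_eq_square)
    then show "(card (S \<inter> A))\<^sup>2 = (\<Sum>a\<in>A. of_bool (a \<in> S) * card (S \<inter> A))"
      by (simp only: sum_distrib_right)
  qed
  also have "\<dots> = (\<Sum>a\<in>A. \<Sum>S\<in>F. of_bool (a \<in> S) * card (S \<inter> A))" by (rule sum.swap)
  also have "\<dots> = (\<Sum>a\<in>A. \<Sum>b\<in>A. card {S \<in> F. {a, b} \<subseteq> S})"
  proof (rule sum.cong[OF refl])
    fix a
    have "(\<Sum>S\<in>F. of_bool (a \<in> S) * card (S \<inter> A)) = (\<Sum>S\<in>{S \<in> F. a \<in> S}. card (S \<inter> A))"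
      by (rule sum.mono_neutral_cong_right) (use assms in auto)
    also have "\<dots> = (\<Sum>b\<in>A. card {S \<in> {S \<in> F. a \<in> S}. b \<in> S})"
      by (rule sum_card_Int) (use assms in auto)
    also have "\<dots> = (\<Sum>b\<in>A. card {S \<in> F. {a, b} \<subseteq> S})"
      by (rule sum.cong[OF refl], rule arg_cong[where f = card]) auto
    finally show "(\<Sum>S\<in>F. of_bool (a \<in> S) * card (S \<inter> A)) = (\<Sum>b\<in>A. card {S \<in> F. {a, b} \<subseteq> S})" .
  qed
  finally show ?thesis .
qed

text \<open>The number \<open>c2\<close> of samples through two given points is evaluated by applying the same
  double count to the whole of \<open>U\<close>.\<close>

lemma random_subset_variance:
  assumes U: "finite U" "card U = n" and m: "1 \<le> m" "m \<le> n" and A: "A \<subseteq> U"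
  defines "F \<equiv> {S. S \<subseteq> U \<and> card S = m}"
  shows "(\<Sum>S\<in>F. (card A / n - card (S \<inter> A) / m)\<^sup>2) \<le> card F * (card A / (real n * m))"
proof -
  have finF: "finite F" unfolding F_def using U(1) by simp
  obtain c1 where c1: "\<And>a. a \<in> U \<Longrightarrow> card {S \<in> F. a \<in> S} = c1"
  proof
    fix a assume "a \<in> U"
    have "{S \<in> F. a \<in> S} = {S. S \<subseteq> U \<and> card S = m \<and> {a} \<subseteq> S}" by (auto simp: F_def)
    then show "card {S \<in> F. a \<in> S} = (n - 1) choose (m - 1)"
      using card_subsets_containing[of U "{a}" m] U m(1) \<open>a \<in> U\<close> by simp
  qed
  obtain c2 where c2: "\<And>a b. a \<in> U \<Longrightarrow> b \<in> U \<Longrightarrow> a \<noteq> b \<Longrightarrow> card {S \<in> F. {a, b} \<subseteq> S} = c2"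
  proof
    fix a b assume ab: "a \<in> U" "b \<in> U" "a \<noteq> b"
    \<comment> \<open>For \<open>m = 1\<close> truncated subtraction would make the binomial
      coefficient \<open>1\<close>, although no sample contains two points.\<close>
    show "card {S \<in> F. {a, b} \<subseteq> S} = (if m = 1 then 0 else (n - 2) choose (m - 2))"
    proof (cases "m = 1")
      case True
      have "{S \<in> F. {a, b} \<subseteq> S} = {}" using True ab(3) by (auto simp: F_def card_1_singleton_iff)
      then have "card {S \<in> F. {a, b} \<subseteq> S} = 0" by (simp only: card.empty)
      then show ?thesis using True by simp
    next
      case False
      have "{S \<in> F. {a, b} \<subseteq> S} = {S. S \<subseteq> U \<and> card S = m \<and> {a, b} \<subseteq> S}" by (auto simp: F_def)
      then show ?thesis
        using card_subsets_containing[of U "{a, b}" m] U m(1) ab False by (simp add: numeral_2_eq_2)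
    qed
  qed
  have first: "(\<Sum>S\<in>F. card (S \<inter> B)) = card B * c1" if "B \<subseteq> U" for B
  proof -
    have "(\<Sum>S\<in>F. card (S \<inter> B)) = (\<Sum>a\<in>B. card {S \<in> F. a \<in> S})"
      using that U(1) finF finite_subset by (intro sum_card_Int) auto
    also have "\<dots> = (\<Sum>a\<in>B. c1)" using c1 that by (intro sum.cong) auto
    finally show ?thesis by simp
  qed
  have second: "(\<Sum>S\<in>F. (card (S \<inter> B))\<^sup>2) = card B * c1 + card B * (card B - 1) * c2" if B: "B \<subseteq> U" for B
  proof -
    have finB: "finite B" using B U(1) finite_subset by blast
    have "(\<Sum>S\<in>F. (card (S \<inter> B))\<^sup>2) = (\<Sum>a\<in>B. \<Sum>b\<in>B. card {S \<in> F. {a, b} \<subseteq> S})"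
      using finB finF by (rule sum_card_Int_square)
    also have "\<dots> = (\<Sum>a\<in>B. c1 + (card B - 1) * c2)"
    proof (rule sum.cong[OF refl])
      fix a assume a: "a \<in> B"
      have "(\<Sum>b\<in>B. card {S \<in> F. {a, b} \<subseteq> S}) = card {S \<in> F. {a, a} \<subseteq> S} + (\<Sum>b\<in>B - {a}. card {S \<in> F. {a, b} \<subseteq> S})"
        using finB a by (rule sum.remove)
      also have "(\<Sum>b\<in>B - {a}. card {S \<in> F. {a, b} \<subseteq> S}) = (\<Sum>b\<in>B - {a}. c2)"
      proof (rule sum.cong[OF refl])
        fix b assume "b \<in> B - {a}"
        then show "card {S \<in> F. {a, b} \<subseteq> S} = c2" using a B by (intro c2) auto
      qed
      also have "\<dots> = (card B - 1) * c2" using a finB by simp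
      also have "card {S \<in> F. {a, a} \<subseteq> S} = c1" using c1[of a] a B by auto
      finally show "(\<Sum>b\<in>B. card {S \<in> F. {a, b} \<subseteq> S}) = c1 + (card B - 1) * c2" .
    qed
    finally show ?thesis by (simp add: algebra_simps)
  qed
  have SU: "card (S \<inter> U) = m" if "S \<in> F" for S
  proof -
    have "S \<inter> U = S" "card S = m" using that unfolding F_def by auto
    then show ?thesis by simp
  qed
  have "(\<Sum>S\<in>F. card (S \<inter> U)) = card F * m" using SU by simp
  then have e1: "real (card F) * m = real n * c1" using first[of U] U(2) by (simp flip: of_nat_mult)
  have "(\<Sum>S\<in>F. (card (S \<inter> U))\<^sup>2) = card F * m\<^sup>2" using SU by simp
  then have "card F * m\<^sup>2 = n * c1 + n * (n - 1) * c2" using second[of U] U(2) by simp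
  then have "real (card F * m\<^sup>2) = real (n * c1 + n * (n - 1) * c2)" by simp
  then have e2: "real (card F) * (real m * (real m - 1)) = real n * (real n - 1) * c2"
  proof -
    have "real (n - 1) = real n - 1" using m by simp
    then have "real (n * c1 + n * (n - 1) * c2) = real n * c1 + real n * (real n - 1) * c2"
      by (simp only: of_nat_add of_nat_mult)
    then have "real (card F) * (real m * real m) = real n * c1 + real n * (real n - 1) * c2"
      using \<open>real (card F * m\<^sup>2) = _\<close> by (simp only: of_nat_mult power2_eq_square)
    then show ?thesis using e1 by (simp add: right_diff_distrib)
  qed
  define a where "a = card A"
  have an: "a \<le> n" unfolding a_def using A U card_mono by blast
  have n: "0 < real n" "0 < real m" using m by auto
  have c1_eq: "real c1 = card F * m / n" using e1 n by (simp add: field_simps)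
  \<comment> \<open>Sampling without replacement is negatively correlated:
    \<open>(a - 1) / (n - 1) \<le> a / n\<close>. The case \<open>a \<le> 1\<close> is apart because
    \<open>n - 1\<close> may vanish there.\<close>
  have pairs: "real (a * (a - 1) * c2) \<le> card F * (a * m / n)\<^sup>2"
  proof (cases "a \<le> 1")
    case True
    then have "a * (a - 1) = 0" by auto
    then have z: "real (a * (a - 1) * c2) = 0" by (simp only: mult_zero_left of_nat_0)
    show ?thesis unfolding z by simp
  next
    case False
    then have n1: "0 < real n - 1" using an by simp
    have "real (a * (a - 1) * c2) * (real n * (real n - 1)) = card F * (a * (real a - 1)) * (m * (real m - 1))"
    proof -
      have "real (a - 1) = real a - 1" using False by simp
      then have "real (a * (a - 1) * c2) = real a * (real a - 1) * c2" by (simp only: of_nat_mult)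
      then have "real (a * (a - 1) * c2) * (real n * (real n - 1))
          = real a * (real a - 1) * (real n * (real n - 1) * c2)" by (simp only: mult_ac)
      then show ?thesis unfolding e2[symmetric] by (simp only: mult_ac)
    qed
    then have "real (a * (a - 1) * c2) = card F * ((a / n) * ((real a - 1) / (real n - 1)) * (m * (real m - 1)))"
      using n n1 by (simp add: field_simps)
    also have "\<dots> \<le> card F * ((a / n) * (a / n) * (m * m))"
    proof -
      have "(real a - 1) / (real n - 1) \<le> a / n" using n n1 an by (simp add: field_simps)
      moreover have "real m - 1 \<le> real m" by simp
      ultimately show ?thesis
        using n n1 False m by (intro mult_left_mono mult_mono) auto
    qed
    also have "\<dots> = card F * (a * m / n)\<^sup>2" by (simp add: power2_eq_square)
    finally show ?thesis .
  qed
  have "(\<Sum>S\<in>F. (a / n - card (S \<inter> A) / m)\<^sup>2)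
      = (\<Sum>S\<in>F. (a / n)\<^sup>2 - 2 * (a / n) / m * real (card (S \<inter> A)) + 1 / m\<^sup>2 * real ((card (S \<inter> A))\<^sup>2))"
    by (intro sum.cong refl) (simp add: power2_diff power_divide)
  also have "\<dots> = card F * (a / n)\<^sup>2 - 2 * (a / n) / m * real (\<Sum>S\<in>F. card (S \<inter> A)) + 1 / m\<^sup>2 * real (\<Sum>S\<in>F. (card (S \<inter> A))\<^sup>2)"
    by (simp only: sum.distrib sum_subtractf sum_distrib_left[symmetric] of_nat_sum sum_constant)
  also have "\<dots> = card F * (a / n)\<^sup>2 - 2 * (a / n) / m * (a * c1) + 1 / m\<^sup>2 * (real a * c1 + real (a * (a - 1) * c2))"
    unfolding first[OF A] second[OF A] a_def by simp
  also have "\<dots> \<le> card F * (a / n)\<^sup>2 - 2 * (a / n) / m * (a * c1) + 1 / m\<^sup>2 * (real a * c1 + card F * (a * m / n)\<^sup>2)"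
    using pairs by (intro add_left_mono mult_left_mono) auto
  \<comment> \<open>The terms in \<open>(a / n)\<^sup>2\<close> cancel; the diagonal term with
    \<open>c1\<close> remains.\<close>
  also have "\<dots> = card F * (a / (real n * m))"
    unfolding c1_eq using n e1 by (simp add: field_simps power2_eq_square)
  finally show ?thesis unfolding a_def .
qed

text \<open>The variances of the single cells add up to at most \<open>1 / m\<close>, however many
  cells there are, because the cells partition \<open>U\<close>. Markov's inequality at three times
  this value leaves probability \<open>2 / 3\<close>.\<close>

lemma random_subset_discrepancy:
  fixes g :: "'a \<Rightarrow> 'b"
  assumes U: "finite U" "card U = n" and m: "1 \<le> m" "m \<le> n" and Z: "finite Z" "g ` U \<subseteq> Z"
  defines "F \<equiv> {S. S \<subseteq> U \<and> card S = m}"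
  defines "V \<equiv> \<lambda>S. \<Sum>z\<in>Z. (real (card {p \<in> U. g p = z}) / n - card {p \<in> S. g p = z} / m)\<^sup>2"
  shows "2 / 3 \<le> card {S \<in> F. V S \<le> 3 / m} / card F"
proof -
  have finF: "finite F" unfolding F_def using U(1) by simp
  have V0: "0 \<le> V S" for S unfolding V_def by (intro sum_nonneg) auto
  have "(\<Sum>S\<in>F. V S) = (\<Sum>z\<in>Z. \<Sum>S\<in>F. (real (card {p \<in> U. g p = z}) / n - card (S \<inter> {p \<in> U. g p = z}) / m)\<^sup>2)"
  proof -
    have eq: "S \<inter> {p \<in> U. g p = z} = {p \<in> S. g p = z}" if "S \<in> F" for S z
      using that unfolding F_def by auto
    have "(\<Sum>S\<in>F. V S) = (\<Sum>S\<in>F. \<Sum>z\<in>Z. (real (card {p \<in> U. g p = z}) / n - card (S \<inter> {p \<in> U. g p = z}) / m)\<^sup>2)"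
      unfolding V_def using eq by (intro sum.cong refl) simp
    also have "\<dots> = (\<Sum>z\<in>Z. \<Sum>S\<in>F. (real (card {p \<in> U. g p = z}) / n - card (S \<inter> {p \<in> U. g p = z}) / m)\<^sup>2)"
      by (rule sum.swap)
    finally show ?thesis .
  qed
  also have "\<dots> \<le> (\<Sum>z\<in>Z. card F * (card {p \<in> U. g p = z} / (real n * m)))"
    unfolding F_def using U m by (intro sum_mono random_subset_variance) auto
  also have "\<dots> = card F * (real (\<Sum>z\<in>Z. card {p \<in> U. g p = z}) / (real n * m))"
    by (simp add: sum_distrib_left sum_divide_distrib)
  also have "(\<Sum>z\<in>Z. card {p \<in> U. g p = z}) = n"
    using card_eq_sum_fibres[OF U(1) Z] U(2) by simp
  finally have le: "(\<Sum>S\<in>F. V S) \<le> card F / m" using m by simp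
  let ?B = "{S \<in> F. \<not> V S \<le> 3 / m}"
  have "card ?B * (3 / m) = (\<Sum>S\<in>?B. 3 / real m)" by simp
  also have "\<dots> \<le> (\<Sum>S\<in>?B. V S)" by (intro sum_mono) auto
  also have "\<dots> \<le> (\<Sum>S\<in>F. V S)" using finF V0 by (intro sum_mono2) auto
  finally have "card ?B * (3 / real m) \<le> card F / m" using le by linarith
  then have B: "3 * real (card ?B) \<le> card F" using m by (simp add: field_simps)
  have "card F = card ({S \<in> F. V S \<le> 3 / m} \<union> ?B)" by (rule arg_cong[where f = card]) auto
  also have "\<dots> = card {S \<in> F. V S \<le> 3 / m} + card ?B" using finF by (intro card_Un_disjoint) auto
  finally have "real (card F) = real (card {S \<in> F. V S \<le> 3 / m}) + real (card ?B)" by simp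
  then have "2 * real (card F) \<le> 3 * real (card {S \<in> F. V S \<le> 3 / m})" using B by linarith
  moreover have "card F > 0"
    unfolding F_def using n_subsets[OF U(1), of m] U(2) m(2) by simp
  ultimately show ?thesis by (simp add: field_simps)
qed

section \<open>The sampling tester\<close>

text \<open>Nonadaptive algorithms: the queries are fixed in advance, and only the verdict
  \<open>d\<close> depends on the answers.\<close>

primrec ask :: "nat list \<Rightarrow> (nat list \<Rightarrow> verdict) \<Rightarrow> query_alg" where
  "ask [] d = Output (d [])"
| "ask (i # is) d = Query i (\<lambda>v. ask is (\<lambda>vs. d (v # vs)))"

lemma run_ask: "run (ask is d) \<pi> = d (map \<pi> is)"
  by (induction "is" arbitrary: d) auto

lemma queries_ask: "queries (ask is d) \<pi> = is"
  by (induction "is" arbitrary: d) auto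

text \<open>The test compares answers with each other only, so it is a function of the queried
  values, as a verdict must be.\<close>

definition pattern_verdict :: "perm set \<Rightarrow> nat list \<Rightarrow> verdict" where
  "pattern_verdict P vs = (if \<exists>\<beta>\<in>P. len \<beta> = length vs \<and>
     (\<forall>x\<in>{1..len \<beta>}. \<forall>y\<in>{1..len \<beta>}. app \<beta> x < app \<beta> y \<longleftrightarrow> vs ! (x - 1) < vs ! (y - 1))
     then In_Property else Not_In_Property)"

text \<open>Meaningful for \<open>m \<le> n\<close>, where the set of samples is nonempty as
  \<open>pmf_of_set\<close> requires.\<close>

definition sampling_tester :: "perm set \<Rightarrow> nat \<Rightarrow> randomized_alg" where
  "sampling_tester P m n =
     map_pmf (\<lambda>S. ask (sorted_list_of_set S) (pattern_verdict P)) (pmf_of_set {S. S \<subseteq> {1..n} \<and> card S = m})"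

lemma sampling_tester_correct:
  assumes P: "hereditary P" "P \<subseteq> perms" and m: "1 \<le> m"
    and sound: "\<And>n \<pi>. \<pi> permutes {1..n} \<Longrightarrow> m \<le> n \<Longrightarrow> \<epsilon> < dist_PT (n, \<pi>) P \<Longrightarrow>
      2 / 3 \<le> card {S. S \<subseteq> {1..n} \<and> card S = m \<and>
        pattern_verdict P (map \<pi> (sorted_list_of_set S)) = Not_In_Property} / card {S. S \<subseteq> {1..n} \<and> card S = m}"
  shows "one_sided_tester P \<epsilon> m m (sampling_tester P m)"
  unfolding one_sided_tester_def
proof (intro ballI impI)
  fix \<pi> :: perm assume \<pi>: "\<pi> \<in> perms" "m \<le> len \<pi>"
  define F where "F = {S. S \<subseteq> {1..len \<pi>} \<and> card S = m}"
  have finF: "finite F" unfolding F_def by simp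
  have "card F > 0" unfolding F_def using n_subsets[of "{1..len \<pi>}" m] \<pi>(2) by simp
  then have neF: "F \<noteq> {}" by auto
  define t where "t S = ask (sorted_list_of_set S) (pattern_verdict P)" for S
  have A: "sampling_tester P m (len \<pi>) = map_pmf t (pmf_of_set F)"
    unfolding sampling_tester_def t_def F_def ..
  have supp: "set_pmf (sampling_tester P m (len \<pi>)) = t ` F"
    unfolding A using neF finF by simp
  have run: "run (t S) (app \<pi>) = pattern_verdict P (map (app \<pi>) (sorted_list_of_set S))" for S
    unfolding t_def by (rule run_ask)
  show "(\<forall>t\<in>set_pmf (sampling_tester P m (len \<pi>)).
            length (queries t (app \<pi>)) \<le> m \<and> set (queries t (app \<pi>)) \<subseteq> {1..len \<pi>}) \<and>
        (\<pi> \<in> P \<longrightarrow> (\<forall>t\<in>set_pmf (sampling_tester P m (len \<pi>)). run t (app \<pi>) = In_Property)) \<and>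
        (eps_far \<epsilon> \<pi> P \<longrightarrow>
           2 / 3 \<le> measure_pmf.prob (sampling_tester P m (len \<pi>)) {t. run t (app \<pi>) = Not_In_Property})"
  proof (intro conjI impI)
    show "\<forall>t\<in>set_pmf (sampling_tester P m (len \<pi>)).
            length (queries t (app \<pi>)) \<le> m \<and> set (queries t (app \<pi>)) \<subseteq> {1..len \<pi>}"
      unfolding supp
    proof clarify
      fix S assume "S \<in> F"
      then have "finite S" "card S = m" "S \<subseteq> {1..len \<pi>}" unfolding F_def by (auto dest: finite_subset)
      then show "length (queries (t S) (app \<pi>)) \<le> m \<and> set (queries (t S) (app \<pi>)) \<subseteq> {1..len \<pi>}"
        unfolding t_def queries_ask by simp
    qed
  next
    assume \<pi>P: "\<pi> \<in> P"
    show "\<forall>t\<in>set_pmf (sampling_tester P m (len \<pi>)). run t (app \<pi>) = In_Property"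
      unfolding supp
    proof clarify
      fix S assume "S \<in> F"
      then have S: "finite S" "card S = m" "S \<subseteq> {1..len \<pi>}" unfolding F_def by (auto dest: finite_subset)
      define f where "f x = sorted_list_of_set S ! (x - 1)" for x
      note f = sorted_list_of_set_enum[OF S(1,2), folded f_def]
      have range: "f ` {1..m} \<subseteq> {1..len \<pi>}" using f(2) S(3) by simp
      obtain \<rho> where \<rho>: "(m, \<rho>) \<in> P" "\<rho> permutes {1..m}"
        "\<forall>i\<in>{1..m}. \<forall>j\<in>{1..m}. \<rho> i < \<rho> j \<longleftrightarrow> app \<pi> (f i) < app \<pi> (f j)"
        by (rule hereditary_pattern[OF P(1) \<pi>P \<pi>(1) m f(1) range])
      have nth: "map (app \<pi>) (sorted_list_of_set S) ! (x - 1) = app \<pi> (f x)" if "x \<in> {1..m}" for x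
      proof -
        have "x - 1 < length (sorted_list_of_set S)" using that S by auto
        then show ?thesis unfolding f_def by (rule nth_map)
      qed
      show "run (t S) (app \<pi>) = In_Property"
        unfolding run pattern_verdict_def
        by (rule if_P, rule bexI[OF _ \<rho>(1)]) (use \<rho>(3) nth S in simp)
    qed
  next
    assume "eps_far \<epsilon> \<pi> P"
    then have "\<epsilon> < dist_PT (len \<pi>, app \<pi>) P" by (simp add: eps_far_def)
    moreover have "app \<pi> permutes {1..len \<pi>}" using \<pi>(1) by (simp add: perms_def)
    ultimately have "2 / 3 \<le> card {S. S \<subseteq> {1..len \<pi>} \<and> card S = m \<and>
        pattern_verdict P (map (app \<pi>) (sorted_list_of_set S)) = Not_In_Property} / card F"
      unfolding F_def using \<pi>(2) by (intro sound)
    also have "{S. S \<subseteq> {1..len \<pi>} \<and> card S = m \<and>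
        pattern_verdict P (map (app \<pi>) (sorted_list_of_set S)) = Not_In_Property}
        = F \<inter> t -` {t. run t (app \<pi>) = Not_In_Property}"
      unfolding F_def by (auto simp: run)
    finally show "2 / 3 \<le> measure_pmf.prob (sampling_tester P m (len \<pi>)) {t. run t (app \<pi>) = Not_In_Property}"
      unfolding A using measure_pmf_of_set[OF neF finF] by simp
  qed
qed

lemma len_excluded_ge_two:
  assumes "hereditary P" "P \<subseteq> perms" "P \<noteq> {}" "\<sigma> \<in> perms" "\<sigma> \<notin> P"
  shows "2 \<le> len \<sigma>"
proof (rule ccontr)
  assume "\<not> 2 \<le> len \<sigma>"
  then have l: "len \<sigma> = 1" using assms(4) by (auto simp: perms_def)
  obtain \<pi> where \<pi>: "\<pi> \<in> P" using assms(3) by blast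
  then have "1 \<le> len \<pi>" using assms(2) by (auto simp: perms_def)
  then have "subpermutation \<sigma> \<pi>"
    unfolding subpermutation_def l by (intro exI[of _ id]) (auto simp: strict_mono_on_def)
  then show False using assms \<pi> unfolding hereditary_def by blast
qed

text \<open>For the degenerate cases: always rejecting is one-sided if \<open>P\<close> is empty,
  and always accepting is sound if nothing is far.\<close>

lemma constant_tester:
  assumes "v = In_Property \<or> P = {}"
    and "\<And>\<pi>. \<pi> \<in> perms \<Longrightarrow> eps_far \<epsilon> \<pi> P \<Longrightarrow> v = Not_In_Property"
  shows "one_sided_tester P \<epsilon> q n0 (\<lambda>_. return_pmf (Output v))"
  using assms unfolding one_sided_tester_def by (auto simp: indicator_def)

lemma dyadic_scale:
  fixes x :: real
  assumes "1 \<le> x"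
  obtains L :: nat where "x \<le> 2 ^ L" "2 ^ L < 2 * x"
proof -
  define L where "L = (LEAST L :: nat. x \<le> 2 ^ L)"
  have "\<exists>L :: nat. x \<le> 2 ^ L" using real_arch_pow[of 2 x] by (auto intro: less_imp_le)
  then have 1: "x \<le> 2 ^ L" unfolding L_def by (rule LeastI_ex)
  have "2 ^ L < 2 * x"
  proof (cases L)
    case 0
    then show ?thesis using assms by simp
  next
    case (Suc l)
    then have "\<not> x \<le> 2 ^ l" using not_less_Least[of l "\<lambda>L. x \<le> 2 ^ L"] unfolding L_def by auto
    then show ?thesis using Suc by simp
  qed
  then show ?thesis using 1 that by blast
qed

theorem theorem1p9:
  fixes P :: "perm set" and \<epsilon> C :: real and \<sigma> :: perm and M' :: nat
  assumes "permutation_property P" and "hereditary P"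
    and "\<epsilon> > 0"
    and "smallest_excluded P \<sigma>"
    and "C = 1000 * fh_const \<sigma>"
    and "enat M' = min (n_zero P (M1 C (\<epsilon> / 2)) (\<epsilon> / 2)) (n_zero P (M2 (\<epsilon> / 2)) (\<epsilon> / 2))"
  shows "\<exists>A. one_sided_tester P \<epsilon> M' M' A"
proof -
  have P: "hereditary P" "P \<subseteq> perms" using assms(1,2) by (auto simp: permutation_property_def)
  have \<sigma>: "\<sigma> \<in> perms" "\<sigma> \<notin> P" using assms(4) by (auto simp: smallest_excluded_def)
  \<comment> \<open>For empty \<open>P\<close> the excluded \<open>\<sigma>\<close> has length
    \<open>1\<close>, outside the range of the bounds on \<open>fh_const\<close>; for
    \<open>\<epsilon> \<ge> 1\<close> the bound \<open>\<eta> < 1 / 2\<close> fails.\<close>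
  consider "P = {}" | "1 \<le> \<epsilon>" | "P \<noteq> {}" "\<epsilon> < 1" by linarith
  then show ?thesis
  proof cases
    case 1
    then show ?thesis using constant_tester[of Not_In_Property P] by blast
  next
    case 2
    have "\<not> eps_far \<epsilon> \<pi> P" if "\<pi> \<in> perms" for \<pi>
      using dist_PT_le_one[OF P(2) that] 2 by (simp add: eps_far_def)
    then show ?thesis using constant_tester[of In_Property P \<epsilon>] by blast
  next
    case 3
    define \<eta> where "\<eta> = \<epsilon> / 2"
    have \<eta>: "0 < \<eta>" "\<eta> < 1 / 2" using assms(3) 3(2) by (auto simp: \<eta>_def)
    have len: "2 \<le> len \<sigma>" using len_excluded_ge_two[OF P 3(1) \<sigma>] .
    have fh: "1 \<le> fh_const \<sigma>" using fh_const_ge_one[OF \<sigma>(1) len] .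
    have "0 < 2000 * C / \<eta> * (log 2 (\<eta> / 2))\<^sup>2"
    proof -
      have "log 2 (\<eta> / 2) < 0" using \<eta> by (subst log_less_zero_cancel_iff) auto
      then have "0 < (log 2 (\<eta> / 2))\<^sup>2" by simp
      moreover have "0 < 2000 * C / \<eta>" using \<eta> fh assms(5) by simp
      ultimately show ?thesis by (rule mult_pos_pos[rotated])
    qed
    then have m1: "M1 C \<eta> \<noteq> 0" "2000 * C / \<eta> * (log 2 (\<eta> / 2))\<^sup>2 \<le> M1 C \<eta>"
      unfolding M1_def by (auto simp: real_nat_ceiling_ge)
    have "0 < 20000 / \<eta>\<^sup>2" using \<eta> by simp
    then have m2: "M2 \<eta> \<noteq> 0" "20000 / \<eta>\<^sup>2 \<le> M2 \<eta>"
      unfolding M2_def by (auto simp: real_nat_ceiling_ge)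
    \<comment> \<open>The minimum is one of the two values; what survives of the choice is the lower
      bound on \<open>M\<close> that belongs to it.\<close>
    obtain M where M: "M \<noteq> 0" "2000 * (1000 * fh_const \<sigma>) / \<eta> * (log 2 (\<eta> / 2))\<^sup>2 \<le> M \<or> 20000 / \<eta>\<^sup>2 \<le> M"
      and nz: "enat M' = n_zero P M \<eta>"
    proof -
      have "enat M' = n_zero P (M1 C \<eta>) \<eta> \<or> enat M' = n_zero P (M2 \<eta>) \<eta>"
        using assms(6) unfolding \<eta>_def by (simp add: min_def split: if_splits)
      then show ?thesis using that m1 m2 assms(5) by blast
    qed
    \<comment> \<open>Finiteness of \<open>M'\<close> enters here: with \<open>M \<noteq> 0\<close>,
      an infinite \<open>kstar P M\<close> would make \<open>n_zero\<close> infinite.\<close>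
    obtain k where k: "kstar P M = enat k"
      using nz M(1) by (cases "kstar P M") (auto simp: n_zero_def)
    have "M' = nat \<lceil>32 * real M ^ 5 * real k / \<eta> ^ 3\<rceil>"
      using nz M(1) k by (simp add: n_zero_def)
    then have m: "32 * real M ^ 5 * real k / \<eta> ^ 3 \<le> M'" by (simp add: real_nat_ceiling_ge)
    have "0 < 32 * real M ^ 5 * real k / \<eta> ^ 3" using M(1) kstar_pos[OF k] \<eta> by simp
    then have m1: "1 \<le> M'" using m by (cases M') auto
    \<comment> \<open>The grid is fine enough for the displacement at the last scale and, up to a
      factor of two, no finer, which keeps the number of cells small.\<close>
    have "1 \<le> 16 / \<eta>" using \<eta> by simp
    then obtain L :: nat where L: "16 / \<eta> \<le> 2 ^ L" "2 ^ L < 2 * (16 / \<eta>)" by (rule dyadic_scale)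
    have "one_sided_tester P \<epsilon> M' M' (sampling_tester P M')"
    proof (rule sampling_tester_correct[OF P m1])
      fix n \<pi> assume \<pi>: "\<pi> permutes {1..n}" and n: "M' \<le> n" and far: "\<epsilon> < dist_PT (n, \<pi>) P"
      define F where "F = {S. S \<subseteq> {1..n} \<and> card S = M'}"
      define Z where "Z = {..<2 ^ L :: nat} \<times> {..<2 ^ L :: nat}"
      define V where "V S = (\<Sum>z\<in>Z. (real (card {p \<in> {1..n}. cell n \<pi> L p = z}) / n
         - card {p \<in> S. cell n \<pi> L p = z} / M')\<^sup>2)" for S
      have finF: "finite F" unfolding F_def by simp
      have "cell n \<pi> L ` {1..n} \<subseteq> Z"
        unfolding Z_def using occupied_cells_le(1)[OF \<pi>, of "\<lambda>x. x" n L] by simp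
      moreover have "finite Z" by (simp add: Z_def)
      ultimately have "2 / 3 \<le> card {S \<in> F. V S \<le> 3 / M'} / card F"
        unfolding F_def V_def using m1 n by (intro random_subset_discrepancy) auto
      also have "\<dots> \<le> card {S. S \<subseteq> {1..n} \<and> card S = M' \<and>
          pattern_verdict P (map \<pi> (sorted_list_of_set S)) = Not_In_Property} / card F"
      proof (intro divide_right_mono of_nat_mono card_mono)
        show "finite {S. S \<subseteq> {1..n} \<and> card S = M' \<and>
          pattern_verdict P (map \<pi> (sorted_list_of_set S)) = Not_In_Property}"
          using finF unfolding F_def by (rule rev_finite_subset) blast
        show "{S \<in> F. V S \<le> 3 / M'} \<subseteq> {S. S \<subseteq> {1..n} \<and> card S = M' \<and>
          pattern_verdict P (map \<pi> (sorted_list_of_set S)) = Not_In_Property}"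
        proof clarify
          fix S assume SF: "S \<in> F" and V: "V S \<le> 3 / M'"
          then have S: "finite S" "card S = M'" "S \<subseteq> {1..n}" unfolding F_def by (auto dest: finite_subset)
          define f where "f x = sorted_list_of_set S ! (x - 1)" for x
          note f = sorted_list_of_set_enum[OF S(1,2), folded f_def]
          have nth: "map \<pi> (sorted_list_of_set S) ! (x - 1) = \<pi> (f x)" if "x \<in> {1..M'}" for x
          proof -
            have "x - 1 < length (sorted_list_of_set S)" using that S by auto
            then show ?thesis unfolding f_def by (rule nth_map)
          qed
          \<comment> \<open>A sample with small deviation must be rejected: acceptance would supply
            a \<open>\<beta>\<close> in \<open>P\<close> and hence distance at most
            \<open>2 * \<eta> = \<epsilon>\<close>.\<close>
          have "pattern_verdict P (map \<pi> (sorted_list_of_set S)) \<noteq> In_Property"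
          proof
            assume "pattern_verdict P (map \<pi> (sorted_list_of_set S)) = In_Property"
            then have "\<exists>\<beta>\<in>P. len \<beta> = length (map \<pi> (sorted_list_of_set S)) \<and>
              (\<forall>x\<in>{1..len \<beta>}. \<forall>y\<in>{1..len \<beta>}. app \<beta> x < app \<beta> y \<longleftrightarrow>
                 map \<pi> (sorted_list_of_set S) ! (x - 1) < map \<pi> (sorted_list_of_set S) ! (y - 1))"
              unfolding pattern_verdict_def by (metis verdict.distinct(1))
            then obtain \<beta> where \<beta>: "\<beta> \<in> P" "len \<beta> = M'"
              and ord: "\<forall>x\<in>{1..M'}. \<forall>y\<in>{1..M'}. app \<beta> x < app \<beta> y \<longleftrightarrow> \<pi> (f x) < \<pi> (f y)"
              using S nth by auto
            have s: "card {x \<in> {1..M'}. cell n \<pi> L (f x) = z} = card {p \<in> S. cell n \<pi> L p = z}" for z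
            proof -
              have "inj_on f {1..M'}" using f(1) strict_mono_on_imp_inj_on by blast
              then have "inj_on f {x \<in> {1..M'}. cell n \<pi> L (f x) = z}" by (rule inj_on_subset) blast
              then have "card {x \<in> {1..M'}. cell n \<pi> L (f x) = z} = card (f ` {x \<in> {1..M'}. cell n \<pi> L (f x) = z})"
                by (rule card_image[symmetric])
              also have "f ` {x \<in> {1..M'}. cell n \<pi> L (f x) = z} = {p \<in> S. cell n \<pi> L p = z}"
                unfolding f(2)[symmetric] by blast
              finally show ?thesis .
            qed
            have "dist_PT (n, \<pi>) P \<le> 2 * \<eta>"
            proof (rule close_to_property[OF P \<sigma> len \<eta> \<pi> k M(2) m \<beta> f(1)])
              show "f ` {1..M'} \<subseteq> {1..n}" using f(2) S(3) by simp
              show "app \<beta> x < app \<beta> y \<longleftrightarrow> \<pi> (f x) < \<pi> (f y)" if "x \<in> {1..M'}" "y \<in> {1..M'}" for x y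
                using ord that by blast
              show "(\<Sum>z\<in>{..<2 ^ L} \<times> {..<2 ^ L}. (real (card {p \<in> {1..n}. cell n \<pi> L p = z}) / n
                - real (card {x \<in> {1..M'}. cell n \<pi> L (f x) = z}) / M')\<^sup>2) \<le> 3 / M'"
                using V unfolding V_def Z_def s .
            qed (use L in auto)
            then show False using far by (simp add: \<eta>_def)
          qed
          then have "pattern_verdict P (map \<pi> (sorted_list_of_set S)) = Not_In_Property"
            by (metis verdict.exhaust)
          then show "S \<subseteq> {1..n} \<and> card S = M' \<and>
            pattern_verdict P (map \<pi> (sorted_list_of_set S)) = Not_In_Property" using S by blast
        qed
      qed auto
      finally show "2 / 3 \<le> card {S. S \<subseteq> {1..n} \<and> card S = M' \<and>
        pattern_verdict P (map \<pi> (sorted_list_of_set S)) = Not_In_Property} / card {S. S \<subseteq> {1..n} \<and> card S = M'}"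
        unfolding F_def .
    qed
    then show ?thesis by blast
  qed
qed

end
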